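(* Let $u\ne0$ be a (real or complex) parameter. For $j=1,2$ let $\alpha_j$ be a point at infinity with $\mathrm{Re}(u\alpha_j)=(-1)^j\infty$, and let $\Xi_j(u,\alpha_j)$ comprise the set of points $\xi$ for which there is a progressive path $\mathcal{L}_j$ linking $\xi$ with $\alpha_j$ in $\Delta$, that is, one having the properties (i) $\mathcal{L}_j$ consists of a finite chain of $R_2$ arcs, and (ii) as $t$ passes along $\mathcal{L}_j$ from $\alpha_j$ to $\xi$, the real part of $(-1)^jut$ is nonincreasing. Assume that all integrals below converge. Then the differential equation $$\frac{d^2W}{d\xi^2}=\{u^2+\psi(\xi)\}W$$ has solutions $$W_1(u,\xi)=\exp\{S_n(u,\xi)-S_n(u,\alpha_1)\}\{e^{u\xi}+\varepsilon_{n,1}(u,\xi)\},$$ $$W_2(u,\xi)=\exp\{S_n(-u,\xi)-S_n(-u,\alpha_2)\}\{e^{-u\xi}+\varepsilon_{n,2}(u,\xi)\},$$ which are independent of the positive integer $n$, and whose error terms satisfy, for any positive integer $r$: for $\xi\in\Xi_1(u,\alpha_1)$, $$\begin{aligned}|e^{-u\xi}\varepsilon_{n,1}(u,\xi)|\le{}&\left|\exp\left\{\sum_{s=n}^{n+r-1}\frac{E_s(\xi)-E_s(\alpha_1)}{u^s}\right\}-1\right|\\&+\frac{1}{|u|^{n+r}}\int_{\alpha_1}^{\xi}|\chi_{n+r}(u,t)\,dt|\;\exp\Bigg\{\frac{4}{|u|}\int_{\alpha_1}^{\xi}|T_{n+r}(u,t)\,dt|\\&\quad+\frac{1}{|u|^{n+r}}\int_{\alpha_1}^{\xi}|\chi_{n+r}(u,t)\,dt|+\mathrm{Re}\sum_{s=n}^{n+r-1}\frac{E_s(\xi)-E_s(\alpha_1)}{u^s}\Bigg\},\end{aligned}$$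 and for $\xi\in\Xi_2(u,\alpha_2)$, $$\begin{aligned}|e^{u\xi}\varepsilon_{n,2}(u,\xi)|\le{}&\left|\exp\left\{\sum_{s=n}^{n+r-1}(-1)^s\frac{E_s(\xi)-E_s(\alpha_2)}{u^s}\right\}-1\right|\\&+\frac{1}{|u|^{n+r}}\int_{\alpha_2}^{\xi}|\chi_{n+r}(-u,t)\,dt|\;\exp\Bigg\{\frac{4}{|u|}\int_{\alpha_2}^{\xi}|T_{n+r}(-u,t)\,dt|\\&\quad+\frac{1}{|u|^{n+r}}\int_{\alpha_2}^{\xi}|\chi_{n+r}(-u,t)\,dt|+\mathrm{Re}\sum_{s=n}^{n+r-1}(-1)^s\frac{E_s(\xi)-E_s(\alpha_2)}{u^s}\Bigg\},\end{aligned}$$ where the integrals from $\alpha_j$ to $\xi$ are taken along $\mathcal{L}_j$.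
   Context: $\Delta$ is an unbounded complex domain in the $\xi$-plane and $\psi$ is a function analytic in $\Delta$, independent of $u$. (It arises from the equation $d^2w/dz^2=\{u^2f(z)+g(z)\}w$, with $f,g$ meromorphic and $f$ without zeros, via $\xi=\int f^{1/2}(z)\,dz$, $W=f^{1/4}(z)w$, which gives $\psi=\dfrac{4ff''-5f'^2}{16f^3}+\dfrac{g}{f}$.) Coefficients: $F_1=\tfrac12\psi$, $F_2=-\tfrac14\psi'$, and $$F_{s+1}(\xi)=-\frac12\frac{dF_s(\xi)}{d\xi}-\frac12\sum_{j=1}^{s-1}F_j(\xi)F_{s-j}(\xi)\quad(s=2,3,4,\dots).$$ $E_s(\xi)=\int F_s(\xi)\,d\xi$ ($s=1,2,3,\dots$) is an antiderivative of $F_s$, and $$S_n(u,\xi)=\sum_{s=1}^{n-1}\frac{E_s(\xi)}{u^s},\qquad T_n(u,\xi)=\sum_{s=0}^{n-2}\frac{F_{s+1}(\xi)}{u^s},$$ $$\chi_n(u,\xi)=2F_n(\xi)-\sum_{s=1}^{n-1}\frac{G_{n,s}(\xi)}{u^s},\qquad G_{n,s}(\xi)=\sum_{k=s}^{n-1}F_k(\xi)F_{s+n-k-1}(\xi).$$ Empty sums are zero. An $R_2$ arc is an arc with a parametrization $t=t(\tau)$ for which $t''(\tau)$ is continuous and $t'(\tau)$ does not vanish. $\int|h(t)\,dt|$ denotes integration with respect to arc length. The point $\alpha_j$ is the infinite end of a fixed unbounded $R_2$ arc in $\Delta$, and all paths $\mathcal{L}_j$ coincide with that arc near $\alpha_j$;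 $\mathrm{Re}(u\alpha_j)=(-1)^j\infty$ means $\mathrm{Re}(ut)\to(-1)^j\infty$ as $t\to\alpha_j$ along it. $E_s(\alpha_j)$ and $S_n(\pm u,\alpha_j)$ denote the limits as $\xi\to\alpha_j$ along the path, which are assumed to exist (this being part of the assumption on convergence of integrals, $E_s(\xi)-E_s(\alpha_j)=\int_{\alpha_j}^{\xi}F_s(t)\,dt$). If $\Delta$ is not simply connected, $E_s$ and the solutions are understood as analytically continued along $\mathcal{L}_j$. *)

theory Defs
  imports "HOL-Complex_Analysis.Complex_Analysis"
begin

(* The value at index 0 is a dummy; the sums below never use it. *)
fun F_coeff :: "(complex \<Rightarrow> complex) \<Rightarrow> nat \<Rightarrow> complex \<Rightarrow> complex" where
  "F_coeff \<psi> 0 = (\<lambda>\<xi>. 0)"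
| "F_coeff \<psi> (Suc 0) = (\<lambda>\<xi>. \<psi> \<xi> / 2)"
| "F_coeff \<psi> (Suc (Suc 0)) = (\<lambda>\<xi>. - deriv \<psi> \<xi> / 4)"
| "F_coeff \<psi> (Suc (Suc (Suc k))) = (\<lambda>\<xi>.
     - (1 / 2) * deriv (F_coeff \<psi> (k + 2)) \<xi>
     - (1 / 2) * (\<Sum>j = 1..k + 1. F_coeff \<psi> j \<xi> * F_coeff \<psi> (k + 2 - j) \<xi>))"

definition T_fun :: "(complex \<Rightarrow> complex) \<Rightarrow> nat \<Rightarrow> complex \<Rightarrow> complex \<Rightarrow> complex" where
  "T_fun \<psi> n u \<xi> = (\<Sum>s<n - 1. F_coeff \<psi> (s + 1) \<xi> / u ^ s)"

definition G_fun :: "(complex \<Rightarrow> complex) \<Rightarrow> nat \<Rightarrow> nat \<Rightarrow> complex \<Rightarrow> complex" where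
  "G_fun \<psi> n s \<xi> = (\<Sum>k = s..n - 1. F_coeff \<psi> k \<xi> * F_coeff \<psi> (s + n - k - 1) \<xi>)"

definition chi_fun :: "(complex \<Rightarrow> complex) \<Rightarrow> nat \<Rightarrow> complex \<Rightarrow> complex \<Rightarrow> complex" where
  "chi_fun \<psi> n u \<xi> = 2 * F_coeff \<psi> n \<xi> - (\<Sum>s = 1..n - 1. G_fun \<psi> n s \<xi> / u ^ s)"

(* S_n as a function of the values e s of the antiderivatives E_s at one point, finite or infinite. *)
definition S_sum :: "(nat \<Rightarrow> complex) \<Rightarrow> nat \<Rightarrow> complex \<Rightarrow> complex" where
  "S_sum e n u = (\<Sum>s = 1..n - 1. e s / u ^ s)"

definition R2_arc_on :: "(real \<Rightarrow> complex) \<Rightarrow> real set \<Rightarrow> bool" where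
  "R2_arc_on \<gamma> I \<longleftrightarrow> (\<exists>\<gamma>' \<gamma>''.
     (\<forall>\<tau>\<in>I. (\<gamma> has_vector_derivative \<gamma>' \<tau>) (at \<tau> within I) \<and> \<gamma>' \<tau> \<noteq> 0 \<and>
             (\<gamma>' has_vector_derivative \<gamma>'' \<tau>) (at \<tau> within I)) \<and>
     continuous_on I \<gamma>'')"

(* The arc A is parametrized by [0, \<infinity>), with the parameter increasing towards the infinite
   end \<alpha>_j; the last condition is Re (u \<alpha>_j) = (-1)^j \<infinity>. *)
definition arc_to_infinity :: "complex set \<Rightarrow> (real \<Rightarrow> complex) \<Rightarrow> nat \<Rightarrow> complex \<Rightarrow> bool" where
  "arc_to_infinity \<Delta> A j u \<longleftrightarrow> R2_arc_on A {0..} \<and> A ` {0..} \<subseteq> \<Delta> \<and>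
     filterlim (\<lambda>\<tau>. (-1) ^ j * Re (u * A \<tau>)) at_top at_top"

(* A path in \<Delta> linking \<gamma> a with the infinite end of A is parametrized by [a, \<infinity>), with the
   finite endpoint at parameter a.  The starting parameter a is left free so that the path can use
   the parametrization of A itself near infinity. *)
definition linking_path ::
  "complex set \<Rightarrow> (real \<Rightarrow> complex) \<Rightarrow> (real \<Rightarrow> complex) \<Rightarrow> real \<Rightarrow> bool" where
  "linking_path \<Delta> A \<gamma> a \<longleftrightarrow> \<gamma> ` {a..} \<subseteq> \<Delta> \<and>
     (\<exists>(k::nat) p. p 0 = a \<and>
        (\<forall>i<k. p i < p (Suc i) \<and> R2_arc_on \<gamma> {p i..p (Suc i)}) \<and> R2_arc_on \<gamma> {p k..}) \<and>
     (\<forall>\<^sub>F \<tau> in at_top. \<gamma> \<tau> = A \<tau>)"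

(* Since the parameter decreases as t passes from infinity to the finite endpoint, nonincreasing
   along the path means nondecreasing in the parameter. *)
definition progressive_path ::
  "complex set \<Rightarrow> (real \<Rightarrow> complex) \<Rightarrow> nat \<Rightarrow> complex \<Rightarrow> (real \<Rightarrow> complex) \<Rightarrow> real \<Rightarrow> bool" where
  "progressive_path \<Delta> A j u \<gamma> a \<longleftrightarrow> linking_path \<Delta> A \<gamma> a \<and>
     mono_on {a..} (\<lambda>\<tau>. Re ((-1) ^ j * u * \<gamma> \<tau>))"

definition Xi :: "complex set \<Rightarrow> (real \<Rightarrow> complex) \<Rightarrow> nat \<Rightarrow> complex \<Rightarrow> complex set" where
  "Xi \<Delta> A j u = {\<xi>. \<exists>\<gamma> a. progressive_path \<Delta> A j u \<gamma> a \<and> \<gamma> a = \<xi>}"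

(* The integral of |h(t) dt| from infinity to \<gamma> a, with respect to arc length.  The integrand is
   nonnegative, so integrability on the half line is convergence of the improper integral; the
   finitely many corners of \<gamma> form a null set. *)
definition arclength_integrable ::
  "(complex \<Rightarrow> complex) \<Rightarrow> (real \<Rightarrow> complex) \<Rightarrow> real \<Rightarrow> bool" where
  "arclength_integrable h \<gamma> a \<longleftrightarrow>
     (\<lambda>\<tau>. norm (h (\<gamma> \<tau>)) * norm (vector_derivative \<gamma> (at \<tau>))) integrable_on {a..}"

definition arclength_integral ::
  "(complex \<Rightarrow> complex) \<Rightarrow> (real \<Rightarrow> complex) \<Rightarrow> real \<Rightarrow> real" where
  "arclength_integral h \<gamma> a =
     integral {a..} (\<lambda>\<tau>. norm (h (\<gamma> \<tau>)) * norm (vector_derivative \<gamma> (at \<tau>)))"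

(* f \<tau> is a function element at \<gamma> \<tau>; only its germ there is relevant. *)
definition continued_along ::
  "(real \<Rightarrow> complex) \<Rightarrow> real \<Rightarrow> (real \<Rightarrow> complex \<Rightarrow> complex) \<Rightarrow> bool" where
  "continued_along \<gamma> a f \<longleftrightarrow>
     (\<forall>\<tau>\<ge>a. f \<tau> analytic_on {\<gamma> \<tau>} \<and>
        (\<forall>\<^sub>F \<sigma> in at \<tau> within {a..}. \<forall>\<^sub>F z in nhds (\<gamma> \<sigma>). f \<sigma> z = f \<tau> z))"

(* A possibly multivalued analytic function on \<Delta>: the element at \<gamma> \<tau> reached by continuation
   along the path \<gamma> from infinity.  A single-valued f is the branched function \<lambda>\<gamma> \<tau>. f. *)
type_synonym branched = "(real \<Rightarrow> complex) \<Rightarrow> real \<Rightarrow> complex \<Rightarrow> complex"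

definition value_at_end :: "branched \<Rightarrow> (real \<Rightarrow> complex) \<Rightarrow> real \<Rightarrow> complex" where
  "value_at_end f \<gamma> a = f \<gamma> a (\<gamma> a)"

definition value_at_infinity :: "branched \<Rightarrow> (real \<Rightarrow> complex) \<Rightarrow> complex" where
  "value_at_infinity f \<gamma> = Lim at_top (\<lambda>\<tau>. f \<gamma> \<tau> (\<gamma> \<tau>))"

definition limit_at_infinity_exists :: "branched \<Rightarrow> (real \<Rightarrow> complex) \<Rightarrow> bool" where
  "limit_at_infinity_exists f \<gamma> \<longleftrightarrow> (\<exists>l. ((\<lambda>\<tau>. f \<gamma> \<tau> (\<gamma> \<tau>)) \<longlongrightarrow> l) at_top)"

(* Different branches may carry different additive constants. *)
definition branched_antiderivative ::
  "complex set \<Rightarrow> (real \<Rightarrow> complex) \<Rightarrow> (complex \<Rightarrow> complex) \<Rightarrow> branched \<Rightarrow> bool" where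
  "branched_antiderivative \<Delta> A h f \<longleftrightarrow>
     (\<forall>\<gamma> a. linking_path \<Delta> A \<gamma> a \<longrightarrow> continued_along \<gamma> a (f \<gamma>) \<and>
        (\<forall>\<tau>\<ge>a. \<forall>\<^sub>F z in nhds (\<gamma> \<tau>). (f \<gamma> \<tau> has_field_derivative h z) (at z)))"

(* One solution of W'' = (u^2 + \<psi>) W: all branches agree with each other along A near infinity,
   and the solution is an ordinary holomorphic function on \<Delta> if \<Delta> is simply connected. *)
definition branched_solution ::
  "complex set \<Rightarrow> (real \<Rightarrow> complex) \<Rightarrow> (complex \<Rightarrow> complex) \<Rightarrow> complex \<Rightarrow> branched \<Rightarrow> bool" where
  "branched_solution \<Delta> A \<psi> u W \<longleftrightarrow>
     (\<forall>\<gamma> a. linking_path \<Delta> A \<gamma> a \<longrightarrow> continued_along \<gamma> a (W \<gamma>) \<and>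
        (\<forall>\<tau>\<ge>a. \<forall>\<^sub>F z in nhds (\<gamma> \<tau>).
           deriv (deriv (W \<gamma> \<tau>)) z = (u\<^sup>2 + \<psi> z) * W \<gamma> \<tau> z) \<and>
        (\<forall>\<^sub>F \<tau> in at_top. \<forall>\<^sub>F z in nhds (A \<tau>). W \<gamma> \<tau> z = W A \<tau> z)) \<and>
     (simply_connected \<Delta> \<longrightarrow>
        (\<exists>w. w holomorphic_on \<Delta> \<and>
           (\<forall>\<gamma> a. linking_path \<Delta> A \<gamma> a \<longrightarrow> (\<forall>\<^sub>F z in nhds (\<gamma> a). W \<gamma> a z = w z))))"

end

(* The solution is characterised by its recessive behaviour at the infinite end.  Put P = u + T_n/u and
   Phi = exp (u xi + S_n(xi) - S_n(alpha)); substituting W = Phi (1 + h) gives h'' + 2 P h' = u^(1-n) chi_n (1 + h).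
   Written as two Duhamel integrals from alpha to xi, whose kernels are bounded on a progressive path, this
   equation controls h and h'/u by Gronwall's inequality, for every n at once, as soon as h and h' vanish at
   alpha.  The case n = 1 also produces the solution: solutions that agree with e^(u xi) to first order at a
   point R of the arc have bounded data at a fixed point by the same estimate, and a limit point of these
   data as R tends to infinity belongs to a recessive solution. *)

theory Submission
  imports Defs
begin

section \<open>Linear second-order equations in the complex domain\<close>

text \<open>The normalisation e^(-u xi) W -> 1 and e^(-u xi) (W' - u W) -> 0 at the infinite end
  does not mention n, which is why one W serves every n. It yields h -> 0, but h' also contains T_n,
  whose limit is unknown; so each estimate starts at a finite R where the data are small, and their
  size is sent to 0 afterwards. The factor u^(1-n) chi_n is the residual of P in the Riccati
  equation P' + P^2 = u^2 + psi, an algebraic consequence of the recursion for the coefficients. The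
  number r enters only at the end: the estimate is made for N = n + r, and the terms s = n, ..., n +
  r - 1 are then moved out of Phi_N. This produces the first summand of the bound and the real part
  in the exponent. Since \<Delta> may be multiply connected and paths may have corners, a solution
  is carried as a pair (value, derivative) along a real parameter and is turned into germs only
  where a branch is asked for.\<close>

lemma norm_primitive_le:
  fixes F f :: "complex \<Rightarrow> complex"
  assumes K: "convex K" "z0 \<in> K" "z \<in> K"
    and der: "\<And>w. w \<in> K \<Longrightarrow> (F has_field_derivative f w) (at w)"
    and F0: "F z0 = 0"
    and bnd: "\<And>w. w \<in> K \<Longrightarrow> norm (f w) \<le> B * exp (l * norm (w - z0))"
    and "l > 0" "B \<ge> 0"
  shows "norm (F z) \<le> B / l * exp (l * norm (z - z0))"
proof -
  define d where "d = norm (z - z0)"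
  define c where "c t = z0 + of_real t * (z - z0)" for t :: real
  have cK: "c t \<in> K" if "0 \<le> t" "t \<le> 1" for t
  proof -
    have "c t = (1 - t) *\<^sub>R z0 + t *\<^sub>R z"
      by (simp add: c_def scaleR_conv_of_real algebra_simps)
    then show ?thesis using convexD_alt[OF K(1,2,3) that] by metis
  qed
  have dc: "(c has_vector_derivative (z - z0)) (at t)" for t
    unfolding c_def by (auto intro!: derivative_eq_intros simp: has_vector_derivative_def scaleR_conv_of_real fun_eq_iff)
  have dF: "((\<lambda>t. F (c t)) has_vector_derivative (z - z0) * f (c t)) (at t)"
    if "0 \<le> t" "t \<le> 1" for t
    using field_vector_diff_chain_at[OF dc der[OF cK[OF that]]] by (simp add: o_def)
  have nc: "norm (c t - z0) = t * d" if "0 \<le> t" for t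
    using that by (simp add: c_def d_def norm_mult)
  \<comment> \<open>Along the segment the weight \<open>exp (l * (t * d))\<close>, taken with
    respect to arc length, has a primitive smaller by the factor 1/l. A large l therefore makes
    Picard iteration contract on a whole convex compact set instead of a small disc.\<close>
  have "norm (F (c 1) - F (c 0)) \<le> B / l * exp (l * (1 * d)) - B / l * exp (l * (0 * d))"
  proof (rule differentiable_bound_general[where f = "\<lambda>t. F (c t)" and \<phi> = "\<lambda>t. B / l * exp (l * (t * d))"
      and f' = "\<lambda>t. (z - z0) * f (c t)" and \<phi>' = "\<lambda>t. d * (B * exp (l * (t * d)))"])
    show "continuous_on {0..1} (\<lambda>t. F (c t))"
      using dF has_vector_derivative_continuous by (fastforce intro: continuous_at_imp_continuous_on)
    show "((\<lambda>t. B / l * exp (l * (t * d))) has_vector_derivative d * (B * exp (l * (t * d)))) (at t)" for t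
      using \<open>l > 0\<close> unfolding has_real_derivative_iff_has_vector_derivative[symmetric]
      by (auto intro!: derivative_eq_intros)
    show "norm ((z - z0) * f (c t)) \<le> d * (B * exp (l * (t * d)))" if "0 < t" "t < 1" for t
    proof -
      have "norm (f (c t)) \<le> B * exp (l * (t * d))"
        using bnd[OF cK[of t]] nc[of t] that by simp
      then show ?thesis by (simp add: norm_mult d_def mult_left_mono)
    qed
  qed (use dF \<open>l > 0\<close> in \<open>auto intro!: continuous_intros\<close>)
  moreover have "c 1 = z" "c 0 = z0" by (auto simp: c_def)
  ultimately show ?thesis using F0 assms(7,8)
    by (simp add: d_def) (smt (verit) divide_nonneg_pos)
qed

lemma holomorphic_primitive_at_base:
  assumes "convex S" "open S" "f holomorphic_on S"
  shows "\<exists>g. g z0 = 0 \<and> (\<forall>z\<in>S. (g has_field_derivative f z) (at z))"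
proof -
  obtain g where g: "\<And>x. x \<in> S \<Longrightarrow> (g has_field_derivative f x) (at x within S)"
    by (rule holomorphic_convex_primitive'[OF assms]) (rule that)
  have "((\<lambda>z. g z - g z0) has_field_derivative f z) (at z)" if "z \<in> S" for z
    using DERIV_diff[OF g[OF that] DERIV_const[of "g z0"]] by (simp add: at_within_open[OF that assms(2)])
  then show ?thesis by (intro exI[of _ "\<lambda>z. g z - g z0"]) auto
qed

text \<open>Picard iteration written as a series: \<open>a n\<close> and \<open>b n\<close> are the
  n-th corrections, each the primitive of a coefficient times the previous correction of the other
  component, and the sums of the corrections form the solution.\<close>

lemma linear_system_convex:
  fixes m1 m2 :: "complex \<Rightarrow> complex"
  assumes S: "convex S" "open S" and m: "m1 holomorphic_on S" "m2 holomorphic_on S" and z0: "z0 \<in> S"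
  shows "\<exists>v p. v z0 = c0 \<and> p z0 = c1 \<and>
     (\<forall>z\<in>S. (v has_field_derivative m1 z * p z) (at z) \<and> (p has_field_derivative m2 z * v z) (at z))"
proof -
  define I where "I f = (SOME g. g z0 = 0 \<and> (\<forall>z\<in>S. (g has_field_derivative f z) (at z)))" for f
  have I: "I f z0 = 0" "\<And>z. z \<in> S \<Longrightarrow> (I f has_field_derivative f z) (at z)"
    if "f holomorphic_on S" for f
    using someI_ex[OF holomorphic_primitive_at_base[OF S that, of z0]] unfolding I_def by blast+
  define d where "d = rec_nat (\<lambda>z. c0, \<lambda>z. c1)
    (\<lambda>_ (a, b). (I (\<lambda>z. m1 z * b z), I (\<lambda>z. m2 z * a z)))"
  define a b where "a n = fst (d n)" and "b n = snd (d n)" for n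
  have ab0: "a 0 = (\<lambda>z. c0)" "b 0 = (\<lambda>z. c1)" by (auto simp: a_def b_def d_def)
  have abS: "a (Suc n) = I (\<lambda>z. m1 z * b n z)" "b (Suc n) = I (\<lambda>z. m2 z * a n z)" for n
    by (simp_all add: a_def b_def d_def case_prod_unfold)
  have hol: "a n holomorphic_on S \<and> b n holomorphic_on S" for n
  proof (induction n)
    case (Suc n)
    have "(\<lambda>z. m1 z * b n z) holomorphic_on S" "(\<lambda>z. m2 z * a n z) holomorphic_on S"
      using Suc m by (auto intro!: holomorphic_intros)
    from I(2)[OF this(1)] I(2)[OF this(2)] show ?case
      unfolding abS using \<open>open S\<close> by (auto simp: holomorphic_on_open)
  qed (simp add: ab0)
  have mh: "(\<lambda>z. m1 z * b n z) holomorphic_on S" "(\<lambda>z. m2 z * a n z) holomorphic_on S" for n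
    using hol m by (auto intro!: holomorphic_intros)
  have da: "(a (Suc n) has_field_derivative m1 z * b n z) (at z)"
    and db: "(b (Suc n) has_field_derivative m2 z * a n z) (at z)" if "z \<in> S" for n z
    unfolding abS using I(2)[OF mh(1) that] I(2)[OF mh(2) that] by auto
  have ab_z0: "a (Suc n) z0 = 0" "b (Suc n) z0 = 0" for n
    unfolding abS using I(1)[OF mh(1)] I(1)[OF mh(2)] by auto
  have ex: "\<exists>r h. 0 < r \<and> summable h \<and>
      (\<forall>n. \<forall>y\<in>ball x r \<inter> S. norm (a n y) \<le> h n \<and> norm (b n y) \<le> h n)" if x: "x \<in> S" for x
  proof -
    obtain r where r: "r > 0" "cball x r \<subseteq> S"
      using \<open>open S\<close> x open_contains_cball by blast
    \<comment> \<open>Compact, convex, and containing the base point together with a neighbourhood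
      of \<open>x\<close>: segments from \<open>z0\<close> stay inside, and the coefficients are
      bounded there.\<close>
    define K where "K = convex hull (insert z0 (cball x r))"
    have K: "compact K" "convex K" "z0 \<in> K" "cball x r \<subseteq> K"
      unfolding K_def using hull_subset[of "insert z0 (cball x r)" convex]
      by (auto intro!: compact_convex_hull)
    have "K \<subseteq> S"
      unfolding K_def by (rule hull_minimal) (use r z0 S in auto)
    have "bounded (m1 ` K \<union> m2 ` K)"
      using m K(1) by (intro bounded_Un[THEN iffD2] conjI compact_imp_bounded compact_continuous_image
          holomorphic_on_imp_continuous_on holomorphic_on_subset[OF _ \<open>K \<subseteq> S\<close>]) auto
    then obtain C where "C > 0" and "\<forall>y\<in>m1 ` K \<union> m2 ` K. norm y \<le> C"
      unfolding bounded_pos by blast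
    then have C: "norm (m1 y) \<le> C" "norm (m2 y) \<le> C" if "y \<in> K" for y using that by auto
    define D where "D = max (norm c0) (norm c1)"
    \<comment> \<open>The rate is 2C because a coefficient of size C costs a factor C and the
      integration returns 1/(2C), so each correction is half the preceding one in this
      weight.\<close>
    define e where "e y = exp (2 * C * norm (y - z0))" for y
    have e1: "1 \<le> e y" for y unfolding e_def using \<open>C > 0\<close> by simp
    have ind: "\<forall>y\<in>K. norm (a n y) \<le> D / 2 ^ n * e y \<and> norm (b n y) \<le> D / 2 ^ n * e y" for n
    proof (induction n)
      case 0
      have "D \<ge> 0" unfolding D_def by (meson max.coboundedI1 norm_ge_zero)
      then have "D \<le> D * e y" for y using mult_left_mono[OF e1[of y]] by simp
      moreover have "norm c0 \<le> D" "norm c1 \<le> D" unfolding D_def by auto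
      ultimately show ?case by (simp add: ab0) (meson order_trans)
    next
      case (Suc n)
      have D0: "D \<ge> 0" unfolding D_def by (meson max.coboundedI1 norm_ge_zero)
      have "norm (a (Suc n) y) \<le> (C * (D / 2 ^ n)) / (2 * C) * exp (2 * C * norm (y - z0))" if "y \<in> K" for y
      proof (rule norm_primitive_le[OF K(2,3) that])
        show "(a (Suc n) has_field_derivative m1 w * b n w) (at w)" if "w \<in> K" for w
          using da \<open>K \<subseteq> S\<close> that by blast
        show "norm (m1 w * b n w) \<le> C * (D / 2 ^ n) * exp (2 * C * norm (w - z0))" if "w \<in> K" for w
          using mult_mono[OF C(1)[OF that] Suc[rule_format, OF that, THEN conjunct2]] \<open>C > 0\<close>
          by (simp add: norm_mult e_def mult.assoc)
      qed (use ab_z0 \<open>C > 0\<close> D0 in auto)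
      moreover have "norm (b (Suc n) y) \<le> (C * (D / 2 ^ n)) / (2 * C) * exp (2 * C * norm (y - z0))" if "y \<in> K" for y
      proof (rule norm_primitive_le[OF K(2,3) that])
        show "(b (Suc n) has_field_derivative m2 w * a n w) (at w)" if "w \<in> K" for w
          using db \<open>K \<subseteq> S\<close> that by blast
        show "norm (m2 w * a n w) \<le> C * (D / 2 ^ n) * exp (2 * C * norm (w - z0))" if "w \<in> K" for w
          using mult_mono[OF C(2)[OF that] Suc[rule_format, OF that, THEN conjunct1]] \<open>C > 0\<close>
          by (simp add: norm_mult e_def mult.assoc)
      qed (use ab_z0 \<open>C > 0\<close> D0 in auto)
      ultimately show ?case using \<open>C > 0\<close> by (simp add: e_def field_simps)
    qed
    have "bounded (e ` K)" unfolding e_def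
      by (intro compact_imp_bounded compact_continuous_image continuous_intros K)
    then obtain M where M: "\<And>y. y \<in> K \<Longrightarrow> norm (e y) \<le> M" unfolding bounded_iff by blast
    have "D \<ge> 0" unfolding D_def by (meson max.coboundedI1 norm_ge_zero)
    then have "norm (a n y) \<le> D * M * (1 / 2) ^ n \<and> norm (b n y) \<le> D * M * (1 / 2) ^ n" if "y \<in> K" for n y
    proof -
      have "e y \<le> M" using M[OF that] by (simp add: e_def)
      then have "D / 2 ^ n * e y \<le> D / 2 ^ n * M" using \<open>D \<ge> 0\<close> by (intro mult_left_mono) auto
      moreover have "D / 2 ^ n * M = D * M * (1 / 2) ^ n" by (simp add: power_one_over field_simps)
      ultimately show ?thesis using ind[of n] that by (metis order_trans)
    qed
    moreover have "summable (\<lambda>n. D * M * (1 / 2 :: real) ^ n)" by (intro summable_mult summable_geometric) auto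
    moreover have "ball x r \<inter> S \<subseteq> K" using K(4) by auto
    ultimately show ?thesis using \<open>r > 0\<close> subsetD
      by (intro exI[of _ r] exI[of _ "\<lambda>n. D * M * (1 / 2 :: real) ^ n"]) blast
  qed
  then have loc: "\<exists>r h. 0 < r \<and> summable h \<and> (\<forall>\<^sub>F n in sequentially. \<forall>y\<in>ball x r \<inter> S. norm (a n y) \<le> h n)"
    "\<exists>r h. 0 < r \<and> summable h \<and> (\<forall>\<^sub>F n in sequentially. \<forall>y\<in>ball x r \<inter> S. norm (b n y) \<le> h n)"
    if "x \<in> S" for x
  proof -
    from ex[OF that] obtain r h where rh: "0 < r" "summable h"
      "\<forall>n. \<forall>y\<in>ball x r \<inter> S. norm (a n y) \<le> h n \<and> norm (b n y) \<le> h n" by blast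
    then show "\<exists>r h. 0 < r \<and> summable h \<and> (\<forall>\<^sub>F n in sequentially. \<forall>y\<in>ball x r \<inter> S. norm (a n y) \<le> h n)"
      "\<exists>r h. 0 < r \<and> summable h \<and> (\<forall>\<^sub>F n in sequentially. \<forall>y\<in>ball x r \<inter> S. norm (b n y) \<le> h n)"
      by (intro exI[of _ r] exI[of _ h] conjI always_eventually; blast)+
  qed
  \<comment> \<open>The index shift matters: the constant term of index 0 contributes derivative 0,
    so the sum of the derivatives is again \<open>m1\<close> times the full sum of the
    \<open>b n\<close>.\<close>
  define a' where "a' n z = (case n of 0 \<Rightarrow> 0 | Suc k \<Rightarrow> m1 z * b k z)" for n z
  define b' where "b' n z = (case n of 0 \<Rightarrow> 0 | Suc k \<Rightarrow> m2 z * a k z)" for n z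
  have da': "(a n has_field_derivative a' n z) (at z)" if "z \<in> S" for n z
    using da[OF that] by (cases n) (auto simp: a'_def ab0)
  have db': "(b n has_field_derivative b' n z) (at z)" if "z \<in> S" for n z
    using db[OF that] by (cases n) (auto simp: b'_def ab0)
  have "\<exists>g g'. \<forall>x\<in>S. ((\<lambda>n. a n x) sums g x) \<and> ((\<lambda>n. a' n x) sums g' x) \<and> (g has_field_derivative g' x) (at x)"
    by (rule series_and_derivative_comparison_local[OF \<open>open S\<close> da' loc(1)])
  then obtain g g' where g: "\<And>x. x \<in> S \<Longrightarrow> ((\<lambda>n. a n x) sums g x)" "\<And>x. x \<in> S \<Longrightarrow> ((\<lambda>n. a' n x) sums g' x)"
     "\<And>x. x \<in> S \<Longrightarrow> (g has_field_derivative g' x) (at x)" by blast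
  have "\<exists>g g'. \<forall>x\<in>S. ((\<lambda>n. b n x) sums g x) \<and> ((\<lambda>n. b' n x) sums g' x) \<and> (g has_field_derivative g' x) (at x)"
    by (rule series_and_derivative_comparison_local[OF \<open>open S\<close> db' loc(2)])
  then obtain h h' where h: "\<And>x. x \<in> S \<Longrightarrow> ((\<lambda>n. b n x) sums h x)" "\<And>x. x \<in> S \<Longrightarrow> ((\<lambda>n. b' n x) sums h' x)"
     "\<And>x. x \<in> S \<Longrightarrow> (h has_field_derivative h' x) (at x)" by blast
  have g': "g' x = m1 x * h x" if "x \<in> S" for x
  proof -
    have "(\<lambda>n. a' (Suc n) x) sums (m1 x * h x)"
      using sums_mult[OF h(1)[OF that]] by (simp add: a'_def)
    then have "(\<lambda>n. a' n x) sums (m1 x * h x)"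
      by (subst (asm) sums_Suc_iff) (simp add: a'_def)
    with g(2)[OF that] show ?thesis by (rule sums_unique2)
  qed
  have h': "h' x = m2 x * g x" if "x \<in> S" for x
  proof -
    have "(\<lambda>n. b' (Suc n) x) sums (m2 x * g x)"
      using sums_mult[OF g(1)[OF that]] by (simp add: b'_def)
    then have "(\<lambda>n. b' n x) sums (m2 x * g x)"
      by (subst (asm) sums_Suc_iff) (simp add: b'_def)
    with h(2)[OF that] show ?thesis by (rule sums_unique2)
  qed
  have "(\<lambda>n. a n z0) sums a 0 z0" "(\<lambda>n. b n z0) sums b 0 z0"
    using sums_finite[of "{0}" "\<lambda>n. a n z0"] sums_finite[of "{0}" "\<lambda>n. b n z0"] ab_z0
    by (auto simp: gr0_conv_Suc)
  then have "g z0 = c0" "h z0 = c1"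
    using g(1)[OF z0] h(1)[OF z0] ab0 by (auto dest: sums_unique2)
  with g(3) h(3) g' h' show ?thesis by (intro exI[of _ g] exI[of _ h]) auto
qed

section \<open>Wronskian, uniqueness and global existence\<close>

definition solves_on ::
  "(complex \<Rightarrow> complex) \<Rightarrow> complex set \<Rightarrow> (complex \<Rightarrow> complex) \<Rightarrow> (complex \<Rightarrow> complex) \<Rightarrow> bool" where
  "solves_on q S v p \<longleftrightarrow>
     (\<forall>z\<in>S. (v has_field_derivative p z) (at z) \<and> (p has_field_derivative q z * v z) (at z))"

lemma solves_on_subset: "solves_on q S v p \<Longrightarrow> T \<subseteq> S \<Longrightarrow> solves_on q T v p"
  by (auto simp: solves_on_def)

lemma solves_on_exists_convex:
  assumes "convex S" "open S" "q holomorphic_on S" "z0 \<in> S"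
  shows "\<exists>v p. solves_on q S v p \<and> v z0 = c0 \<and> p z0 = c1"
  using linear_system_convex[OF assms(1,2) _ assms(3,4), of "\<lambda>_. 1" c0 c1]
  unfolding solves_on_def by auto

text \<open>The equation has no first-derivative term, so the two contributions
  \<open>q z * v z * w z\<close> to the derivative of the Wronskian cancel.\<close>

lemma wronskian_constant:
  assumes "solves_on q S v p" "solves_on q S w r" "convex S" "x \<in> S" "y \<in> S"
  shows "v x * r x - p x * w x = v y * r y - p y * w y"
proof -
  have "\<exists>c. \<forall>z\<in>S. v z * r z - p z * w z = c"
  proof (rule has_field_derivative_zero_constant[OF \<open>convex S\<close>])
    fix z assume "z \<in> S"
    then have d: "(v has_field_derivative p z) (at z)" "(p has_field_derivative q z * v z) (at z)"
        "(w has_field_derivative r z) (at z)" "(r has_field_derivative q z * w z) (at z)"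
      using assms(1,2) unfolding solves_on_def by blast+
    have "((\<lambda>z. v z * r z - p z * w z) has_field_derivative 0) (at z)"
      by (rule DERIV_cong[OF DERIV_diff[OF DERIV_mult[OF d(1,4)] DERIV_mult[OF d(2,3)]]])
        (simp add: algebra_simps)
    then show "((\<lambda>z. v z * r z - p z * w z) has_field_derivative 0) (at z within S)"
      by (rule has_field_derivative_at_within)
  qed
  with assms(4,5) show ?thesis by auto
qed

text \<open>Uniqueness is drawn from existence. The difference of the two solutions has vanishing
  Wronskian with every solution; against a fundamental pair normalised at \<open>m\<close>, whose
  own Wronskian is 1, Cramer's rule forces value and derivative of the difference to vanish at
  \<open>z\<close>.\<close>

lemma solves_on_unique_convex:
  assumes S: "convex S" "open S" "q holomorphic_on S"
    and sol: "solves_on q S v p" "solves_on q S w r"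
    and m: "m \<in> S" "v m = w m" "p m = r m" and z: "z \<in> S"
  shows "v z = w z \<and> p z = r z"
proof -
  obtain f1 g1 f2 g2 where f: "solves_on q S f1 g1" "f1 m = 1" "g1 m = 0"
      "solves_on q S f2 g2" "f2 m = 0" "g2 m = 1"
    using solves_on_exists_convex[OF S m(1)] by metis
  define a b where "a = v z - w z" and "b = p z - r z"
  have eq: "a * k z - b * f z = 0" if "solves_on q S f k" for f k
  proof -
    have "a * k z - b * f z = (v z * k z - p z * f z) - (w z * k z - r z * f z)"
      by (simp add: a_def b_def algebra_simps)
    also have "\<dots> = (v m * k m - p m * f m) - (w m * k m - r m * f m)"
      using wronskian_constant[OF sol(1) that S(1) m(1) z] wronskian_constant[OF sol(2) that S(1) m(1) z]
      by simp
    finally show ?thesis using m by simp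
  qed
  have W: "f1 z * g2 z - g1 z * f2 z = 1"
    using wronskian_constant[OF f(1,4) S(1) m(1) z] f by simp
  have "a = a * (f1 z * g2 z - g1 z * f2 z)" using W by simp
  also have "\<dots> = f1 z * (a * g2 z - b * f2 z) - f2 z * (a * g1 z - b * f1 z)" by (simp add: algebra_simps)
  finally have "a = 0" using eq[OF f(1)] eq[OF f(4)] by simp
  have "b = b * (f1 z * g2 z - g1 z * f2 z)" using W by simp
  also have "\<dots> = g1 z * (a * g2 z - b * f2 z) - g2 z * (a * g1 z - b * f1 z)" by (simp add: algebra_simps)
  finally have "b = 0" using eq[OF f(1)] eq[OF f(4)] by simp
  with \<open>a = 0\<close> show ?thesis by (simp add: a_def b_def)
qed

text \<open>The equation is pulled back along a Riemann map to a disc, where it becomes a first-order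
  system that is no longer of the form \<open>v' = p\<close>, \<open>p' = q v\<close>.\<close>

lemma solves_on_exists_simply_connected:
  assumes S: "simply_connected S" "open S" "q holomorphic_on S" "z0 \<in> S"
  shows "\<exists>v p. solves_on q S v p \<and> v z0 = c0 \<and> p z0 = c1"
proof -
  consider "S = UNIV" | f g where "f holomorphic_on S" "g holomorphic_on ball 0 1"
      "\<forall>z\<in>S. f z \<in> ball 0 1 \<and> g (f z) = z" "\<forall>z\<in>ball 0 1. g z \<in> S \<and> f (g z) = z"
    using Riemann_mapping_theorem[of S] S by blast
  then show ?thesis
  proof cases
    case 1
    then show ?thesis using solves_on_exists_convex[of S] S by auto
  next
    case 2
    have gS: "g ` ball 0 1 \<subseteq> S" using 2 by auto
    have h1: "deriv g holomorphic_on ball 0 1" using 2 by (intro holomorphic_deriv) auto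
    have h2: "(\<lambda>t. deriv g t * q (g t)) holomorphic_on ball 0 1"
      using h1 holomorphic_on_compose_gen[OF 2(2) S(3) gS] by (auto intro!: holomorphic_intros simp: o_def)
    have "f z0 \<in> ball 0 1" using 2 S by auto
    from linear_system_convex[OF convex_ball open_ball h1 h2 this, of c0 c1]
    obtain a b where ab: "a (f z0) = c0" "b (f z0) = c1"
      "\<And>t. t \<in> ball 0 1 \<Longrightarrow> (a has_field_derivative deriv g t * b t) (at t)"
      "\<And>t. t \<in> ball 0 1 \<Longrightarrow> (b has_field_derivative deriv g t * q (g t) * a t) (at t)" by blast
    have "solves_on q S (\<lambda>z. a (f z)) (\<lambda>z. b (f z))"
      unfolding solves_on_def
    proof
      fix z assume z: "z \<in> S"
      have fz: "f z \<in> ball 0 1" "g (f z) = z" using 2 z by auto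
      have df: "(f has_field_derivative deriv f z) (at z)"
        using 2(1) z S(2) holomorphic_derivI by blast
      have dg: "(g has_field_derivative deriv g (f z)) (at (f z))"
        using 2(2) fz holomorphic_derivI by blast
      \<comment> \<open>The factor \<open>deriv g\<close> carried by both equations on the disc
        cancels against the \<open>deriv f\<close> of the chain rule, which restores the original
        equation on \<open>S\<close>.\<close>
      have "((\<lambda>z. g (f z)) has_field_derivative deriv g (f z) * deriv f z) (at z)"
        using DERIV_chain2[OF dg df] .
      moreover have "((\<lambda>z. g (f z)) has_field_derivative 1) (at z)"
        by (rule has_field_derivative_transform_within_open[where f = "\<lambda>z. z" and S = S])
          (use S(2) z 2 in auto)
      ultimately have "deriv g (f z) * deriv f z = 1" by (rule DERIV_unique)
      then have e: "deriv g (f z) * x * deriv f z = x" for x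
        by (metis mult.assoc mult.commute mult_1)
      show "((\<lambda>z. a (f z)) has_field_derivative b (f z)) (at z) \<and>
          ((\<lambda>z. b (f z)) has_field_derivative q z * a (f z)) (at z)"
        using DERIV_chain2[OF ab(3)[OF fz(1)] df] DERIV_chain2[OF ab(4)[OF fz(1)] df] fz(2)
          e[of "b (f z)"] e[of "q z * a (f z)"]
        by (simp only: mult.assoc)
    qed
    then show ?thesis using ab by (intro exI[of _ "\<lambda>z. a (f z)"] exI[of _ "\<lambda>z. b (f z)"]) auto
  qed
qed

section \<open>Continuation of solutions along paths\<close>

text \<open>\<open>Y \<sigma>\<close> is the pair (value, derivative) at \<open>\<gamma> \<sigma>\<close> of a function element
  that solves \<open>w'' = q w\<close> and is continued along \<open>\<gamma>\<close>.\<close>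

definition section_along ::
  "(complex \<Rightarrow> complex) \<Rightarrow> (real \<Rightarrow> complex) \<Rightarrow> real set \<Rightarrow> (real \<Rightarrow> complex \<times> complex) \<Rightarrow> bool" where
  "section_along q \<gamma> I Y \<longleftrightarrow> (\<forall>\<tau>\<in>I. \<exists>r>0. \<exists>v p. solves_on q (ball (\<gamma> \<tau>) r) v p \<and>
     (\<forall>\<^sub>F \<sigma> in nhds \<tau>. \<sigma> \<in> I \<longrightarrow> Y \<sigma> = (v (\<gamma> \<sigma>), p (\<gamma> \<sigma>))))"

lemma section_alongE:
  assumes "section_along q \<gamma> I Y" "open D" "\<gamma> ` I \<subseteq> D" "\<tau> \<in> I"
  obtains r v p where "r > 0" "ball (\<gamma> \<tau>) r \<subseteq> D" "solves_on q (ball (\<gamma> \<tau>) r) v p"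
    "\<forall>\<^sub>F \<sigma> in nhds \<tau>. \<sigma> \<in> I \<longrightarrow> Y \<sigma> = (v (\<gamma> \<sigma>), p (\<gamma> \<sigma>))"
proof -
  obtain r v p where r: "r > 0" "solves_on q (ball (\<gamma> \<tau>) r) v p"
    "\<forall>\<^sub>F \<sigma> in nhds \<tau>. \<sigma> \<in> I \<longrightarrow> Y \<sigma> = (v (\<gamma> \<sigma>), p (\<gamma> \<sigma>))"
    using assms(1,4) unfolding section_along_def by blast
  obtain e where e: "e > 0" "ball (\<gamma> \<tau>) e \<subseteq> D" using assms(2-4) openE by blast
  show thesis
  proof (rule that)
    show "min r e > 0" using r e by auto
    show "ball (\<gamma> \<tau>) (min r e) \<subseteq> D" using e by auto
    show "solves_on q (ball (\<gamma> \<tau>) (min r e)) v p" by (rule solves_on_subset[OF r(2)]) auto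
  qed (fact r)
qed

lemma eventually_in_ball_along:
  fixes \<gamma> :: "real \<Rightarrow> complex"
  assumes "continuous_on I \<gamma>" "\<tau> \<in> I" "r > 0"
  shows "\<forall>\<^sub>F \<sigma> in nhds \<tau>. \<sigma> \<in> I \<longrightarrow> \<gamma> \<sigma> \<in> ball (\<gamma> \<tau>) r"
proof -
  obtain d where "d > 0" "\<And>s. s \<in> I \<Longrightarrow> dist s \<tau> < d \<Longrightarrow> dist (\<gamma> s) (\<gamma> \<tau>) < r"
    using assms unfolding continuous_on_iff by blast
  then show ?thesis unfolding eventually_nhds_metric by (intro exI[of _ d]) (auto simp: dist_commute)
qed

lemma section_along_subset: "section_along q \<gamma> I Y \<Longrightarrow> J \<subseteq> I \<Longrightarrow> section_along q \<gamma> J Y"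
  unfolding section_along_def by (smt (verit, best) eventually_mono subsetD)

lemma section_along_cong:
  assumes "section_along q \<gamma> I Y" "\<And>t. t \<in> I \<Longrightarrow> \<gamma> t = \<gamma>' t"
  shows "section_along q \<gamma>' I Y"
  using assms unfolding section_along_def by (smt (verit, best) eventually_mono)

lemma section_along_solution:
  assumes "solves_on q S v p" "open S" "\<gamma> ` I \<subseteq> S"
  shows "section_along q \<gamma> I (\<lambda>\<sigma>. (v (\<gamma> \<sigma>), p (\<gamma> \<sigma>)))"
  unfolding section_along_def
proof
  fix \<tau> assume "\<tau> \<in> I"
  then obtain r where "r > 0" "ball (\<gamma> \<tau>) r \<subseteq> S" using assms openE by blast
  then show "\<exists>r>0. \<exists>v' p'. solves_on q (ball (\<gamma> \<tau>) r) v' p' \<and>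
     (\<forall>\<^sub>F \<sigma> in nhds \<tau>. \<sigma> \<in> I \<longrightarrow> (v (\<gamma> \<sigma>), p (\<gamma> \<sigma>)) = (v' (\<gamma> \<sigma>), p' (\<gamma> \<sigma>)))"
    using solves_on_subset[OF assms(1)] by (intro exI[of _ r] conjI exI[of _ v] exI[of _ p]) auto
qed

lemma section_along_zero: "section_along q \<gamma> I (\<lambda>_. (0, 0))"
  using section_along_solution[of q UNIV "\<lambda>_. 0" "\<lambda>_. 0"] by (simp add: solves_on_def)

lemma section_along_combine:
  assumes "section_along q \<gamma> I Y" "section_along q \<gamma> I Z"
  shows "section_along q \<gamma> I (\<lambda>\<sigma>. (c * fst (Y \<sigma>) + d * fst (Z \<sigma>), c * snd (Y \<sigma>) + d * snd (Z \<sigma>)))"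
  unfolding section_along_def
proof
  fix \<tau> assume t: "\<tau> \<in> I"
  obtain r v p where r: "r > 0" "solves_on q (ball (\<gamma> \<tau>) r) v p"
    "\<forall>\<^sub>F \<sigma> in nhds \<tau>. \<sigma> \<in> I \<longrightarrow> Y \<sigma> = (v (\<gamma> \<sigma>), p (\<gamma> \<sigma>))"
    using assms(1) t unfolding section_along_def by blast
  obtain e w s where e: "e > 0" "solves_on q (ball (\<gamma> \<tau>) e) w s"
    "\<forall>\<^sub>F \<sigma> in nhds \<tau>. \<sigma> \<in> I \<longrightarrow> Z \<sigma> = (w (\<gamma> \<sigma>), s (\<gamma> \<sigma>))"
    using assms(2) t unfolding section_along_def by blast
  have "solves_on q (ball (\<gamma> \<tau>) (min r e)) (\<lambda>z. c * v z + d * w z) (\<lambda>z. c * p z + d * s z)"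
    unfolding solves_on_def
  proof (intro ballI conjI)
    fix z assume "z \<in> ball (\<gamma> \<tau>) (min r e)"
    then have *: "(v has_field_derivative p z) (at z)" "(p has_field_derivative q z * v z) (at z)"
      "(w has_field_derivative s z) (at z)" "(s has_field_derivative q z * w z) (at z)"
      using r(2) e(2) unfolding solves_on_def by auto
    show "((\<lambda>z. c * v z + d * w z) has_field_derivative c * p z + d * s z) (at z)"
      by (intro DERIV_add DERIV_cmult *)
    show "((\<lambda>z. c * p z + d * s z) has_field_derivative q z * (c * v z + d * w z)) (at z)"
      by (rule DERIV_cong[OF DERIV_add[OF DERIV_cmult DERIV_cmult]], rule *, rule *)
        (simp add: algebra_simps)
  qed
  moreover have "\<forall>\<^sub>F \<sigma> in nhds \<tau>. \<sigma> \<in> I \<longrightarrow> (c * fst (Y \<sigma>) + d * fst (Z \<sigma>), c * snd (Y \<sigma>) + d * snd (Z \<sigma>)) =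
      (c * v (\<gamma> \<sigma>) + d * w (\<gamma> \<sigma>), c * p (\<gamma> \<sigma>) + d * s (\<gamma> \<sigma>))"
    using r(3) e(3) by eventually_elim auto
  moreover have "min r e > 0" using r e by auto
  ultimately show "\<exists>r>0. \<exists>v p. solves_on q (ball (\<gamma> \<tau>) r) v p \<and>
     (\<forall>\<^sub>F \<sigma> in nhds \<tau>. \<sigma> \<in> I \<longrightarrow> (c * fst (Y \<sigma>) + d * fst (Z \<sigma>), c * snd (Y \<sigma>) + d * snd (Z \<sigma>)) =
      (v (\<gamma> \<sigma>), p (\<gamma> \<sigma>)))" by blast
qed

text \<open>Agreement at one parameter is equivalent to agreement at any nearby one, by uniqueness
  in a small disc; bisection spreads the equivalence over a compact subinterval. An equivalence, not
  an implication, is propagated so that \<open>m\<close> may lie on either side of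
  \<open>t\<close>.\<close>

lemma section_along_unique:
  assumes D: "open D" "q holomorphic_on D" "continuous_on I \<gamma>" "\<gamma> ` I \<subseteq> D" "is_interval I"
    and Y: "section_along q \<gamma> I Y" "section_along q \<gamma> I Z"
    and m: "m \<in> I" "Y m = Z m" "t \<in> I"
  shows "Y t = Z t"
proof -
  have "(Y s = Z s) = (Y t = Z t)" if st: "s \<le> t" "s \<in> I" "t \<in> I" for s t
  proof -
    have sub: "{s..t} \<subseteq> I"
      using D(5) that unfolding is_interval_1 by (meson atLeastAtMost_iff subsetI)
    \<comment> \<open>The trivial premises are instances of the guards in the predicate: the local
      condition of \<open>Bolzano\<close> also ranges over intervals that stick out of
      \<open>{s..t}\<close>.\<close>
    have "s \<le> s \<longrightarrow> t \<le> t \<longrightarrow> (Y s = Z s) = (Y t = Z t)"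
    proof (rule Bolzano[OF \<open>s \<le> t\<close>, where P = "\<lambda>x y. s \<le> x \<longrightarrow> y \<le> t \<longrightarrow> (Y x = Z x) = (Y y = Z y)"])
      fix x assume x: "s \<le> x" "x \<le> t"
      then have xI: "x \<in> I" using sub by auto
      obtain r v p where r: "r > 0" "ball (\<gamma> x) r \<subseteq> D" "solves_on q (ball (\<gamma> x) r) v p"
        "\<forall>\<^sub>F \<sigma> in nhds x. \<sigma> \<in> I \<longrightarrow> Y \<sigma> = (v (\<gamma> \<sigma>), p (\<gamma> \<sigma>))"
        using section_alongE[OF Y(1) D(1,4) xI] by blast
      obtain e w k where e: "e > 0" "ball (\<gamma> x) e \<subseteq> D" "solves_on q (ball (\<gamma> x) e) w k"
        "\<forall>\<^sub>F \<sigma> in nhds x. \<sigma> \<in> I \<longrightarrow> Z \<sigma> = (w (\<gamma> \<sigma>), k (\<gamma> \<sigma>))"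
        using section_alongE[OF Y(2) D(1,4) xI] by blast
      define B where "B = ball (\<gamma> x) (min r e)"
      have B: "convex B" "open B" "q holomorphic_on B" "solves_on q B v p" "solves_on q B w k"
        unfolding B_def using r e
        by (auto intro!: holomorphic_on_subset[OF D(2)] solves_on_subset[OF r(3)] solves_on_subset[OF e(3)])
      have inB: "\<forall>\<^sub>F \<sigma> in nhds x. \<sigma> \<in> I \<longrightarrow> \<gamma> \<sigma> \<in> B"
        unfolding B_def using eventually_in_ball_along[OF D(3) xI, of "min r e"] r(1) e(1) by simp
      have "\<forall>\<^sub>F \<sigma> in nhds x. \<sigma> \<in> I \<longrightarrow> \<gamma> \<sigma> \<in> B \<and> Y \<sigma> = (v (\<gamma> \<sigma>), p (\<gamma> \<sigma>)) \<and> Z \<sigma> = (w (\<gamma> \<sigma>), k (\<gamma> \<sigma>))"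
        using r(4) e(4) inB by eventually_elim auto
      then obtain d where d: "d > 0" "\<And>\<sigma>. dist \<sigma> x < d \<Longrightarrow> \<sigma> \<in> I \<Longrightarrow>
          \<gamma> \<sigma> \<in> B \<and> Y \<sigma> = (v (\<gamma> \<sigma>), p (\<gamma> \<sigma>)) \<and> Z \<sigma> = (w (\<gamma> \<sigma>), k (\<gamma> \<sigma>))"
        unfolding eventually_nhds_metric by blast
      have key: "Y b = Z b" if "Y a = Z a" "dist a x < d" "dist b x < d" "a \<in> I" "b \<in> I" for a b
      proof -
        have "v (\<gamma> b) = w (\<gamma> b) \<and> p (\<gamma> b) = k (\<gamma> b)"
          by (rule solves_on_unique_convex[OF B, of "\<gamma> a"]) (use d(2)[of a] d(2)[of b] that in auto)
        then show ?thesis using d(2)[of b] that by auto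
      qed
      show "\<exists>d>0. \<forall>a b. a \<le> x \<and> x \<le> b \<and> b - a < d \<longrightarrow> s \<le> a \<longrightarrow> b \<le> t \<longrightarrow> (Y a = Z a) = (Y b = Z b)"
      proof (intro exI[of _ d] conjI allI impI d(1))
        fix a b assume *: "a \<le> x \<and> x \<le> b \<and> b - a < d" "s \<le> a" "b \<le> t"
        then have "a \<in> I" "b \<in> I" "dist a x < d" "dist b x < d"
          using sub by (auto simp: dist_real_def)
        then show "(Y a = Z a) = (Y b = Z b)" using key by blast
      qed
    qed auto
    then show ?thesis by simp
  qed
  then show ?thesis using m by (metis linear)
qed

text \<open>Only the seam needs an argument: the local solutions from the left and from the right
  have equal data at \<open>\<gamma> y\<close>, hence coincide on a common disc, and one of them
  describes both halves there.\<close>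

lemma section_along_glue:
  assumes D: "open D" "q holomorphic_on D" "continuous_on {x..z} \<gamma>" "\<gamma> ` {x..z} \<subseteq> D"
    and xyz: "x \<le> y" "y \<le> z"
    and Y: "section_along q \<gamma> {x..y} Y" "section_along q \<gamma> {y..z} Z" "Y y = Z y"
  shows "section_along q \<gamma> {x..z} (\<lambda>t. if t \<le> y then Y t else Z t)"
  unfolding section_along_def
proof
  fix \<tau> assume t: "\<tau> \<in> {x..z}"
  let ?U = "\<lambda>t. if t \<le> y then Y t else Z t"
  consider "\<tau> < y" | "\<tau> > y" | "\<tau> = y" by linarith
  then show "\<exists>r>0. \<exists>v p. solves_on q (ball (\<gamma> \<tau>) r) v p \<and>
     (\<forall>\<^sub>F \<sigma> in nhds \<tau>. \<sigma> \<in> {x..z} \<longrightarrow> ?U \<sigma> = (v (\<gamma> \<sigma>), p (\<gamma> \<sigma>)))"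
  proof cases
    case 1
    then have "\<tau> \<in> {x..y}" using t by simp
    then obtain r v p where r: "r > 0" "solves_on q (ball (\<gamma> \<tau>) r) v p"
      "\<forall>\<^sub>F \<sigma> in nhds \<tau>. \<sigma> \<in> {x..y} \<longrightarrow> Y \<sigma> = (v (\<gamma> \<sigma>), p (\<gamma> \<sigma>))"
      using Y(1) unfolding section_along_def by blast
    have "\<forall>\<^sub>F \<sigma> in nhds \<tau>. \<sigma> < y" 
      using eventually_nhds_in_open[of "{..<y}" \<tau>] 1 by simp
    with r(3) have "\<forall>\<^sub>F \<sigma> in nhds \<tau>. \<sigma> \<in> {x..z} \<longrightarrow> ?U \<sigma> = (v (\<gamma> \<sigma>), p (\<gamma> \<sigma>))"
      by eventually_elim auto
    with r show ?thesis by blast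
  next
    case 2
    then have "\<tau> \<in> {y..z}" using t by simp
    then obtain r v p where r: "r > 0" "solves_on q (ball (\<gamma> \<tau>) r) v p"
      "\<forall>\<^sub>F \<sigma> in nhds \<tau>. \<sigma> \<in> {y..z} \<longrightarrow> Z \<sigma> = (v (\<gamma> \<sigma>), p (\<gamma> \<sigma>))"
      using Y(2) unfolding section_along_def by blast
    have "\<forall>\<^sub>F \<sigma> in nhds \<tau>. \<sigma> > y" 
      using eventually_nhds_in_open[of "{y<..}" \<tau>] 2 by simp
    with r(3) have "\<forall>\<^sub>F \<sigma> in nhds \<tau>. \<sigma> \<in> {x..z} \<longrightarrow> ?U \<sigma> = (v (\<gamma> \<sigma>), p (\<gamma> \<sigma>))"
      by eventually_elim auto
    with r show ?thesis by blast
  next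
    case 3
    have cont: "continuous_on {x..y} \<gamma>" "\<gamma> ` {x..y} \<subseteq> D" "continuous_on {y..z} \<gamma>" "\<gamma> ` {y..z} \<subseteq> D"
      using D(3,4) xyz by (auto elim!: continuous_on_subset)
    obtain r v p where r: "r > 0" "ball (\<gamma> y) r \<subseteq> D" "solves_on q (ball (\<gamma> y) r) v p"
        "\<forall>\<^sub>F \<sigma> in nhds y. \<sigma> \<in> {x..y} \<longrightarrow> Y \<sigma> = (v (\<gamma> \<sigma>), p (\<gamma> \<sigma>))"
      using section_alongE[OF Y(1) D(1) cont(2), of y] xyz by auto
    obtain e w k where e: "e > 0" "ball (\<gamma> y) e \<subseteq> D" "solves_on q (ball (\<gamma> y) e) w k"
        "\<forall>\<^sub>F \<sigma> in nhds y. \<sigma> \<in> {y..z} \<longrightarrow> Z \<sigma> = (w (\<gamma> \<sigma>), k (\<gamma> \<sigma>))"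
      using section_alongE[OF Y(2) D(1) cont(4), of y] xyz by auto
    define B where "B = ball (\<gamma> y) (min r e)"
    have B: "convex B" "open B" "q holomorphic_on B" "solves_on q B v p" "solves_on q B w k"
      unfolding B_def using r e
      by (auto intro!: holomorphic_on_subset[OF D(2)] solves_on_subset[OF r(3)] solves_on_subset[OF e(3)])
    have yB: "\<gamma> y \<in> B" using r(1) e(1) by (simp add: B_def)
    have "Y y = (v (\<gamma> y), p (\<gamma> y))" "Z y = (w (\<gamma> y), k (\<gamma> y))"
      using eventually_nhds_x_imp_x[OF r(4)] eventually_nhds_x_imp_x[OF e(4)] xyz by auto
    then have eq: "v a = w a \<and> p a = k a" if "a \<in> B" for a
      by (intro solves_on_unique_convex[OF B yB _ _ that]) (use Y(3) in auto)
    have "\<forall>\<^sub>F \<sigma> in nhds y. \<sigma> \<in> {x..z} \<longrightarrow> \<gamma> \<sigma> \<in> B"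
      unfolding B_def using eventually_in_ball_along[OF D(3), of y "min r e"] xyz r(1) e(1) by auto
    with r(4) e(4) have "\<forall>\<^sub>F \<sigma> in nhds y. \<sigma> \<in> {x..z} \<longrightarrow> ?U \<sigma> = (v (\<gamma> \<sigma>), p (\<gamma> \<sigma>))"
      by eventually_elim (use eq in auto)
    then show ?thesis using 3 r by blast
  qed
qed

lemma section_along_exists_interval:
  assumes D: "open D" "q holomorphic_on D" "continuous_on {a..b} \<gamma>" "\<gamma> ` {a..b} \<subseteq> D"
    and m: "m \<in> {a..b}"
  shows "\<exists>Y. section_along q \<gamma> {a..b} Y \<and> Y m = c"
proof -
  \<comment> \<open>Solvability is asked for every \<open>m\<close> and \<open>c\<close>, since
    gluing passes the value at the seam from the half that contains \<open>m\<close> on to the other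
    half as new initial data.\<close>
  define P where "P x y \<longleftrightarrow> (a \<le> x \<longrightarrow> y \<le> b \<longrightarrow>
      (\<forall>m\<in>{x..y}. \<forall>c. \<exists>Y. section_along q \<gamma> {x..y} Y \<and> Y m = c))" for x y
  have "a \<le> b" using m by simp
  then have "P a b"
  proof (rule Bolzano)
    fix x y z assume P: "P x y" "P y z" and xyz: "x \<le> y" "y \<le> z"
    show "P x z" unfolding P_def
    proof (intro impI ballI allI)
      fix m c assume *: "a \<le> x" "z \<le> b" "m \<in> {x..z}"
      have ex1: "\<exists>Y. section_along q \<gamma> {x..y} Y \<and> Y m = c" if "m \<in> {x..y}" for m c
        using P(1) * xyz that unfolding P_def by fastforce
      have ex2: "\<exists>Y. section_along q \<gamma> {y..z} Y \<and> Y m = c" if "m \<in> {y..z}" for m c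
        using P(2) * xyz that unfolding P_def by fastforce
      have cont: "continuous_on {x..z} \<gamma>" "\<gamma> ` {x..z} \<subseteq> D"
        using D(3,4) * by (auto elim!: continuous_on_subset)
      show "\<exists>Y. section_along q \<gamma> {x..z} Y \<and> Y m = c"
      proof (cases "m \<le> y")
        case True
        obtain Y where Y: "section_along q \<gamma> {x..y} Y" "Y m = c" using ex1[of m c] * True by auto
        obtain Z where Z: "section_along q \<gamma> {y..z} Z" "Z y = Y y" using ex2[of y "Y y"] xyz by auto
        show ?thesis using section_along_glue[OF D(1,2) cont xyz Y(1) Z(1)] Z(2) Y(2) True by fastforce
      next
        case False
        obtain Z where Z: "section_along q \<gamma> {y..z} Z" "Z m = c" using ex2[of m c] * False by auto
        obtain Y where Y: "section_along q \<gamma> {x..y} Y" "Y y = Z y" using ex1[of y "Z y"] xyz by auto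
        show ?thesis using section_along_glue[OF D(1,2) cont xyz Y(1) Z(1)] Z(2) Y(2) False by fastforce
      qed
    qed
  next
    fix x assume x: "a \<le> x" "x \<le> b"
    then have "\<gamma> x \<in> D" using D(4) by auto
    then obtain r where r: "r > 0" "ball (\<gamma> x) r \<subseteq> D" using D(1) openE by blast
    obtain d where d: "d > 0" "\<And>s. s \<in> {a..b} \<Longrightarrow> dist s x < d \<Longrightarrow> dist (\<gamma> s) (\<gamma> x) < r"
      using D(3) x r(1) unfolding continuous_on_iff by (metis atLeastAtMost_iff)
    show "\<exists>d>0. \<forall>s t. s \<le> x \<and> x \<le> t \<and> t - s < d \<longrightarrow> P s t"
    proof (intro exI[of _ d] conjI allI impI d(1))
      fix s t assume st: "s \<le> x \<and> x \<le> t \<and> t - s < d"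
      show "P s t" unfolding P_def
      proof (intro impI ballI allI)
        fix m c assume *: "a \<le> s" "t \<le> b" "m \<in> {s..t}"
        have im: "\<gamma> ` {s..t} \<subseteq> ball (\<gamma> x) r"
          using d(2) * st by (auto simp: dist_real_def dist_commute[of "\<gamma> x"])
        have "q holomorphic_on ball (\<gamma> x) r" using D(2) r(2) holomorphic_on_subset by blast
        from solves_on_exists_convex[OF convex_ball open_ball this, of "\<gamma> m" "fst c" "snd c"]
        obtain v p where "solves_on q (ball (\<gamma> x) r) v p" "v (\<gamma> m) = fst c" "p (\<gamma> m) = snd c"
          using im * by blast
        then show "\<exists>Y. section_along q \<gamma> {s..t} Y \<and> Y m = c"
          using section_along_solution[OF _ open_ball im] by fastforce
      qed
    qed
  qed
  then show ?thesis using m unfolding P_def by blast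
qed

text \<open>Sections on the growing intervals \<open>{a..m + real n}\<close> with the same data at
  \<open>m\<close> extend one another by uniqueness, so they have a common extension to the ray;
  \<open>N t\<close> is the index of an interval that reaches \<open>t\<close>.\<close>

lemma section_along_exists_ray:
  assumes D: "open D" "q holomorphic_on D" "continuous_on {a..} \<gamma>" "\<gamma> ` {a..} \<subseteq> D"
    and m: "a \<le> m"
  shows "\<exists>Y. section_along q \<gamma> {a..} Y \<and> Y m = c"
proof -
  have "\<exists>Y. section_along q \<gamma> {a..m + real n} Y \<and> Y m = c" for n
    using D m by (intro section_along_exists_interval[OF D(1,2)]) (auto elim: continuous_on_subset)
  then obtain Y where Y: "\<And>n. section_along q \<gamma> {a..m + real n} (Y n)" "\<And>n. Y n m = c" by metis
  have eq: "Y n t = Y k t" if "t \<in> {a..m + real n}" "n \<le> k" for n k t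
    by (rule section_along_unique[where I = "{a..m + real n}" and m = m and q = q and \<gamma> = \<gamma> and D = D])
      (use that D m Y in \<open>auto intro: continuous_on_subset section_along_subset[OF Y(1)] simp: is_interval_cc\<close>)
  define N where "N t = nat \<lceil>t - m\<rceil>" for t
  have N: "t \<le> m + real (N t)" for t unfolding N_def by linarith
  define U where "U t = Y (N t) t" for t
  have U: "U t = Y k t" if "t \<in> {a..m + real k}" for k t
  proof (cases "N t \<le> k")
    case True
    then show ?thesis unfolding U_def using that N[of t] by (intro eq) auto
  next
    case False
    then show ?thesis unfolding U_def using that by (intro eq[symmetric]) auto
  qed
  have "section_along q \<gamma> {a..} U"
    unfolding section_along_def
  proof
    fix \<tau> assume t: "\<tau> \<in> {a..}"
    \<comment> \<open>One interval further than needed to reach \<open>\<tau>\<close>, so that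
      \<open>\<tau>\<close> is not its right end and nearby larger parameters are covered
      too.\<close>
    define k where "k = Suc (N \<tau>)"
    have k: "\<tau> < m + real k" unfolding k_def using N[of \<tau>] by simp
    have "\<tau> \<in> {a..m + real k}" using t k by simp
    then obtain r v p where r: "r > 0" "solves_on q (ball (\<gamma> \<tau>) r) v p"
      "\<forall>\<^sub>F \<sigma> in nhds \<tau>. \<sigma> \<in> {a..m + real k} \<longrightarrow> Y k \<sigma> = (v (\<gamma> \<sigma>), p (\<gamma> \<sigma>))"
      using Y(1)[of k] unfolding section_along_def by blast
    have "\<forall>\<^sub>F \<sigma> in nhds \<tau>. \<sigma> < m + real k" 
      using eventually_nhds_in_open[of "{..<m + real k}" \<tau>] k by simp
    with r(3) have "\<forall>\<^sub>F \<sigma> in nhds \<tau>. \<sigma> \<in> {a..} \<longrightarrow> U \<sigma> = (v (\<gamma> \<sigma>), p (\<gamma> \<sigma>))"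
      by eventually_elim (use U[where k = k] in auto)
    with r show "\<exists>r>0. \<exists>v p. solves_on q (ball (\<gamma> \<tau>) r) v p \<and>
     (\<forall>\<^sub>F \<sigma> in nhds \<tau>. \<sigma> \<in> {a..} \<longrightarrow> U \<sigma> = (v (\<gamma> \<sigma>), p (\<gamma> \<sigma>)))" by blast
  qed
  moreover have "U m = c" using U[of m 0] m Y(2) by simp
  ultimately show ?thesis by blast
qed

lemma section_along_continuous:
  assumes "section_along q \<gamma> I Y" "continuous_on I \<gamma>"
  shows "continuous_on I (\<lambda>t. fst (Y t))" "continuous_on I (\<lambda>t. snd (Y t))"
proof -
  have "continuous (at \<tau> within I) (\<lambda>t. fst (Y t)) \<and> continuous (at \<tau> within I) (\<lambda>t. snd (Y t))"
    if t: "\<tau> \<in> I" for \<tau>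
  proof -
    obtain r v p where r: "r > 0" "solves_on q (ball (\<gamma> \<tau>) r) v p"
      "\<forall>\<^sub>F \<sigma> in nhds \<tau>. \<sigma> \<in> I \<longrightarrow> Y \<sigma> = (v (\<gamma> \<sigma>), p (\<gamma> \<sigma>))"
      using assms(1) t unfolding section_along_def by blast
    have cv: "isCont v (\<gamma> \<tau>)" "isCont p (\<gamma> \<tau>)"
      using r(1,2) unfolding solves_on_def by (metis DERIV_isCont centre_in_ball)+
    have g: "continuous (at \<tau> within I) \<gamma>" using assms(2) t continuous_on_eq_continuous_within by blast
    have Yt: "Y \<tau> = (v (\<gamma> \<tau>), p (\<gamma> \<tau>))" using eventually_nhds_x_imp_x[OF r(3)] t by simp
    have ev: "\<forall>\<^sub>F \<sigma> in at \<tau> within I. Y \<sigma> = (v (\<gamma> \<sigma>), p (\<gamma> \<sigma>))"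
      using r(3) unfolding eventually_at_filter by eventually_elim auto
    have "((\<lambda>\<sigma>. v (\<gamma> \<sigma>)) \<longlongrightarrow> v (\<gamma> \<tau>)) (at \<tau> within I)" "((\<lambda>\<sigma>. p (\<gamma> \<sigma>)) \<longlongrightarrow> p (\<gamma> \<tau>)) (at \<tau> within I)"
      using isCont_tendsto_compose[OF cv(1)] isCont_tendsto_compose[OF cv(2)] g
      unfolding continuous_within by blast+
    then have "((\<lambda>t. fst (Y t)) \<longlongrightarrow> v (\<gamma> \<tau>)) (at \<tau> within I)" "((\<lambda>t. snd (Y t)) \<longlongrightarrow> p (\<gamma> \<tau>)) (at \<tau> within I)"
      by (auto elim!: Lim_transform_eventually intro: eventually_mono[OF ev])
    then show ?thesis unfolding continuous_within Yt by simp
  qed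
  then show "continuous_on I (\<lambda>t. fst (Y t))" "continuous_on I (\<lambda>t. snd (Y t))"
    unfolding continuous_on_eq_continuous_within by auto
qed

text \<open>Near an interior parameter a section is the composite of a solution pair with \<gamma>.
  The chain rule thus gives a first-order system in a real variable, the form to which the estimates
  along paths apply.\<close>

lemma section_along_derivative:
  assumes "section_along q \<gamma> I Y" "\<tau> \<in> interior I" "(\<gamma> has_vector_derivative g) (at \<tau>)"
  shows "((\<lambda>t. fst (Y t)) has_vector_derivative g * snd (Y \<tau>)) (at \<tau>)"
    "((\<lambda>t. snd (Y t)) has_vector_derivative g * (q (\<gamma> \<tau>) * fst (Y \<tau>))) (at \<tau>)"
proof -
  have t: "\<tau> \<in> I" using assms(2) interior_subset by blast
  obtain r v p where r: "r > 0" "solves_on q (ball (\<gamma> \<tau>) r) v p"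
    "\<forall>\<^sub>F \<sigma> in nhds \<tau>. \<sigma> \<in> I \<longrightarrow> Y \<sigma> = (v (\<gamma> \<sigma>), p (\<gamma> \<sigma>))"
    using assms(1) t unfolding section_along_def by blast
  have Yt: "Y \<tau> = (v (\<gamma> \<tau>), p (\<gamma> \<tau>))" using eventually_nhds_x_imp_x[OF r(3)] t by simp
  have "\<forall>\<^sub>F \<sigma> in nhds \<tau>. \<sigma> \<in> interior I" using assms(2) by (simp add: eventually_nhds_in_open)
  with r(3) have ev: "\<forall>\<^sub>F \<sigma> in nhds \<tau>. Y \<sigma> = (v (\<gamma> \<sigma>), p (\<gamma> \<sigma>))"
    by eventually_elim (use interior_subset in blast)
  have d: "(v has_field_derivative p (\<gamma> \<tau>)) (at (\<gamma> \<tau>))"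
    "(p has_field_derivative q (\<gamma> \<tau>) * v (\<gamma> \<tau>)) (at (\<gamma> \<tau>))"
    using r(1,2) unfolding solves_on_def by auto
  have e1: "\<forall>\<^sub>F \<sigma> in nhds \<tau>. \<sigma> \<in> UNIV \<longrightarrow> fst (Y \<sigma>) = (v \<circ> \<gamma>) \<sigma>" and e2: "\<forall>\<^sub>F \<sigma> in nhds \<tau>. \<sigma> \<in> UNIV \<longrightarrow> snd (Y \<sigma>) = (p \<circ> \<gamma>) \<sigma>"
    using ev by (auto elim!: eventually_mono)
  show "((\<lambda>t. fst (Y t)) has_vector_derivative g * snd (Y \<tau>)) (at \<tau>)"
    using field_vector_diff_chain_at[OF assms(3) d(1)]
    by (subst has_vector_derivative_cong_ev[OF e1]) (simp_all add: Yt)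
  show "((\<lambda>t. snd (Y t)) has_vector_derivative g * (q (\<gamma> \<tau>) * fst (Y \<tau>))) (at \<tau>)"
    using field_vector_diff_chain_at[OF assms(3) d(2)]
    by (subst has_vector_derivative_cong_ev[OF e2]) (simp_all add: Yt)
qed

section \<open>Function elements with prescribed data\<close>

definition local_solution ::
  "complex set \<Rightarrow> (complex \<Rightarrow> complex) \<Rightarrow> complex \<Rightarrow> complex \<times> complex \<Rightarrow> complex \<Rightarrow> complex" where
  "local_solution D q z c = (SOME v. \<exists>r>0. \<exists>p. ball z r \<subseteq> D \<and> solves_on q (ball z r) v p \<and>
     v z = fst c \<and> p z = snd c)"

lemma local_solutionE:
  assumes "open D" "q holomorphic_on D" "z \<in> D"
  obtains r p where "r > 0" "ball z r \<subseteq> D" "solves_on q (ball z r) (local_solution D q z c) p"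
    "local_solution D q z c z = fst c" "p z = snd c"
proof -
  obtain r where r: "r > 0" "ball z r \<subseteq> D" using assms openE by blast
  then obtain v p where "solves_on q (ball z r) v p" "v z = fst c" "p z = snd c"
    using solves_on_exists_convex[OF convex_ball open_ball holomorphic_on_subset[OF assms(2) r(2)], of z "fst c" "snd c"]
    by auto
  with r have "\<exists>v. \<exists>r>0. \<exists>p. ball z r \<subseteq> D \<and> solves_on q (ball z r) v p \<and> v z = fst c \<and> p z = snd c"
    by blast
  from someI_ex[OF this] show thesis using that unfolding local_solution_def[symmetric] by blast
qed

text \<open>This makes the choice by \<open>SOME\<close> harmless: on the convex intersection of the
  two discs both functions solve the same equation with the same data at \<open>z\<close>. Only the
  germ is determined, and continuation looks at nothing else.\<close>

lemma local_solution_eq: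
  assumes D: "open D" "q holomorphic_on D" "z \<in> D"
    and v: "solves_on q (ball z0 r) v p" "z \<in> ball z0 r"
  shows "\<forall>\<^sub>F x in nhds z. local_solution D q z (v z, p z) x = v x"
proof -
  obtain e k where e: "e > 0" "ball z e \<subseteq> D" "solves_on q (ball z e) (local_solution D q z (v z, p z)) k"
    "local_solution D q z (v z, p z) z = v z" "k z = p z"
    using local_solutionE[OF D, of "(v z, p z)"] by auto
  define B where "B = ball z e \<inter> ball z0 r"
  have B: "convex B" "open B" "q holomorphic_on B" "solves_on q B (local_solution D q z (v z, p z)) k" "solves_on q B v p"
    unfolding B_def using e v
    by (auto intro!: holomorphic_on_subset[OF D(2)] solves_on_subset[OF v(1)] solves_on_subset[OF e(3)] convex_Int)
  have zB: "z \<in> B" using e v by (simp add: B_def)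
  have "local_solution D q z (v z, p z) x = v x" if "x \<in> B" for x
    using solves_on_unique_convex[OF B zB e(4,5) that] by blast
  then show ?thesis by (rule eventually_mono[OF eventually_nhds_in_open[OF B(2) zB]])
qed

lemma solves_on_deriv2:
  assumes "solves_on q S v p" "open S" "z \<in> S"
  shows "deriv (deriv v) z = q z * v z"
proof -
  have 1: "deriv v x = p x" if "x \<in> S" for x
    using assms that unfolding solves_on_def by (blast intro: DERIV_imp_deriv)
  have "deriv (deriv v) z = deriv p z"
    by (rule deriv_cong_ev[OF eventually_mono[OF eventually_nhds_in_open[OF assms(2,3)]]]) (rule 1, auto)
  also have "\<dots> = q z * v z" using assms unfolding solves_on_def by (blast intro: DERIV_imp_deriv)
  finally show ?thesis .
qed

lemma solves_on_holomorphic: "solves_on q S v p \<Longrightarrow> open S \<Longrightarrow> v holomorphic_on S"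
  unfolding solves_on_def by (auto simp: holomorphic_on_open)

lemma local_solution_ode:
  assumes D: "open D" "q holomorphic_on D" "z \<in> D"
  shows "\<forall>\<^sub>F x in nhds z. deriv (deriv (local_solution D q z c)) x = q x * local_solution D q z c x"
    and "local_solution D q z c z = fst c"
proof -
  obtain r p where r: "r > 0" "solves_on q (ball z r) (local_solution D q z c) p"
    "local_solution D q z c z = fst c"
    using local_solutionE[OF D, of c] by metis
  show "\<forall>\<^sub>F x in nhds z. deriv (deriv (local_solution D q z c)) x = q x * local_solution D q z c x"
    by (rule eventually_mono[OF eventually_nhds_in_open[OF open_ball, of z z r]])
      (use r(1) solves_on_deriv2[OF r(2) open_ball] in auto)
  show "local_solution D q z c z = fst c" by (rule r(3))
qed

lemma local_solution_continued_along:
  assumes D: "open D" "q holomorphic_on D" "continuous_on {a..} \<gamma>" "\<gamma> ` {a..} \<subseteq> D"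
    and Y: "section_along q \<gamma> {a..} Y"
  shows "continued_along \<gamma> a (\<lambda>\<tau>. local_solution D q (\<gamma> \<tau>) (Y \<tau>))"
  unfolding continued_along_def
proof (intro allI impI conjI)
  fix \<tau> assume t: "a \<le> \<tau>"
  then have gD: "\<gamma> \<tau> \<in> D" using D(4) by auto
  obtain e k where e: "e > 0" "solves_on q (ball (\<gamma> \<tau>) e) (local_solution D q (\<gamma> \<tau>) (Y \<tau>)) k"
    using local_solutionE[OF D(1,2) gD, of "Y \<tau>"] by metis
  show "local_solution D q (\<gamma> \<tau>) (Y \<tau>) analytic_on {\<gamma> \<tau>}"
    unfolding analytic_at using solves_on_holomorphic[OF e(2) open_ball] e(1) by (metis centre_in_ball open_ball)
  obtain r v p where r: "r > 0" "ball (\<gamma> \<tau>) r \<subseteq> D" "solves_on q (ball (\<gamma> \<tau>) r) v p"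
    "\<forall>\<^sub>F \<sigma> in nhds \<tau>. \<sigma> \<in> {a..} \<longrightarrow> Y \<sigma> = (v (\<gamma> \<sigma>), p (\<gamma> \<sigma>))"
    using section_alongE[OF Y D(1,4), of \<tau>] t by auto
  have Yt: "Y \<tau> = (v (\<gamma> \<tau>), p (\<gamma> \<tau>))" using eventually_nhds_x_imp_x[OF r(4)] t by simp
  have "\<forall>\<^sub>F x in nhds (\<gamma> \<tau>). local_solution D q (\<gamma> \<tau>) (Y \<tau>) x = v x"
    unfolding Yt by (rule local_solution_eq[OF D(1,2) gD r(3)]) (use r in auto)
  then obtain d where d: "d > 0" "\<And>x. x \<in> ball (\<gamma> \<tau>) d \<Longrightarrow> local_solution D q (\<gamma> \<tau>) (Y \<tau>) x = v x"
    unfolding eventually_nhds_metric by (auto simp: dist_commute)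
  have "\<forall>\<^sub>F \<sigma> in nhds \<tau>. \<sigma> \<in> {a..} \<longrightarrow> \<gamma> \<sigma> \<in> ball (\<gamma> \<tau>) (min r d)"
    using eventually_in_ball_along[OF D(3), of \<tau> "min r d"] t r(1) d(1) by simp
  \<comment> \<open>A single pair \<open>v\<close>, \<open>p\<close> supplies the data at all
    parameters close to \<open>\<tau>\<close>, so the elements chosen separately at those points are
    all germs of \<open>v\<close>.\<close>
  with r(4) have "\<forall>\<^sub>F \<sigma> in nhds \<tau>. \<sigma> \<in> {a..} \<longrightarrow>
      (\<forall>\<^sub>F z in nhds (\<gamma> \<sigma>). local_solution D q (\<gamma> \<sigma>) (Y \<sigma>) z = local_solution D q (\<gamma> \<tau>) (Y \<tau>) z)"
  proof eventually_elim
    case (elim \<sigma>)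
    show ?case
    proof
      assume s: "\<sigma> \<in> {a..}"
      then have s': "\<gamma> \<sigma> \<in> D" "\<gamma> \<sigma> \<in> ball (\<gamma> \<tau>) r" "\<gamma> \<sigma> \<in> ball (\<gamma> \<tau>) d" "Y \<sigma> = (v (\<gamma> \<sigma>), p (\<gamma> \<sigma>))"
        using elim D(4) by auto
      show "\<forall>\<^sub>F z in nhds (\<gamma> \<sigma>). local_solution D q (\<gamma> \<sigma>) (Y \<sigma>) z = local_solution D q (\<gamma> \<tau>) (Y \<tau>) z"
        using local_solution_eq[OF D(1,2) s'(1) r(3) s'(2)] eventually_nhds_in_open[OF open_ball s'(3)]
        unfolding s'(4) by eventually_elim (use d(2) in auto)
    qed
  qed
  then show "\<forall>\<^sub>F \<sigma> in at \<tau> within {a..}. \<forall>\<^sub>F z in nhds (\<gamma> \<sigma>).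
      local_solution D q (\<gamma> \<sigma>) (Y \<sigma>) z = local_solution D q (\<gamma> \<tau>) (Y \<tau>) z"
    unfolding eventually_at_filter by (rule eventually_mono) auto
qed

section \<open>Linking paths and branches determined near infinity\<close>

lemma R2_arc_on_subset: "R2_arc_on \<gamma> I \<Longrightarrow> J \<subseteq> I \<Longrightarrow> R2_arc_on \<gamma> J"
  unfolding R2_arc_on_def
  by (meson continuous_on_subset has_vector_derivative_within_subset subsetD)

lemma R2_arc_on_continuous: "R2_arc_on \<gamma> I \<Longrightarrow> continuous_on I \<gamma>"
  unfolding R2_arc_on_def continuous_on_eq_continuous_within
  by (meson has_vector_derivative_continuous)

lemma linking_path_continuous:
  assumes "linking_path \<Delta> A \<gamma> a"
  shows "continuous_on {a..} \<gamma>"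
proof -
  obtain k p where p: "p 0 = a" "\<And>i. i < k \<Longrightarrow> p i < p (Suc i)" "\<And>i. i < k \<Longrightarrow> R2_arc_on \<gamma> {p i..p (Suc i)}"
    "R2_arc_on \<gamma> {p k..}"
    using assms unfolding linking_path_def by blast
  have "a \<le> p i \<and> continuous_on {a..p i} \<gamma>" if "i \<le> k" for i
    using that
  proof (induction i)
    case (Suc i)
    then have "continuous_on ({a..p i} \<union> {p i..p (Suc i)}) \<gamma>"
      using R2_arc_on_continuous[OF p(3)[of i]] by (intro continuous_on_closed_Un) auto
    moreover have "{a..p i} \<union> {p i..p (Suc i)} = {a..p (Suc i)}"
      using Suc p(2)[of i] by (intro ivl_disj_un_two_touch) auto
    ultimately show ?case using Suc p(2)[of i] by auto
  qed (auto simp: p(1))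
  from this[of k] have "continuous_on ({a..p k} \<union> {p k..}) \<gamma>" "{a..p k} \<union> {p k..} = {a..}"
    using R2_arc_on_continuous[OF p(4)] by (auto intro!: continuous_on_closed_Un)
  then show ?thesis by simp
qed

lemma arc_to_infinity_linking:
  assumes "arc_to_infinity \<Delta> A j u" "0 \<le> b"
  shows "linking_path \<Delta> A A b"
  using assms R2_arc_on_subset[of A "{0..}" "{b..}"] unfolding linking_path_def arc_to_infinity_def
  by (intro conjI exI[of _ 0] exI[of _ "\<lambda>_. b"]) auto

text \<open>The data at \<open>\<gamma> \<tau>\<close> of the branch that coincides near infinity with the one given by
  \<open>Y0\<close>; uniqueness makes them independent of the starting parameter of the path.\<close>

definition branch_data ::
  "(complex \<Rightarrow> complex) \<Rightarrow> (real \<Rightarrow> complex \<times> complex) \<Rightarrow> (real \<Rightarrow> complex) \<Rightarrow> real \<Rightarrow> complex \<times> complex" where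
  "branch_data q Y0 \<gamma> \<tau> = (THE c. \<exists>Y. section_along q \<gamma> {\<tau>..} Y \<and> Y \<tau> = c \<and> (\<forall>\<^sub>F \<sigma> in at_top. Y \<sigma> = Y0 \<sigma>))"

lemma branch_data_eq:
  assumes D: "open D" "q holomorphic_on D" "continuous_on {a..} \<gamma>" "\<gamma> ` {a..} \<subseteq> D"
    and Y: "section_along q \<gamma> {a..} Y" "\<forall>\<^sub>F \<sigma> in at_top. Y \<sigma> = Y0 \<sigma>" and t: "a \<le> \<tau>"
  shows "branch_data q Y0 \<gamma> \<tau> = Y \<tau>"
  unfolding branch_data_def
proof (rule the_equality)
  show "\<exists>Z. section_along q \<gamma> {\<tau>..} Z \<and> Z \<tau> = Y \<tau> \<and> (\<forall>\<^sub>F \<sigma> in at_top. Z \<sigma> = Y0 \<sigma>)"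
    using section_along_subset[OF Y(1), of "{\<tau>..}"] Y(2) t by auto
next
  fix c assume "\<exists>Z. section_along q \<gamma> {\<tau>..} Z \<and> Z \<tau> = c \<and> (\<forall>\<^sub>F \<sigma> in at_top. Z \<sigma> = Y0 \<sigma>)"
  then obtain Z where Z: "section_along q \<gamma> {\<tau>..} Z" "Z \<tau> = c" "\<forall>\<^sub>F \<sigma> in at_top. Z \<sigma> = Y0 \<sigma>" by blast
  have "\<forall>\<^sub>F \<sigma> in at_top. Y \<sigma> = Z \<sigma> \<and> \<sigma> \<ge> \<tau>"
    using Z(3) Y(2) eventually_ge_at_top[of \<tau>] by eventually_elim auto
  from eventually_happens'[OF trivial_limit_at_top_linorder this]
  obtain m where m: "Y m = Z m" "m \<ge> \<tau>" by blast
  have "Y \<tau> = Z \<tau>"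
    by (rule section_along_unique[OF D(1,2) _ _ is_interval_ci section_along_subset[OF Y(1)] Z(1), of m])
      (use m t D(3,4) in \<open>auto elim: continuous_on_subset\<close>)
  then show "c = Y \<tau>" using Z by simp
qed

text \<open>Beyond \<open>m\<close> the path and the arc share their parametrisation. The section
  started from the datum \<open>Y0 m\<close> follows \<open>Y0\<close> outwards by uniqueness and
  reaches back to the finite end of \<gamma>.\<close>

lemma section_along_extend_from_infinity:
  assumes D: "open D" "q holomorphic_on D" "continuous_on {a..} \<gamma>" "\<gamma> ` {a..} \<subseteq> D"
    and Y0: "section_along q A {b..} Y0" and ev: "\<forall>\<^sub>F \<tau> in at_top. \<gamma> \<tau> = A \<tau>"
  shows "\<exists>Y. section_along q \<gamma> {a..} Y \<and> (\<forall>\<^sub>F \<sigma> in at_top. Y \<sigma> = Y0 \<sigma>)"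
proof -
  obtain m' where m': "\<And>t. t \<ge> m' \<Longrightarrow> \<gamma> t = A t" using ev by (auto simp: eventually_at_top_linorder)
  define m where "m = max m' (max a b)"
  have m: "m \<ge> m'" "m \<ge> a" "m \<ge> b" by (auto simp: m_def)
  obtain Y where Y: "section_along q \<gamma> {a..} Y" "Y m = Y0 m"
    using section_along_exists_ray[OF D m(2)] by blast
  have "section_along q A {m..} Y0" using section_along_subset[OF Y0] m by auto
  then have Y0': "section_along q \<gamma> {m..} Y0" by (rule section_along_cong) (use m m' in auto)
  have "Y t = Y0 t" if "t \<ge> m" for t
    by (rule section_along_unique[OF D(1,2) _ _ is_interval_ci section_along_subset[OF Y(1)] Y0' , of m])
      (use m that D(3,4) Y(2) in \<open>auto elim: continuous_on_subset\<close>)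
  then show ?thesis using Y(1) by (auto simp: eventually_at_top_linorder)
qed

text \<open>All branches descend from the one section \<open>Y0\<close> on the arc and so agree near
  infinity. The arc has its own parameter \<open>u'\<close>, because the equation sees only the
  square of \<open>u\<close> and the construction is used with either sign.\<close>

lemma branched_solution_exists:
  assumes D: "open \<Delta>" "\<psi> holomorphic_on \<Delta>" and A: "arc_to_infinity \<Delta> A j u'"
    and b: "0 \<le> b" and Y0: "section_along (\<lambda>z. u\<^sup>2 + \<psi> z) A {b..} Y0"
  shows "\<exists>W. branched_solution \<Delta> A \<psi> u W \<and>
    (\<forall>\<gamma> a. linking_path \<Delta> A \<gamma> a \<longrightarrow> (\<exists>Y. section_along (\<lambda>z. u\<^sup>2 + \<psi> z) \<gamma> {a..} Y \<and>
       (\<forall>\<^sub>F \<sigma> in at_top. Y \<sigma> = Y0 \<sigma>) \<and> (\<forall>\<tau>\<ge>a. W \<gamma> \<tau> (\<gamma> \<tau>) = fst (Y \<tau>))))"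
proof -
  define q where "q z = u\<^sup>2 + \<psi> z" for z
  have q: "q holomorphic_on \<Delta>" unfolding q_def using D by (auto intro!: holomorphic_intros)
  have Y0: "section_along q A {b..} Y0" using Y0 unfolding q_def .
  define W where "W \<gamma> \<tau> = local_solution \<Delta> q (\<gamma> \<tau>) (branch_data q Y0 \<gamma> \<tau>)" for \<gamma> \<tau>
  have path: "continuous_on {a..} \<gamma>" "\<gamma> ` {a..} \<subseteq> \<Delta>" "\<forall>\<^sub>F \<tau> in at_top. \<gamma> \<tau> = A \<tau>"
    if "linking_path \<Delta> A \<gamma> a" for \<gamma> a
    using that linking_path_continuous[OF that] unfolding linking_path_def by auto
  have ex: "\<exists>Y. section_along q \<gamma> {a..} Y \<and> (\<forall>\<^sub>F \<sigma> in at_top. Y \<sigma> = Y0 \<sigma>) \<and>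
      (\<forall>\<tau>\<ge>a. branch_data q Y0 \<gamma> \<tau> = Y \<tau>)" if "linking_path \<Delta> A \<gamma> a" for \<gamma> a
    using section_along_extend_from_infinity[OF D(1) q path(1,2)[OF that] Y0 path(3)[OF that]]
      branch_data_eq[OF D(1) q path(1,2)[OF that]] by blast
  have lA: "linking_path \<Delta> A A b" using arc_to_infinity_linking[OF A b] .
  have bA: "\<forall>\<^sub>F \<tau> in at_top. branch_data q Y0 \<gamma> \<tau> = Y0 \<tau>" if l: "linking_path \<Delta> A \<gamma> a" for \<gamma> a
  proof -
    obtain Y where Y: "\<forall>\<^sub>F \<sigma> in at_top. Y \<sigma> = Y0 \<sigma>" "\<forall>\<tau>\<ge>a. branch_data q Y0 \<gamma> \<tau> = Y \<tau>"
      using ex[OF l] by blast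
    from Y(1) eventually_ge_at_top[of a] show ?thesis by eventually_elim (use Y(2) in auto)
  qed
  have "branched_solution \<Delta> A \<psi> u W" unfolding branched_solution_def
  proof (intro conjI allI impI)
    fix \<gamma> a assume l: "linking_path \<Delta> A \<gamma> a"
    obtain Y where Y: "section_along q \<gamma> {a..} Y" "\<And>\<tau>. \<tau> \<ge> a \<Longrightarrow> branch_data q Y0 \<gamma> \<tau> = Y \<tau>"
      using ex[OF l] by blast
    have "continued_along \<gamma> a (\<lambda>\<tau>. local_solution \<Delta> q (\<gamma> \<tau>) (Y \<tau>))"
      by (rule local_solution_continued_along[OF D(1) q path(1,2)[OF l] Y(1)])
    then show "continued_along \<gamma> a (W \<gamma>)"
      unfolding continued_along_def W_def eventually_at_filter
      by (auto simp: Y(2) elim!: eventually_mono)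
    fix \<tau> assume t: "a \<le> \<tau>"
    then have "\<gamma> \<tau> \<in> \<Delta>" using path(2)[OF l] by auto
    then show "\<forall>\<^sub>F z in nhds (\<gamma> \<tau>). deriv (deriv (W \<gamma> \<tau>)) z = (u\<^sup>2 + \<psi> z) * W \<gamma> \<tau> z"
      unfolding W_def using local_solution_ode(1)[OF D(1) q] unfolding q_def by blast
  next
    fix \<gamma> a assume l: "linking_path \<Delta> A \<gamma> a"
    show "\<forall>\<^sub>F \<tau> in at_top. \<forall>\<^sub>F z in nhds (A \<tau>). W \<gamma> \<tau> z = W A \<tau> z"
      using path(3)[OF l] bA[OF l] bA[OF lA] by eventually_elim (simp add: W_def)
  next
    \<comment> \<open>Here a global solution with the data of \<open>Y0\<close> at
      \<open>A b\<close> exists; uniqueness along the arc, and then along each path, identifies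
      every branch with a germ of it.\<close>
    assume sc: "simply_connected \<Delta>"
    have "A b \<in> \<Delta>" using path(2)[OF lA] by auto
    then obtain w p where w: "solves_on q \<Delta> w p" "w (A b) = fst (Y0 b)" "p (A b) = snd (Y0 b)"
      using solves_on_exists_simply_connected[OF sc D(1) q] by blast
    have Y0eq: "Y0 t = (w (A t), p (A t))" if "t \<ge> b" for t
      by (rule section_along_unique[OF D(1) q path(1,2)[OF lA] is_interval_ci Y0
            section_along_solution[OF w(1) D(1) path(2)[OF lA]], of b]) (use that w in \<open>auto simp: prod_eq_iff\<close>)
    have "\<forall>\<^sub>F z in nhds (\<gamma> a). W \<gamma> a z = w z" if l: "linking_path \<Delta> A \<gamma> a" for \<gamma> a
    proof -
      have "\<forall>\<^sub>F \<sigma> in at_top. (w (\<gamma> \<sigma>), p (\<gamma> \<sigma>)) = Y0 \<sigma>"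
        using path(3)[OF l] eventually_ge_at_top[of b] by eventually_elim (simp add: Y0eq)
      then have "branch_data q Y0 \<gamma> a = (w (\<gamma> a), p (\<gamma> a))"
        by (intro branch_data_eq[OF D(1) q path(1,2)[OF l] section_along_solution[OF w(1) D(1) path(2)[OF l]]]) auto
      moreover have "\<gamma> a \<in> \<Delta>" using path(2)[OF l] by auto
      moreover then obtain r where "r > 0" "ball (\<gamma> a) r \<subseteq> \<Delta>" using D(1) openE by blast
      ultimately show ?thesis
        unfolding W_def using local_solution_eq[OF D(1) q _ solves_on_subset[OF w(1)], of "\<gamma> a" "\<gamma> a" r] by simp
    qed
    then show "\<exists>w. w holomorphic_on \<Delta> \<and>
           (\<forall>\<gamma> a. linking_path \<Delta> A \<gamma> a \<longrightarrow> (\<forall>\<^sub>F z in nhds (\<gamma> a). W \<gamma> a z = w z))"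
      using solves_on_holomorphic[OF w(1) D(1)] by blast
  qed
  moreover have "\<exists>Y. section_along (\<lambda>z. u\<^sup>2 + \<psi> z) \<gamma> {a..} Y \<and>
       (\<forall>\<^sub>F \<sigma> in at_top. Y \<sigma> = Y0 \<sigma>) \<and> (\<forall>\<tau>\<ge>a. W \<gamma> \<tau> (\<gamma> \<tau>) = fst (Y \<tau>))"
    if l: "linking_path \<Delta> A \<gamma> a" for \<gamma> a
  proof -
    obtain Y where Y: "section_along q \<gamma> {a..} Y" "\<forall>\<^sub>F \<sigma> in at_top. Y \<sigma> = Y0 \<sigma>"
      "\<And>\<tau>. \<tau> \<ge> a \<Longrightarrow> branch_data q Y0 \<gamma> \<tau> = Y \<tau>"
      using ex[OF l] by blast
    have "W \<gamma> \<tau> (\<gamma> \<tau>) = fst (Y \<tau>)" if "\<tau> \<ge> a" for \<tau>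
      unfolding W_def Y(3)[OF that] using path(2)[OF l] that by (intro local_solution_ode(2)[OF D(1) q]) auto
    then show ?thesis using Y(1,2) unfolding q_def by blast
  qed
  ultimately show ?thesis by blast
qed

section \<open>Duhamel and Gronwall estimates\<close>

text \<open>Meant for path derivatives, which at corners have no prescribed value: measurability and
  boundedness off a finite set are enough for integrability.\<close>

lemma integrable_bounded_isCont_off_finite:
  fixes f :: "real \<Rightarrow> 'a::euclidean_space"
  assumes F: "finite F" and cont: "\<And>t. t \<in> {a<..<b} - F \<Longrightarrow> isCont f t"
    and bnd: "\<And>t. t \<in> {a<..<b} - F \<Longrightarrow> norm (f t) \<le> B"
  shows "f integrable_on {a..b}"
proof -
  define S where "S = {a<..<b} - F"
  have S: "open S" unfolding S_def using F by (intro open_Diff finite_imp_closed) auto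
  have "f integrable_on S"
  proof (rule measurable_bounded_by_integrable_imp_integrable)
    have SL: "S \<in> sets lebesgue" using S borel_open by (simp add: sets_completionI_sets)
    then show "S \<in> sets lebesgue" .
    show "f \<in> borel_measurable (lebesgue_on S)"
      by (rule continuous_imp_measurable_on_sets_lebesgue[OF _ SL])
        (use cont in \<open>auto simp: S_def intro: continuous_at_imp_continuous_on\<close>)
    have "bounded S" unfolding S_def by (rule bounded_subset[OF bounded_closed_interval[of a b]]) auto
    then have "S \<in> lmeasurable" using SL by (simp add: bounded_set_imp_lmeasurable)
    then show "(\<lambda>_. B) integrable_on S" by (rule integrable_on_const)
    show "norm (f t) \<le> B" if "t \<in> S" for t using bnd that by (simp add: S_def)
  qed
  then show ?thesis
  proof (rule integrable_spike_set)
    show "negligible {x \<in> S - {a..b}. f x \<noteq> 0}" "negligible {x \<in> {a..b} - S. f x \<noteq> 0}"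
      by (rule negligible_subset[of "F \<union> {a, b}"]; use F in \<open>auto simp: S_def\<close>)+
  qed
qed

lemma integral_has_real_derivative_isCont:
  fixes m :: "real \<Rightarrow> real"
  assumes "m integrable_on {s..R}" "t \<in> {s<..<R}" "isCont m t"
  shows "((\<lambda>\<tau>. integral {s..\<tau>} m) has_real_derivative m t) (at t)"
proof -
  have "((\<lambda>\<tau>. integral {s..\<tau>} m) has_vector_derivative m t) (at t within ({s..R} - {}))"
    by (rule integral_has_vector_derivative_continuous_at)
      (use assms in \<open>auto intro: continuous_at_imp_continuous_within\<close>)
  moreover have "at t within {s..R} = at t" using assms(2) by (intro at_within_interior) simp
  ultimately show ?thesis by (simp add: has_real_derivative_iff_has_vector_derivative)
qed

text \<open>\<open>H\<close> is \<open>M\<close> times the integrating factor exp(-K), with K the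
  integral of \<open>k\<close> from t to R, minus the integral of \<open>a\<close> from t to R. As
  the integrating factor is at most 1, \<open>H\<close> is nondecreasing, and its values at
  \<open>s\<close> and \<open>R\<close> give the claim. The argument runs backwards because the
  known data sit at \<open>R\<close>.\<close>

lemma gronwall_backward:
  fixes m a k M :: "real \<Rightarrow> real"
  assumes sR: "s \<le> R" and F: "finite F"
    and int: "m integrable_on {s..R}" "a integrable_on {s..R}" "k integrable_on {s..R}"
    and cont: "\<And>t. t \<in> {s<..<R} - F \<Longrightarrow> isCont m t \<and> isCont a t \<and> isCont k t"
    and k0: "\<And>t. k t \<ge> 0" and a0: "\<And>t. a t \<ge> 0"
    and M: "\<And>t. t \<in> {s..R} \<Longrightarrow> M t = d + integral {t..R} m"
    and le: "\<And>t. t \<in> {s..R} \<Longrightarrow> m t \<le> a t + k t * M t"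
  shows "M s \<le> (d + integral {s..R} a) * exp (integral {s..R} k)"
proof -
  define I where "I f t = integral {s..R} f - integral {s..t} f" for f :: "real \<Rightarrow> real" and t
  have I: "I f t = integral {t..R} f" if "f integrable_on {s..R}" "t \<in> {s..R}" for f t
    using Henstock_Kurzweil_Integration.integral_combine[of s t R f] that unfolding I_def by auto
  have dI: "(I f has_real_derivative - f t) (at t)"
    if "f integrable_on {s..R}" "t \<in> {s<..<R}" "isCont f t" for f t
    unfolding I_def using DERIV_diff[OF DERIV_const integral_has_real_derivative_isCont[OF that]] by simp
  have cI: "continuous_on {s..R} (I f)" if "f integrable_on {s..R}" for f
    unfolding I_def by (intro continuous_intros indefinite_integral_continuous_1 that)
  define H where "H t = (d + I m t) * exp (- I k t) - I a t" for t
  \<comment> \<open>The value 0 at the ends and at the points of \<open>F\<close> keeps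
    \<open>H'\<close> nonnegative there and does not affect its integral.\<close>
  define H' where "H' t = (if t \<in> {s<..<R} - F then
      exp (- I k t) * (- m t + k t * (d + I m t)) + a t else 0)" for t
  have "(H' has_integral (H R - H s)) {s..R}"
  proof (rule fundamental_theorem_of_calculus_interior_strong[OF F sR])
    show "continuous_on {s..R} H" unfolding H_def by (intro continuous_intros cI int)
    fix t assume t: "t \<in> {s<..<R} - F"
    then have "isCont m t" "isCont a t" "isCont k t" and t': "t \<in> {s<..<R}" using cont by auto
    note d = dI[OF int(1) t' this(1)] dI[OF int(2) t' this(2)] dI[OF int(3) t' this(3)]
    have "(H has_real_derivative H' t) (at t)"
      unfolding H_def
      by (rule derivative_eq_intros d refl)+ (use t in \<open>simp add: H'_def algebra_simps\<close>)
    then show "(H has_vector_derivative H' t) (at t)"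
      by (simp add: has_real_derivative_iff_has_vector_derivative)
  qed
  moreover have "0 \<le> H' t" if "t \<in> {s..R}" for t
  proof (cases "t \<in> {s<..<R} - F")
    case True
    have Ik0: "0 \<le> I k t" using I[OF int(3) that] k0 by (simp add: integral_nonneg integrable_on_subinterval[OF int(3)] that[unfolded atLeastAtMost_iff])
    have "m t \<le> a t + k t * (d + I m t)" using le[OF that] M[OF that] I[OF int(1) that] by simp
    then have "exp (- I k t) * (- a t) \<le> exp (- I k t) * (- m t + k t * (d + I m t))"
      by (intro mult_left_mono) auto
    moreover have "exp (- I k t) * a t \<le> 1 * a t" using Ik0 a0 by (intro mult_right_mono) auto
    ultimately show ?thesis using True by (simp add: H'_def)
  next
    case False
    then show ?thesis by (simp only: H'_def if_False order_refl)
  qed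
  ultimately have "0 \<le> H R - H s" by (rule has_integral_nonneg)
  moreover have "H R = d" unfolding H_def I_def by simp
  moreover have "H s = M s * exp (- integral {s..R} k) - integral {s..R} a"
    unfolding H_def using I[of _ s] int M[of s] sR by simp
  ultimately have "M s * exp (- integral {s..R} k) \<le> d + integral {s..R} a" by simp
  then show ?thesis by (simp add: exp_minus field_simps)
qed

text \<open>In the applications \<open>y\<close> is h, \<open>z\<close> is h', \<open>X\<close> is
  the residual and \<open>g\<close> the derivative of the path. One quantity \<open>M\<close>
  dominates both |y| and |z|/|u|; measuring z in units of u turns the term 2 T z / u into at most 2
  |T| M, the source of \<open>2 * Q\<close> in the exponent. The size \<open>d\<close> of the data
  at the finite end \<open>R\<close> is kept as a parameter that can tend to 0.\<close>

lemma duhamel_bound: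
  fixes \<gamma> g y z X T :: "real \<Rightarrow> complex"
  assumes sR: "s \<le> R" and F: "finite F" and u: "u \<noteq> 0"
    and cont: "continuous_on {s..R} \<gamma>" "continuous_on {s..R} X" "continuous_on {s..R} T"
      "continuous_on {s..R} y" "continuous_on {s..R} z"
    and g: "\<And>t. t \<in> {s<..<R} - F \<Longrightarrow> (\<gamma> has_vector_derivative g t) (at t)"
      "\<And>t. t \<in> {s<..<R} - F \<Longrightarrow> isCont g t" "\<And>t. t \<in> {s<..<R} - F \<Longrightarrow> norm (g t) \<le> B"
    and dy: "\<And>t. t \<in> {s<..<R} - F \<Longrightarrow> (y has_vector_derivative g t * z t) (at t)"
    and dz: "\<And>t. t \<in> {s<..<R} - F \<Longrightarrow>
       (z has_vector_derivative g t * (X t * (1 + y t) - 2 * (u + T t / u) * z t)) (at t)"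
    and mono: "\<And>t t'. s \<le> t \<Longrightarrow> t \<le> t' \<Longrightarrow> t' \<le> R \<Longrightarrow> Re (u * \<gamma> t') \<le> Re (u * \<gamma> t)"
    and d: "norm (y R) + norm (z R) / norm u \<le> d"
  defines "P \<equiv> integral {s..R} (\<lambda>t. norm (X t) * norm (g t)) / norm u"
    and "Q \<equiv> integral {s..R} (\<lambda>t. norm (T t) * norm (g t)) / norm u"
  shows "norm (y s) \<le> (d + P) * exp (P + 2 * Q) \<and> norm (z s) / norm u \<le> (d + P) * exp (P + 2 * Q)"
proof -
  define f where "f t = X t * (1 + y t) - 2 * (T t / u) * z t" for t
  have cf: "continuous_on {s..R} f" unfolding f_def using u by (intro continuous_intros cont) auto
  have isC: "isCont h t" if "continuous_on {s..R} h" "t \<in> {s<..<R}" for h :: "real \<Rightarrow> complex" and t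
    using continuous_on_interior[OF that(1)] that(2) by simp
  have ig: "(\<lambda>t. norm (h t) * norm (g t)) integrable_on {s..R}" if h: "continuous_on {s..R} h" for h :: "real \<Rightarrow> complex"
  proof -
    have "compact (h ` {s..R})" by (rule compact_continuous_image[OF h]) simp
    then obtain C where "\<forall>x\<in>h ` {s..R}. norm x \<le> C"
      using compact_imp_bounded[of "h ` {s..R}"] unfolding bounded_iff by blast
    then have C: "norm (h t) \<le> C" if "t \<in> {s..R}" for t using that by blast
    show ?thesis
    proof (rule integrable_bounded_isCont_off_finite[OF F])
      fix t assume t: "t \<in> {s<..<R} - F"
      show "isCont (\<lambda>t. norm (h t) * norm (g t)) t"
        using isC[OF h] g(2) t by (intro continuous_intros) auto
      show "norm (norm (h t) * norm (g t)) \<le> C * B"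
        using mult_mono[OF C[of t] g(3)[OF t]] t order_trans[OF norm_ge_zero C[of t]] by auto
    qed
  qed
  define m where "m t = norm (f t) * norm (g t) / norm u" for t
  define a where "a t = norm (X t) * norm (g t) / norm u" for t
  define k where "k t = a t + 2 * (norm (T t) * norm (g t) / norm u)" for t
  have int: "m integrable_on {s..R}" "a integrable_on {s..R}" "k integrable_on {s..R}"
    unfolding m_def a_def k_def
    by (intro integrable_add integrable_on_divide integrable_on_mult_right ig cf cont)+
  have cm: "isCont m t \<and> isCont a t \<and> isCont k t" if "t \<in> {s<..<R} - F" for t
    unfolding m_def a_def k_def using isC[OF cf] isC[OF cont(2)] isC[OF cont(3)] g(2) that u
    by (intro conjI continuous_intros) auto
  define M where "M t = d + integral {t..R} m" for t
  have bound: "norm (y \<tau>) \<le> M \<tau> \<and> norm (z \<tau>) / norm u \<le> M \<tau>" if t: "\<tau> \<in> {s..R}" for \<tau>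
  proof -
    have sub: "{\<tau>..R} \<subseteq> {s..R}" and tR: "\<tau> \<le> R" using t by auto
    \<comment> \<open>The Duhamel kernel. By monotonicity its modulus is at most 1 on
      \<open>{\<tau>..R}\<close>, so \<open>1 - e t\<close> is at most 2 in modulus; that 2 is
      absorbed by the factor \<open>2 * u\<close> in front of y.\<close>
    define e where "e t = exp (2 * u * (\<gamma> t - \<gamma> \<tau>))" for t
    have ce: "continuous_on {\<tau>..R} e" unfolding e_def
      by (intro continuous_intros continuous_on_subset[OF cont(1) sub])
    have ne: "norm (e t) \<le> 1" if "t \<in> {\<tau>..R}" for t
      using mono[of \<tau> t] that t unfolding e_def by (simp add: algebra_simps)
    \<comment> \<open>\<open>2 u y + z\<close> and \<open>z e\<^sup>2\<^sup>u\<^sup>\<gamma>\<close> both have a derivative free of the term \<open>2 u z\<close>.\<close>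
    have c: "((\<lambda>t. g t * f t) has_integral ((2 * u * y R + z R) - (2 * u * y \<tau> + z \<tau>))) {\<tau>..R}"
    proof (rule fundamental_theorem_of_calculus_interior_strong[OF F tR])
      show "continuous_on {\<tau>..R} (\<lambda>t. 2 * u * y t + z t)"
        by (intro continuous_intros continuous_on_subset[OF _ sub] cont)
      fix t assume "t \<in> {\<tau><..<R} - F"
      then have t': "t \<in> {s<..<R} - F" using t by auto
      show "((\<lambda>t. 2 * u * y t + z t) has_vector_derivative g t * f t) (at t)"
        using has_vector_derivative_add[OF has_vector_derivative_mult_right[OF dy[OF t'], of "2 * u"] dz[OF t']]
        by (rule has_vector_derivative_eq_rhs) (simp add: f_def algebra_simps)
    qed
    have ze: "((\<lambda>t. g t * f t * e t) has_integral (z R * e R - z \<tau> * e \<tau>)) {\<tau>..R}"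
    proof (rule fundamental_theorem_of_calculus_interior_strong[OF F tR])
      show "continuous_on {\<tau>..R} (\<lambda>t. z t * e t)"
        by (intro continuous_intros continuous_on_subset[OF _ sub] cont ce)
      fix t assume "t \<in> {\<tau><..<R} - F"
      then have t': "t \<in> {s<..<R} - F" using t by auto
      have "((\<lambda>t. 2 * u * (\<gamma> t - \<gamma> \<tau>)) has_vector_derivative (2 * u * (g t - 0))) (at t)"
        by (intro has_vector_derivative_mult_right has_vector_derivative_diff g(1)[OF t'] has_vector_derivative_const)
      then have de: "(e has_vector_derivative (2 * u * (g t - 0) * e t)) (at t)"
        unfolding e_def using field_vector_diff_chain_at[OF _ DERIV_exp] by (auto simp: o_def)
      show "((\<lambda>t. z t * e t) has_vector_derivative g t * f t * e t) (at t)"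
        using has_vector_derivative_mult[OF dz[OF t'] de]
        by (rule has_vector_derivative_eq_rhs) (simp add: f_def algebra_simps)
    qed
    have im: "m integrable_on {\<tau>..R}" using int(1) sub integrable_on_subinterval by blast
    have "norm (integral {\<tau>..R} (\<lambda>t. g t * f t * e t)) \<le> integral {\<tau>..R} (\<lambda>t. norm u * m t)"
    proof (rule integral_norm_bound_integral)
      show "norm (g t * f t * e t) \<le> norm u * m t" if "t \<in> {\<tau>..R}" for t
        using mult_left_mono[OF ne[OF that], of "norm (g t * f t)"] u by (simp add: m_def norm_mult mult_ac)
    qed (use ze im in \<open>auto intro: integrable_on_mult_right\<close>)
    then have z1: "norm (z R * e R - z \<tau> * e \<tau>) \<le> norm u * integral {\<tau>..R} m"
      using integral_unique[OF ze] by simp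
    have e\<tau>: "e \<tau> = 1" by (simp add: e_def)
    have "norm (z \<tau>) \<le> norm (z R * e R) + norm (z R * e R - z \<tau> * e \<tau>)"
      unfolding e\<tau> by (metis add.commute diff_add_cancel mult.right_neutral norm_minus_commute norm_triangle_sub norm_triangle_ineq2 diff_le_eq)
    also have "norm (z R * e R) \<le> norm (z R)"
      using mult_left_mono[OF ne[of R], of "norm (z R)"] tR by (simp add: norm_mult)
    finally have z2: "norm (z \<tau>) \<le> norm (z R) + norm u * integral {\<tau>..R} m" using z1 by simp
    \<comment> \<open>Subtracting the two integral identities eliminates \<open>z \<tau>\<close>,
      because \<open>e \<tau> = 1\<close>, and leaves a formula for \<open>y \<tau>\<close>
      alone.\<close>
    have w: "((\<lambda>t. g t * f t * (1 - e t)) has_integral (2 * u * y R + z R * (1 - e R) - 2 * u * y \<tau>)) {\<tau>..R}"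
      using has_integral_diff[OF c ze] e\<tau> by (simp add: algebra_simps)
    have n1e: "norm (1 - e t) \<le> 2" if "t \<in> {\<tau>..R}" for t
      using norm_triangle_ineq4[of 1 "e t"] ne[OF that] by simp
    have "norm (integral {\<tau>..R} (\<lambda>t. g t * f t * (1 - e t))) \<le> integral {\<tau>..R} (\<lambda>t. 2 * norm u * m t)"
    proof (rule integral_norm_bound_integral)
      show "norm (g t * f t * (1 - e t)) \<le> 2 * norm u * m t" if "t \<in> {\<tau>..R}" for t
        using mult_left_mono[OF n1e[OF that], of "norm (g t * f t)"] u by (simp add: m_def norm_mult mult_ac)
    qed (use w im in \<open>auto intro: integrable_on_mult_right\<close>)
    then have y1: "norm (2 * u * y R + z R * (1 - e R) - 2 * u * y \<tau>) \<le> 2 * norm u * integral {\<tau>..R} m"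
      using integral_unique[OF w] by simp
    have "norm (2 * u * y \<tau>) \<le> norm (2 * u * y R + z R * (1 - e R)) + norm (2 * u * y R + z R * (1 - e R) - 2 * u * y \<tau>)"
      by (smt (verit) norm_minus_commute norm_triangle_sub)
    also have "norm (2 * u * y R + z R * (1 - e R)) \<le> norm (2 * u * y R) + norm (z R * (1 - e R))"
      by (rule norm_triangle_ineq)
    also have "norm (z R * (1 - e R)) \<le> 2 * norm (z R)"
      using mult_left_mono[OF n1e[of R], of "norm (z R)"] tR by (simp add: norm_mult mult.commute)
    finally have y2: "2 * norm u * norm (y \<tau>) \<le> 2 * norm u * norm (y R) + 2 * norm (z R) + 2 * norm u * integral {\<tau>..R} m"
      using y1 by (simp add: norm_mult)
    have u0: "norm u > 0" using u by simp
    have "norm (y \<tau>) \<le> norm (y R) + norm (z R) / norm u + integral {\<tau>..R} m"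
      using y2 u0 by (simp add: field_simps)
    moreover have "norm (z \<tau>) / norm u \<le> norm (z R) / norm u + integral {\<tau>..R} m"
      using z2 u0 by (simp add: field_simps)
    ultimately show ?thesis using d unfolding M_def by (smt (verit) norm_ge_zero)
  qed
  have "M s \<le> (d + integral {s..R} a) * exp (integral {s..R} k)"
  proof (rule gronwall_backward[OF sR F int cm])
    show "0 \<le> a t" "0 \<le> k t" for t unfolding a_def k_def by auto
    show "M t = d + integral {t..R} m" for t by (simp add: M_def)
    show "m t \<le> a t + k t * M t" if t: "t \<in> {s..R}" for t
    proof -
      have "norm (f t) \<le> norm (X t) * norm (1 + y t) + 2 * norm (T t) * (norm (z t) / norm u)"
        unfolding f_def using norm_triangle_ineq4[of "X t * (1 + y t)" "2 * (T t / u) * z t"]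
        by (simp add: norm_mult norm_divide)
      also have "\<dots> \<le> norm (X t) * (1 + M t) + 2 * norm (T t) * M t"
        using bound[OF t] norm_triangle_ineq[of 1 "y t"] by (intro add_mono mult_left_mono) auto
      finally have "m t \<le> (norm (X t) * (1 + M t) + 2 * norm (T t) * M t) * norm (g t) / norm u"
        unfolding m_def by (intro divide_right_mono mult_right_mono) auto
      also have "\<dots> = a t + k t * M t" unfolding a_def k_def using u by (simp add: field_simps)
      finally show ?thesis .
    qed
  qed
  moreover have "integral {s..R} a = P" unfolding a_def P_def by simp
  moreover have "integral {s..R} k = P + 2 * Q"
    unfolding k_def P_def Q_def a_def
    by (subst integral_add) (auto intro!: integrable_on_divide integrable_on_mult_right ig cont)
  ultimately have "M s \<le> (d + P) * exp (P + 2 * Q)" by simp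
  then show ?thesis using bound[of s] sR by auto
qed

section \<open>The formal expansion on a path\<close>

abbreviation path_deriv :: "(real \<Rightarrow> complex) \<Rightarrow> real \<Rightarrow> complex" where
  "path_deriv \<gamma> \<tau> \<equiv> vector_derivative \<gamma> (at \<tau>)"

text \<open>The two-sided \<open>path_deriv\<close> is controlled only inside an arc, whereas
  \<open>g\<close> is continuous up to its ends; \<open>g\<close> is what later bounds the path
  derivative close to a corner.\<close>

lemma R2_arc_on_interior:
  assumes "R2_arc_on \<gamma> I"
  obtains g where "continuous_on I g"
    "\<And>t. t \<in> interior I \<Longrightarrow> (\<gamma> has_vector_derivative path_deriv \<gamma> t) (at t)"
    "\<And>t. t \<in> interior I \<Longrightarrow> isCont (path_deriv \<gamma>) t"
    "\<And>t. t \<in> interior I \<Longrightarrow> path_deriv \<gamma> t = g t"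
proof -
  obtain g g' where g: "\<And>t. t \<in> I \<Longrightarrow> (\<gamma> has_vector_derivative g t) (at t within I)"
    "\<And>t. t \<in> I \<Longrightarrow> (g has_vector_derivative g' t) (at t within I)"
    using assms unfolding R2_arc_on_def by blast
  have cg: "continuous_on I g"
    unfolding continuous_on_eq_continuous_within using has_vector_derivative_continuous[OF g(2)] by blast
  have d: "(\<gamma> has_vector_derivative g t) (at t)" if "t \<in> interior I" for t
    using g(1)[of t] that interior_subset[of I] unfolding at_within_interior[OF that] by blast
  then have eq: "path_deriv \<gamma> t = g t" if "t \<in> interior I" for t
    using that vector_derivative_at by blast
  show thesis
  proof (rule that[OF cg])
    fix t assume t: "t \<in> interior I"
    show "(\<gamma> has_vector_derivative path_deriv \<gamma> t) (at t)" using d[OF t] eq[OF t] by simp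
    show "path_deriv \<gamma> t = g t" by (rule eq[OF t])
    have ev: "\<forall>\<^sub>F x in nhds t. path_deriv \<gamma> x = g x"
      by (rule eventually_mono[OF eventually_nhds_in_open[OF open_interior t]]) (rule eq)
    show "isCont (path_deriv \<gamma>) t"
      by (rule iffD2[OF isCont_cong[OF ev] continuous_on_interior[OF cg t]])
  qed
qed

lemma linking_path_regular:
  assumes "linking_path \<Delta> A \<gamma> a"
  obtains F where "finite F"
    "\<And>t. t \<ge> a \<Longrightarrow> t \<notin> F \<Longrightarrow> (\<gamma> has_vector_derivative path_deriv \<gamma> t) (at t)"
    "\<And>t. t \<ge> a \<Longrightarrow> t \<notin> F \<Longrightarrow> isCont (path_deriv \<gamma>) t"
    "\<And>R. \<exists>B. \<forall>t\<in>{a..R} - F. norm (path_deriv \<gamma> t) \<le> B"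
proof -
  obtain k p where p: "p 0 = a" "\<And>i. i < k \<Longrightarrow> p i < p (Suc i)" "\<And>i. i < k \<Longrightarrow> R2_arc_on \<gamma> {p i..p (Suc i)}"
    "R2_arc_on \<gamma> {p k..}"
    using assms unfolding linking_path_def by blast
  \<comment> \<open>The break points together with the starting point \<open>p 0 = a\<close>, to the
    left of which nothing is known about the path.\<close>
  define F where "F = p ` {..k}"
  define good where "good t \<longleftrightarrow> (\<gamma> has_vector_derivative path_deriv \<gamma> t) (at t) \<and> isCont (path_deriv \<gamma>) t" for t
  have bnd: "\<exists>B. \<forall>t\<in>J. norm (g t) \<le> B" if "compact J" "continuous_on J g" for J and g :: "real \<Rightarrow> complex"
    using compact_imp_bounded[OF compact_continuous_image[OF that(2,1)]] unfolding bounded_iff by auto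
  have ind: "a \<le> p i \<and> (\<forall>t\<in>{a..p i} - F. good t) \<and> (\<exists>B. \<forall>t\<in>{a..p i} - F. norm (path_deriv \<gamma> t) \<le> B)"
    if "i \<le> k" for i
    using that
  proof (induction i)
    case 0
    have "p 0 \<in> F" unfolding F_def by auto
    then have "{a..p 0} - F = {}" using p(1) by auto
    then show ?case using p(1) by (metis empty_iff order_refl)
  next
    case (Suc i)
    then have i: "i < k" by simp
    obtain B where B: "\<forall>t\<in>{a..p i} - F. norm (path_deriv \<gamma> t) \<le> B" using Suc.IH i by auto
    obtain g where g: "continuous_on {p i..p (Suc i)} g"
      "\<And>t. t \<in> {p i<..<p (Suc i)} \<Longrightarrow> good t"
      "\<And>t. t \<in> {p i<..<p (Suc i)} \<Longrightarrow> path_deriv \<gamma> t = g t"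
      using R2_arc_on_interior[OF p(3)[OF i]] unfolding good_def interior_atLeastAtMost_real by metis
    obtain C where C: "\<forall>t\<in>{p i..p (Suc i)}. norm (g t) \<le> C" using bnd[OF _ g(1)] by auto
    have "p i \<in> F" "p (Suc i) \<in> F" unfolding F_def using Suc.prems by auto
    then have cov: "{a..p (Suc i)} - F \<subseteq> ({a..p i} - F) \<union> {p i<..<p (Suc i)}"
      by auto
    have "norm (path_deriv \<gamma> t) \<le> max B C" if "t \<in> {a..p (Suc i)} - F" for t
    proof (cases "t \<in> {a..p i} - F")
      case True
      then have "norm (path_deriv \<gamma> t) \<le> B" using B by blast
      then show ?thesis by simp
    next
      case False
      then have "t \<in> {p i<..<p (Suc i)}" using that cov by blast
      then have "norm (path_deriv \<gamma> t) \<le> C" using C g(3)[of t] by simp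
      then show ?thesis by simp
    qed
    then have "\<exists>B. \<forall>t\<in>{a..p (Suc i)} - F. norm (path_deriv \<gamma> t) \<le> B" by blast
    moreover have "\<forall>t\<in>{a..p (Suc i)} - F. good t" using Suc.IH i g(2) cov by auto
    moreover have "a \<le> p (Suc i)" using Suc.IH i p(2)[OF i] by auto
    ultimately show ?case by blast
  qed
  obtain g where g: "continuous_on {p k..} g"
      "\<And>t. t \<in> {p k<..} \<Longrightarrow> good t"
      "\<And>t. t \<in> {p k<..} \<Longrightarrow> path_deriv \<gamma> t = g t"
    using R2_arc_on_interior[OF p(4)] unfolding good_def interior_real_atLeast by metis
  have "p k \<in> F" unfolding F_def by auto
  then have cov: "t \<in> {a..p k} - F \<or> t \<in> {p k<..}" if "t \<ge> a" "t \<notin> F" for t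
    using that by (cases "t \<le> p k") auto
  have gd: "good t" if "t \<ge> a" "t \<notin> F" for t using cov[OF that] ind[of k] g(2) by auto
  show thesis
  proof (rule that[of F])
    show "finite F" unfolding F_def by simp
    fix R
    have "continuous_on {p k..R} g" by (rule continuous_on_subset[OF g(1)]) auto
    then obtain C where C: "\<forall>t\<in>{p k..R}. norm (g t) \<le> C" using bnd by blast
    obtain B where B: "\<forall>t\<in>{a..p k} - F. norm (path_deriv \<gamma> t) \<le> B" using ind[of k] by auto
    have "norm (path_deriv \<gamma> t) \<le> max B C" if t: "t \<in> {a..R} - F" for t
    proof (cases "t \<in> {a..p k} - F")
      case True
      then have "norm (path_deriv \<gamma> t) \<le> B" using B by blast
      then show ?thesis by simp
    next
      case False
      then have "t \<in> {p k<..}" using cov[of t] t by auto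
      then have "norm (path_deriv \<gamma> t) \<le> C" using C g(3)[of t] t by simp
      then show ?thesis by simp
    qed
    then show "\<exists>B. \<forall>t\<in>{a..R} - F. norm (path_deriv \<gamma> t) \<le> B" by blast
  qed (use gd in \<open>auto simp: good_def\<close>)
qed

section \<open>The coefficients and the Riccati residual\<close>

lemma F_coeff_holomorphic:
  assumes "open D" "\<psi> holomorphic_on D"
  shows "F_coeff \<psi> n holomorphic_on D"
proof (induction n rule: less_induct)
  case (less n)
  consider "n = 0" | "n = 1" | "n = 2" | k where "n = Suc (Suc (Suc k))"
    by (metis One_nat_def not0_implies_Suc numeral_2_eq_2)
  then show ?case
  proof cases
    case 4
    have "deriv (F_coeff \<psi> (k + 2)) holomorphic_on D"
      using less[of "k + 2"] 4 assms(1) by (intro holomorphic_deriv) auto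
    moreover have "F_coeff \<psi> j holomorphic_on D" "F_coeff \<psi> (k + 2 - j) holomorphic_on D" if "j \<in> {1..k + 1}" for j
      using less[of j] less[of "k + 2 - j"] 4 that by auto
    ultimately show ?thesis unfolding 4 F_coeff.simps
      by (intro holomorphic_on_diff holomorphic_on_mult holomorphic_on_sum holomorphic_on_const) auto
  qed (use assms in \<open>auto simp: numeral_2_eq_2 intro!: holomorphic_intros\<close>)
qed

text \<open>With an empty convolution the recursion also yields F_2 = -psi'/4 from F_1 = psi/2, so a
  single formula serves from s = 1 on.\<close>

lemma F_coeff_Suc:
  assumes "open D" "\<psi> holomorphic_on D" "z \<in> D" "s \<ge> 1"
  shows "F_coeff \<psi> (Suc s) z = - (1 / 2) * deriv (F_coeff \<psi> s) z
     - (1 / 2) * (\<Sum>j = 1..s - 1. F_coeff \<psi> j z * F_coeff \<psi> (s - j) z)"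
proof (cases "s = 1")
  case True
  have "(\<psi> has_field_derivative deriv \<psi> z) (at z)" using assms holomorphic_derivI by blast
  from DERIV_cdivide[OF this, of 2] have "deriv (\<lambda>\<xi>. \<psi> \<xi> / 2) z = deriv \<psi> z / 2" by (rule DERIV_imp_deriv)
  then show ?thesis using True by simp
next
  case False
  then obtain k where "s = Suc (Suc k)" using assms(4) by (cases s; cases "s - 1") auto
  then show ?thesis by (simp del: sum.cl_ivl_Suc)
qed

text \<open>The algebra behind the residual. With psi = 2 a_1 and S the partial sum, the left side
  is psi - 2 u S - S' - S^2, that is, what u + S misses in the Riccati equation P' + P^2 = u^2 +
  psi. The induction adds one term a_n / u^n at a time; the derivative enters only through the
  sequence \<open>a'\<close> in the recursion.\<close>

lemma chi_recursion:
  fixes a a' :: "nat \<Rightarrow> complex"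
  assumes u: "u \<noteq> 0" and a: "\<And>s. s \<ge> 1 \<Longrightarrow>
    a (Suc s) = - (1 / 2) * a' s - (1 / 2) * (\<Sum>j = 1..s - 1. a j * a (s - j))"
  defines "G \<equiv> \<lambda>n s. \<Sum>k = s..n - 1. a k * a (s + n - k - 1)"
  defines "chi \<equiv> \<lambda>n. 2 * a n - (\<Sum>s = 1..n - 1. G n s / u ^ s)"
  assumes "n \<ge> 1"
  shows "2 * a 1 - 2 * u * (\<Sum>s = 1..n - 1. a s / u ^ s) - (\<Sum>s = 1..n - 1. a' s / u ^ s)
     - (\<Sum>s = 1..n - 1. a s / u ^ s)\<^sup>2 = chi n / u ^ (n - 1)"
  using \<open>n \<ge> 1\<close>
proof (induction n rule: dec_induct)
  case base
  show ?case by (simp add: chi_def)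
next
  case (step n)
  obtain m where m: "n = Suc m" using step by (cases n) auto
  define S where "S = (\<Sum>s = 1..m. a s / u ^ s)"
  define dS where "dS = (\<Sum>s = 1..m. a' s / u ^ s)"
  \<comment> \<open>The two extreme indices k = s and k = n each contribute a_s a_n, and what
    remains is the convolution for n with s raised by one.\<close>
  have Gs: "G (Suc n) s = G n (Suc s) + 2 * a s * a n" if "s \<in> {1..m}" for s
  proof -
    have "{s..n} = insert s (insert n {Suc s..m})" using that m by auto
    moreover have "s \<noteq> n" "s \<notin> {Suc s..m}" "n \<notin> {Suc s..m}" using that m by auto
    ultimately have "(\<Sum>k = s..n. a k * a (s + n - k)) = a s * a n + (a n * a s + (\<Sum>k = Suc s..m. a k * a (s + n - k)))"
      by simp
    then show ?thesis unfolding G_def using m by simp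
  qed
  have Gn: "G (Suc n) n = (a n)\<^sup>2" unfolding G_def by (simp add: power2_eq_square)
  have Gnn: "G n (Suc m) = 0" unfolding G_def using m by simp
  \<comment> \<open>The convolution in the recursion is exactly \<open>G n 1\<close>; this is the
    only place where the recursion is used.\<close>
  have a_next: "2 * a (Suc n) = - a' n - G n 1"
    unfolding a[OF step(1)] G_def using m by simp
  \<comment> \<open>Multiplication by u lowers the exponent by one. The sum may be extended to the
    index \<open>Suc m\<close>, since \<open>G n (Suc m)\<close> is an empty sum.\<close>
  have "(\<Sum>s = 1..m. G n s / u ^ s) * u = (\<Sum>s = 0..m. G n (Suc s) / u ^ s)"
  proof -
    have "(\<Sum>s = 1..m. G n s / u ^ s) * u = (\<Sum>s = 1..m. G n s / u ^ (s - 1))"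
      unfolding sum_distrib_right
    proof (rule sum.cong[OF refl])
      fix s assume "s \<in> {1..m}"
      then obtain r where "s = Suc r" by (cases s) auto
      then show "G n s / u ^ s * u = G n s / u ^ (s - 1)" using u by (simp add: field_simps)
    qed
    also have "\<dots> = (\<Sum>s = 1..Suc m. G n s / u ^ (s - 1))" using Gnn by simp
    also have "\<dots> = (\<Sum>s = 0..m. G n (Suc s) / u ^ s)"
      using sum.shift_bounds_cl_Suc_ivl[of "\<lambda>s. G n s / u ^ (s - 1)" 0 m] by simp
    finally show ?thesis .
  qed
  also have "\<dots> = G n 1 + (\<Sum>s = 1..m. G n (Suc s) / u ^ s)"
    by (subst sum.atLeast_Suc_atMost) auto
  finally have s1: "(\<Sum>s = 1..m. G n s / u ^ s) * u = G n 1 + (\<Sum>s = 1..m. G n (Suc s) / u ^ s)" .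
  have s2: "(\<Sum>s = 1..n. G (Suc n) s / u ^ s) = (\<Sum>s = 1..m. G n (Suc s) / u ^ s) + 2 * a n * S + (a n)\<^sup>2 / u ^ n"
  proof -
    have "(\<Sum>s = 1..n. G (Suc n) s / u ^ s) = (\<Sum>s = 1..m. G (Suc n) s / u ^ s) + G (Suc n) n / u ^ n"
      using m by simp
    also have "(\<Sum>s = 1..m. G (Suc n) s / u ^ s) = (\<Sum>s = 1..m. G n (Suc s) / u ^ s + 2 * a n * (a s / u ^ s))"
      by (intro sum.cong refl) (simp add: Gs add_divide_distrib mult_ac)
    finally show ?thesis by (simp add: sum.distrib sum_distrib_left S_def Gn)
  qed
  have IH: "2 * a 1 - 2 * u * S - dS - S\<^sup>2 = chi n / u ^ m"
    using step.IH m by (simp add: S_def dS_def)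
  have nm: "n - 1 = m" using m by simp
  have uc: "u * chi n = 2 * u * a n - (\<Sum>s = 1..m. G n s / u ^ s) * u"
    unfolding chi_def nm by (simp add: algebra_simps)
  have chiS: "chi (Suc n) = 2 * a (Suc n) - (\<Sum>s = 1..n. G (Suc n) s / u ^ s)"
    by (simp add: chi_def)
  have c: "chi (Suc n) = u * chi n - 2 * u * a n - a' n - 2 * S * a n - (a n)\<^sup>2 / u ^ n"
    unfolding chiS uc s1 s2 a_next by (simp add: algebra_simps)
  have "chi (Suc n) / u ^ n = chi n / u ^ m - 2 * u * (a n / u ^ n) - a' n / u ^ n - 2 * S * (a n / u ^ n) - (a n / u ^ n)\<^sup>2"
    unfolding c using u by (simp add: m field_simps power2_eq_square)
  also have "\<dots> = 2 * a 1 - 2 * u * (S + a n / u ^ n) - (dS + a' n / u ^ n) - (S + a n / u ^ n)\<^sup>2"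
    unfolding IH[symmetric] by (simp add: power2_eq_square algebra_simps)
  finally show ?case using m by (simp add: S_def dS_def)
qed

text \<open>\<open>T_fun \<psi> n u z / u\<close> is the derivative of S_n, hence the correction to
  u in the logarithmic derivative of exp (u xi + S_n).\<close>

lemma T_fun_over_u:
  assumes "u \<noteq> 0"
  shows "T_fun \<psi> n u z / u = (\<Sum>s = 1..n - 1. F_coeff \<psi> s z / u ^ s)"
proof -
  have "T_fun \<psi> n u z / u = (\<Sum>s<n - 1. F_coeff \<psi> (Suc s) z / u ^ Suc s)"
    unfolding T_fun_def using assms by (simp add: sum_divide_distrib mult.commute)
  also have "\<dots> = (\<Sum>s\<in>Suc ` {..<n - 1}. F_coeff \<psi> s z / u ^ s)"
    by (subst sum.reindex) auto
  also have "Suc ` {..<n - 1} = {1..n - 1}"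
    by (simp add: image_Suc_lessThan)
  finally show ?thesis .
qed

lemma T_fun_holomorphic:
  assumes "open D" "\<psi> holomorphic_on D" "u \<noteq> 0"
  shows "T_fun \<psi> n u holomorphic_on D"
proof -
  have "(\<lambda>z. \<Sum>s<n - 1. F_coeff \<psi> (s + 1) z / u ^ s) holomorphic_on D"
    using assms by (intro holomorphic_intros F_coeff_holomorphic) auto
  then show ?thesis by (simp add: T_fun_def[abs_def])
qed

lemma chi_fun_holomorphic:
  assumes "open D" "\<psi> holomorphic_on D" "u \<noteq> 0"
  shows "chi_fun \<psi> n u holomorphic_on D"
proof -
  have "(\<lambda>z. 2 * F_coeff \<psi> n z - (\<Sum>s = 1..n - 1. (\<Sum>k = s..n - 1. F_coeff \<psi> k z * F_coeff \<psi> (s + n - k - 1) z) / u ^ s)) holomorphic_on D"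
    using assms by (intro holomorphic_intros F_coeff_holomorphic) auto
  then show ?thesis by (simp add: chi_fun_def[abs_def] G_fun_def)
qed

text \<open>The Riccati residual of u + T_n/u at a point, obtained from \<open>chi_recursion\<close>
  with the values of the F_s and of their derivatives. It becomes the coefficient of 1 + h in the
  equation for h.\<close>

lemma chi_fun_identity:
  assumes D: "open D" "\<psi> holomorphic_on D" "z \<in> D" and u: "u \<noteq> 0" and n: "n \<ge> 1"
  shows "\<psi> z - 2 * T_fun \<psi> n u z - deriv (T_fun \<psi> n u) z / u - (T_fun \<psi> n u z / u)\<^sup>2
     = chi_fun \<psi> n u z / u ^ (n - 1)"
proof -
  have dF: "(F_coeff \<psi> s has_field_derivative deriv (F_coeff \<psi> s) z) (at z)" for s
    using holomorphic_derivI[OF F_coeff_holomorphic[OF D(1,2)] D(1,3)] .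
  have "(\<lambda>z. \<Sum>s = 1..n - 1. F_coeff \<psi> s z / u ^ s) = (\<lambda>z. T_fun \<psi> n u z / u)"
    using T_fun_over_u[OF u] by auto
  moreover have "((\<lambda>z. \<Sum>s = 1..n - 1. F_coeff \<psi> s z / u ^ s) has_field_derivative
      (\<Sum>s = 1..n - 1. deriv (F_coeff \<psi> s) z / u ^ s)) (at z)"
    by (intro DERIV_sum DERIV_cdivide dF)
  ultimately have "((\<lambda>z. T_fun \<psi> n u z / u) has_field_derivative
      (\<Sum>s = 1..n - 1. deriv (F_coeff \<psi> s) z / u ^ s)) (at z)" by simp
  moreover have "((\<lambda>z. T_fun \<psi> n u z / u) has_field_derivative deriv (T_fun \<psi> n u) z / u) (at z)"
    by (intro DERIV_cdivide holomorphic_derivI[OF T_fun_holomorphic[OF D(1,2) u] D(1,3)])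
  ultimately have dT: "deriv (T_fun \<psi> n u) z / u = (\<Sum>s = 1..n - 1. deriv (F_coeff \<psi> s) z / u ^ s)"
    by (rule DERIV_unique[symmetric])
  have "2 * u * (T_fun \<psi> n u z / u) = 2 * T_fun \<psi> n u z" using u by simp
  then show ?thesis
    using chi_recursion[OF u F_coeff_Suc[OF D] n] unfolding dT T_fun_over_u[OF u, symmetric]
    by (simp add: chi_fun_def G_fun_def)
qed

text \<open>For a nonnegative integrand, integrability on the half line is absolute, which gives
  convergence of the truncated Lebesgue integrals to the full one.\<close>

lemma integral_tail_tendsto_0:
  fixes f :: "real \<Rightarrow> real"
  assumes f: "f integrable_on {b..}" "\<And>x. 0 \<le> f x"
  shows "((\<lambda>t. integral {t..} f) \<longlongrightarrow> 0) at_top"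
proof -
  have ab: "f absolutely_integrable_on {b..}"
    using f by (intro nonnegative_absolutely_integrable_1) auto
  have "((\<lambda>t. set_lebesgue_integral lebesgue {b..t} f) \<longlongrightarrow> set_lebesgue_integral lebesgue {b..} f) at_top"
    by (rule tendsto_set_lebesgue_integral_at_top) (use ab in auto)
  moreover have "set_lebesgue_integral lebesgue {b..t} f = integral {b..t} f" for t
    by (intro set_lebesgue_integral_eq_integral set_integrable_subset[OF ab]) auto
  moreover have "set_lebesgue_integral lebesgue {b..} f = integral {b..} f"
    by (intro set_lebesgue_integral_eq_integral ab)
  ultimately have "((\<lambda>t. integral {b..} f - integral {b..t} f) \<longlongrightarrow> integral {b..} f - integral {b..} f) at_top"
    by (intro tendsto_intros) simp
  moreover have "\<forall>\<^sub>F t in at_top. integral {b..} f - integral {b..t} f = integral {t..} f"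
    using eventually_ge_at_top[of b]
  proof eventually_elim
    case (elim t)
    have "{b..t} \<union> {t..} = {b..}" "{b..t} \<inter> {t..} = {t}" using elim by auto
    moreover have "f integrable_on {b..t}" "f integrable_on {t..}"
      using set_integrable_subset[OF ab, of "{b..t}"] set_integrable_subset[OF ab, of "{t..}"] elim
      by (auto intro: absolutely_integrable_on_def[THEN iffD1, THEN conjunct1])
    ultimately show ?case using integral_Un[of f "{b..t}" "{t..}"] by simp
  qed
  ultimately show ?thesis by (simp add: tendsto_cong)
qed

section \<open>Recessive solutions\<close>

lemma arclength_integral_Icc_le:
  assumes "arclength_integrable h \<gamma> a" "a \<le> s"
  shows "integral {s..R} (\<lambda>t. norm (h (\<gamma> t)) * norm (path_deriv \<gamma> t)) \<le> arclength_integral h \<gamma> s"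
    "arclength_integrable h \<gamma> s"
proof -
  let ?f = "\<lambda>t. norm (h (\<gamma> t)) * norm (path_deriv \<gamma> t)"
  have ab: "?f absolutely_integrable_on {a..}"
    using assms(1) unfolding arclength_integrable_def by (intro nonnegative_absolutely_integrable_1) auto
  have i: "?f integrable_on J" if "J \<subseteq> {a..}" "J \<in> sets lebesgue" for J
    using set_integrable_subset[OF ab that(2,1)] by (rule set_lebesgue_integral_eq_integral(1))
  have "?f integrable_on {s..R}" "?f integrable_on {s..}" using assms(2) by (auto intro!: i)
  then show "integral {s..R} ?f \<le> arclength_integral h \<gamma> s" "arclength_integrable h \<gamma> s"
    unfolding arclength_integral_def arclength_integrable_def by (auto intro!: integral_subset_le)
qed

lemma arclength_integral_nonneg: "0 \<le> arclength_integral h \<gamma> a"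
  unfolding arclength_integral_def by (cases "(\<lambda>\<tau>. norm (h (\<gamma> \<tau>)) * norm (path_deriv \<gamma> \<tau>)) integrable_on {a..}")
    (auto simp: not_integrable_integral intro: integral_nonneg)

text \<open>The case n = 1, where T_1 = 0, chi_1 = psi and Phi is a pure exponential. The data at
  \<open>R\<close> match e^(v xi) exactly, so the initial size is 0, and replacing the integral up
  to \<open>R\<close> by the whole tail makes the bound independent of \<open>R\<close>.\<close>

lemma section_along_base_bound:
  assumes D: "open \<Delta>" "\<psi> holomorphic_on \<Delta>" and v: "v \<noteq> 0"
    and lp: "linking_path \<Delta> A0 A b"
    and mono: "\<And>s t. b \<le> s \<Longrightarrow> s \<le> t \<Longrightarrow> Re (v * A t) \<le> Re (v * A s)"
    and int: "arclength_integrable \<psi> A b"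
    and Y: "section_along (\<lambda>z. v\<^sup>2 + \<psi> z) A {b..} Y"
    and R: "Y R = (exp (v * A R), v * exp (v * A R))" and t: "b \<le> t" "t \<le> R"
  defines "I \<equiv> arclength_integral \<psi> A t / norm v"
  shows "norm (exp (- v * A t) * fst (Y t) - 1) \<le> I * exp I"
    "norm (exp (- v * A t) * (snd (Y t) - v * fst (Y t))) / norm v \<le> I * exp I"
proof -
  obtain F where F: "finite F"
    "\<And>t. t \<ge> b \<Longrightarrow> t \<notin> F \<Longrightarrow> (A has_vector_derivative path_deriv A t) (at t)"
    "\<And>t. t \<ge> b \<Longrightarrow> t \<notin> F \<Longrightarrow> isCont (path_deriv A) t"
    "\<And>R. \<exists>B. \<forall>t\<in>{b..R} - F. norm (path_deriv A t) \<le> B"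
    using linking_path_regular[OF lp] by blast
  obtain B where B: "\<forall>t\<in>{b..R} - F. norm (path_deriv A t) \<le> B" using F(4) by blast
  have cA: "continuous_on {b..} A" and im: "A ` {b..} \<subseteq> \<Delta>"
    using linking_path_continuous[OF lp] lp unfolding linking_path_def by auto
  have cA': "continuous_on {t..R} A" by (rule continuous_on_subset[OF cA]) (use t in auto)
  have cpsi: "continuous_on {t..R} (\<lambda>\<tau>. \<psi> (A \<tau>))"
    by (rule continuous_on_compose2[OF holomorphic_on_imp_continuous_on[OF D(2)] cA']) (use im t in auto)
  have cY: "continuous_on {t..R} (\<lambda>\<tau>. fst (Y \<tau>))" "continuous_on {t..R} (\<lambda>\<tau>. snd (Y \<tau>))"
    using section_along_continuous[OF Y cA] t by (auto elim: continuous_on_subset)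
  define e where "e \<tau> = exp (- v * A \<tau>)" for \<tau>
  have de: "(e has_vector_derivative (- v * path_deriv A \<tau> * e \<tau>)) (at \<tau>)"
    if "(A has_vector_derivative path_deriv A \<tau>) (at \<tau>)" for \<tau>
    using field_vector_diff_chain_at[OF has_vector_derivative_mult_right[OF that, of "- v"] DERIV_exp]
    unfolding e_def by (simp add: o_def)
  have ce: "continuous_on {t..R} e" unfolding e_def by (intro continuous_intros cA')
  let ?y = "\<lambda>\<tau>. e \<tau> * fst (Y \<tau>) - 1" and ?z = "\<lambda>\<tau>. e \<tau> * (snd (Y \<tau>) - v * fst (Y \<tau>))"
  note db = duhamel_bound[where s = t and R = R and F = F and u = v and \<gamma> = A and g = "path_deriv A" and B = B
      and X = "\<lambda>\<tau>. \<psi> (A \<tau>)" and T = "\<lambda>_. 0" and y = ?y and z = ?z and d = 0]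
  have fin: "norm (?y t) \<le> (0 + integral {t..R} (\<lambda>\<tau>. norm (\<psi> (A \<tau>)) * norm (path_deriv A \<tau>)) / norm v) *
       exp (integral {t..R} (\<lambda>\<tau>. norm (\<psi> (A \<tau>)) * norm (path_deriv A \<tau>)) / norm v + 2 * (integral {t..R} (\<lambda>\<tau>. norm (0 :: complex) * norm (path_deriv A \<tau>)) / norm v)) \<and>
     norm (?z t) / norm v \<le> (0 + integral {t..R} (\<lambda>\<tau>. norm (\<psi> (A \<tau>)) * norm (path_deriv A \<tau>)) / norm v) *
       exp (integral {t..R} (\<lambda>\<tau>. norm (\<psi> (A \<tau>)) * norm (path_deriv A \<tau>)) / norm v + 2 * (integral {t..R} (\<lambda>\<tau>. norm (0 :: complex) * norm (path_deriv A \<tau>)) / norm v))"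
  proof (rule db)
    fix \<tau> assume "\<tau> \<in> {t<..<R} - F"
    then have \<tau>: "\<tau> \<ge> b" "\<tau> \<notin> F" "\<tau> \<in> interior {b..}" "\<tau> \<in> {b..R} - F" using t by (auto simp: interior_real_atLeast)
    have dA: "(A has_vector_derivative path_deriv A \<tau>) (at \<tau>)" using F(2) \<tau> by blast
    note dY = section_along_derivative[OF Y \<tau>(3) dA]
    show "(A has_vector_derivative path_deriv A \<tau>) (at \<tau>)" by (rule dA)
    show "isCont (path_deriv A) \<tau>" using F(3) \<tau> by blast
    show "norm (path_deriv A \<tau>) \<le> B" using B \<tau> by blast
    show "(?y has_vector_derivative path_deriv A \<tau> * ?z \<tau>) (at \<tau>)"
      by (rule has_vector_derivative_eq_rhs[OF has_vector_derivative_diff[OF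
            has_vector_derivative_mult[OF de[OF dA] dY(1)] has_vector_derivative_const]])
        (simp add: algebra_simps)
    show "(?z has_vector_derivative path_deriv A \<tau> *
        (\<psi> (A \<tau>) * (1 + ?y \<tau>) - 2 * (v + 0 / v) * ?z \<tau>)) (at \<tau>)"
      by (rule has_vector_derivative_eq_rhs[OF
            has_vector_derivative_mult[OF de[OF dA] has_vector_derivative_diff[OF dY(2) has_vector_derivative_mult_right[OF dY(1)]]]])
        (simp add: algebra_simps power2_eq_square)
  next
    show "norm (?y R) + norm (?z R) / norm v \<le> 0"
      unfolding e_def R by (simp add: exp_minus)
  qed (use t v F(1) mono in \<open>auto intro!: continuous_intros cA' cpsi cY ce\<close>)
  let ?J = "integral {t..R} (\<lambda>\<tau>. norm (\<psi> (A \<tau>)) * norm (path_deriv A \<tau>)) / norm v"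
  have J: "?J \<le> I" unfolding I_def by (intro divide_right_mono arclength_integral_Icc_le[OF int]) (use t in auto)
  have "0 \<le> I" unfolding I_def by (simp add: arclength_integral_nonneg)
  then have "?J * exp ?J \<le> I * exp I" using J by (intro mult_mono) auto
  then show "norm (exp (- v * A t) * fst (Y t) - 1) \<le> I * exp I"
    "norm (exp (- v * A t) * (snd (Y t) - v * fst (Y t))) / norm v \<le> I * exp I"
    using fin unfolding e_def by auto
qed

lemma recessive_section_exists:
  assumes D: "open \<Delta>" "\<psi> holomorphic_on \<Delta>" and v: "v \<noteq> 0"
    and lp: "linking_path \<Delta> A0 A b"
    and mono: "\<And>s t. b \<le> s \<Longrightarrow> s \<le> t \<Longrightarrow> Re (v * A t) \<le> Re (v * A s)"
    and int: "arclength_integrable \<psi> A b"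
  shows "\<exists>Y. section_along (\<lambda>z. v\<^sup>2 + \<psi> z) A {b..} Y \<and>
    ((\<lambda>t. exp (- v * A t) * fst (Y t)) \<longlongrightarrow> 1) at_top \<and>
    ((\<lambda>t. exp (- v * A t) * (snd (Y t) - v * fst (Y t))) \<longlongrightarrow> 0) at_top"
proof -
  define q where "q z = v\<^sup>2 + \<psi> z" for z
  have q: "q holomorphic_on \<Delta>" unfolding q_def using D by (auto intro!: holomorphic_intros)
  have cA: "continuous_on {b..} A" and im: "A ` {b..} \<subseteq> \<Delta>"
    using linking_path_continuous[OF lp] lp unfolding linking_path_def by auto
  note ex = section_along_exists_ray[OF D(1) q cA im]
  define I where "I t = arclength_integral \<psi> A t / norm v" for t
  define H where "H t = I t * exp (I t)" for t
  have "\<exists>Y. section_along q A {b..} Y \<and> Y (b + real n) = (exp (v * A (b + real n)), v * exp (v * A (b + real n)))" for n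
    by (rule ex) simp
  then obtain Z where Z: "\<And>n. section_along q A {b..} (Z n)"
    "\<And>n. Z n (b + real n) = (exp (v * A (b + real n)), v * exp (v * A (b + real n)))" by metis
  have bnd: "norm (exp (- v * A t) * fst (Z n t) - 1) \<le> H t \<and>
    norm (exp (- v * A t) * (snd (Z n t) - v * fst (Z n t))) \<le> norm v * H t" if "b \<le> t" "t \<le> b + real n" for n t
    using section_along_base_bound[OF D v lp mono int Z(1)[unfolded q_def] Z(2) that] v
    unfolding H_def I_def by (simp add: field_simps)
  obtain Y1 where Y1: "section_along q A {b..} Y1" "Y1 b = (1, 0)" using ex[of b "(1, 0)"] by auto
  obtain Y2 where Y2: "section_along q A {b..} Y2" "Y2 b = (0, 1)" using ex[of b "(0, 1)"] by auto
  define comb where "comb c t = (fst c * fst (Y1 t) + snd c * fst (Y2 t), fst c * snd (Y1 t) + snd c * snd (Y2 t))"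
    for c :: "complex \<times> complex" and t
  have scomb: "section_along q A {b..} (comb c)" for c
    unfolding comb_def by (rule section_along_combine[OF Y1(1) Y2(1)])
  \<comment> \<open>The data at \<open>t\<close> depend linearly on those at \<open>b\<close>, so
    convergence at the single parameter \<open>b\<close> entails convergence at every
    \<open>t\<close>.\<close>
  have Zc: "Z n t = comb (Z n b) t" if "b \<le> t" for n t
    by (rule section_along_unique[OF D(1) q cA im is_interval_ci Z(1) scomb, of b])
      (use that Y1(2) Y2(2) in \<open>auto simp: comb_def\<close>)
  define E where "E = exp (v * A b)"
  have E: "E * exp (- v * A b) = 1" unfolding E_def by (simp add: exp_minus)
  \<comment> \<open>\<open>C1\<close> and \<open>C2\<close> undo the factor exp (-v A(b)): the
    estimates for the normalised quantities become bounds on value and derivative at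
    \<open>b\<close>, uniform in n.\<close>
  define C1 where "C1 = norm E * (1 + H b)"
  define C2 where "C2 = norm E * (norm v * H b) + norm v * C1"
  have "Z n b \<in> cball 0 C1 \<times> cball 0 C2" for n
  proof -
    have b: "norm (exp (- v * A b) * fst (Z n b) - 1) \<le> H b"
      "norm (exp (- v * A b) * (snd (Z n b) - v * fst (Z n b))) \<le> norm v * H b" using bnd[of b n] by auto
    have "fst (Z n b) = E * (1 + (exp (- v * A b) * fst (Z n b) - 1))" using E by (simp add: algebra_simps)
    then have "norm (fst (Z n b)) \<le> norm E * (1 + norm (exp (- v * A b) * fst (Z n b) - 1))"
      by (metis mult_left_mono norm_ge_zero norm_mult norm_one norm_triangle_ineq)
    also have "\<dots> \<le> C1" unfolding C1_def by (intro mult_left_mono add_left_mono b) auto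
    finally have 1: "norm (fst (Z n b)) \<le> C1" .
    have "snd (Z n b) = E * (exp (- v * A b) * (snd (Z n b) - v * fst (Z n b))) + v * fst (Z n b)"
      using E by (simp add: mult.assoc[symmetric])
    then have "norm (snd (Z n b)) \<le> norm E * norm (exp (- v * A b) * (snd (Z n b) - v * fst (Z n b))) + norm v * norm (fst (Z n b))"
      by (metis norm_mult norm_triangle_ineq)
    also have "\<dots> \<le> C2" unfolding C2_def by (intro add_mono mult_left_mono b 1) auto
    finally show ?thesis using 1 by (simp add: mem_Times_iff)
  qed
  moreover have "compact (cball (0::complex) C1 \<times> cball (0::complex) C2)" by (intro compact_Times compact_cball)
  ultimately obtain c r where r: "strict_mono r" "((\<lambda>n. Z n b) \<circ> r) \<longlonglongrightarrow> c"
    using seq_compactE[OF compact_imp_seq_compact] by metis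
  define Y where "Y = comb c"
  have lim: "(\<lambda>n. fst (Z (r n) t)) \<longlonglongrightarrow> fst (Y t)" "(\<lambda>n. snd (Z (r n) t)) \<longlonglongrightarrow> snd (Y t)" if "b \<le> t" for t
    unfolding Zc[OF that] Y_def comb_def fst_conv snd_conv using r(2)[unfolded o_def]
    by (intro tendsto_intros; simp)+
  have fin: "norm (exp (- v * A t) * fst (Y t) - 1) \<le> H t"
    "norm (exp (- v * A t) * (snd (Y t) - v * fst (Y t))) \<le> norm v * H t" if t: "b \<le> t" for t
  proof -
    obtain N where N: "t \<le> b + real N" by (metis add.commute diff_le_eq real_arch_simple)
    \<comment> \<open>A strictly increasing \<open>r\<close> satisfies r n \<ge> n, so from
      \<open>N\<close> on the starting point of the approximant lies beyond \<open>t\<close> and its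
      estimate holds at \<open>t\<close>.\<close>
    have rn: "t \<le> b + real (r n)" if "n \<ge> N" for n
      using seq_suble[OF r(1), of n] that N by linarith
    show "norm (exp (- v * A t) * fst (Y t) - 1) \<le> H t"
      by (rule LIMSEQ_le_const2[where X = "\<lambda>n. norm (exp (- v * A t) * fst (Z (r n) t) - 1)"])
        (use bnd[OF t rn] lim[OF t] in \<open>auto intro!: tendsto_intros exI[of _ N]\<close>)
    show "norm (exp (- v * A t) * (snd (Y t) - v * fst (Y t))) \<le> norm v * H t"
      by (rule LIMSEQ_le_const2[where X = "\<lambda>n. norm (exp (- v * A t) * (snd (Z (r n) t) - v * fst (Z (r n) t)))"])
        (use bnd[OF t rn] lim[OF t] in \<open>auto intro!: tendsto_intros exI[of _ N]\<close>)
  qed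
  \<comment> \<open>The bound that survived the limit is governed by tail integrals; their
    convergence to 0 is the recessive behaviour sought.\<close>
  have "(I \<longlongrightarrow> 0) at_top"
    unfolding I_def arclength_integral_def
    using tendsto_divide[OF integral_tail_tendsto_0[OF int[unfolded arclength_integrable_def]] tendsto_const, of "norm v"] v by simp
  then have "(H \<longlongrightarrow> 0 * exp 0) at_top" unfolding H_def by (intro tendsto_intros)
  then have H0: "(H \<longlongrightarrow> 0) at_top" "((\<lambda>t. norm v * H t) \<longlongrightarrow> 0) at_top"
    using tendsto_mult_right_zero[of H at_top "norm v"] by auto
  have "((\<lambda>t. exp (- v * A t) * fst (Y t) - 1) \<longlongrightarrow> 0) at_top"
    by (rule Lim_null_comparison[OF eventually_mono[OF eventually_ge_at_top[of b]] H0(1)]) (rule fin)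
  then have "((\<lambda>t. exp (- v * A t) * fst (Y t)) \<longlongrightarrow> 1) at_top" by (simp only: LIM_zero_iff)
  moreover have "((\<lambda>t. exp (- v * A t) * (snd (Y t) - v * fst (Y t))) \<longlongrightarrow> 0) at_top"
    by (rule Lim_null_comparison[OF eventually_mono[OF eventually_ge_at_top[of b]] H0(2)]) (rule fin)
  ultimately show ?thesis using scomb[of c] unfolding Y_def q_def by blast
qed

text \<open>Convergence of the integral of \<open>T_n\<close> does not make \<open>T_n\<close> vanish at infinity, but it is small
  at points arbitrarily far out, which is enough to start the backward estimate there.\<close>

lemma arclength_integrable_frequently_small:
  assumes lp: "linking_path \<Delta> A \<gamma> a" and int: "arclength_integrable h \<gamma> a"
    and inf: "filterlim (\<lambda>t. Re (v * \<gamma> t)) at_bot at_top" and e: "e > 0"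
  shows "\<exists>R\<ge>R0. norm (h (\<gamma> R)) \<le> e"
proof (rule ccontr)
  assume "\<not> ?thesis"
  then have big: "norm (h (\<gamma> t)) > e" if "t \<ge> R0" for t using that by force
  obtain F where F: "finite F"
    "\<And>t. t \<ge> a \<Longrightarrow> t \<notin> F \<Longrightarrow> (\<gamma> has_vector_derivative path_deriv \<gamma> t) (at t)"
    "\<And>t. t \<ge> a \<Longrightarrow> t \<notin> F \<Longrightarrow> isCont (path_deriv \<gamma>) t"
    "\<And>R. \<exists>B. \<forall>t\<in>{a..R} - F. norm (path_deriv \<gamma> t) \<le> B"
    using linking_path_regular[OF lp] by blast
  define s where "s = max R0 a"
  \<comment> \<open>If |h| exceeded \<open>e\<close> everywhere beyond \<open>s\<close>, the length
    of the tail would be at most \<open>C\<close>. The path would then stay bounded, against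
    \<open>Re (v * \<gamma> t)\<close> tending to minus infinity.\<close>
  define C where "C = arclength_integral h \<gamma> s / e"
  have "norm (\<gamma> R - \<gamma> s) \<le> C" if R: "R \<ge> s" for R
  proof -
    have ft: "(path_deriv \<gamma> has_integral (\<gamma> R - \<gamma> s)) {s..R}"
      by (rule fundamental_theorem_of_calculus_interior_strong[OF F(1) R])
        (use F(2) continuous_on_subset[OF linking_path_continuous[OF lp]] in \<open>auto simp: s_def\<close>)
    let ?f = "\<lambda>t. norm (h (\<gamma> t)) * norm (path_deriv \<gamma> t)"
    have "?f integrable_on {s..R}"
      by (rule integrable_on_subinterval[OF int[unfolded arclength_integrable_def]]) (auto simp: s_def)
    then have fi: "(\<lambda>t. ?f t / e) integrable_on {s..R}" by (rule integrable_on_divide)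
    have "norm (integral {s..R} (path_deriv \<gamma>)) \<le> integral {s..R} (\<lambda>t. ?f t / e)"
    proof (rule integral_norm_bound_integral[OF _ fi])
      show "norm (path_deriv \<gamma> t) \<le> ?f t / e" if "t \<in> {s..R}" for t
        using mult_right_mono[OF less_imp_le[OF big[of t]], of "norm (path_deriv \<gamma> t)"] that e
        by (simp add: s_def field_simps)
    qed (use ft in auto)
    also have "\<dots> \<le> C" unfolding C_def integral_divide using e
      by (intro divide_right_mono arclength_integral_Icc_le[OF int]) (auto simp: s_def)
    finally show ?thesis using integral_unique[OF ft] by simp
  qed note le = this
  have "\<forall>\<^sub>F t in at_top. Re (v * \<gamma> t) \<le> Re (v * \<gamma> s) - norm v * C - 1 \<and> t \<ge> s"
    using inf eventually_ge_at_top[of s] unfolding filterlim_at_bot by (intro eventually_conj) auto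
  from eventually_happens'[OF trivial_limit_at_top_linorder this]
  obtain t where t: "Re (v * \<gamma> t) \<le> Re (v * \<gamma> s) - norm v * C - 1" "t \<ge> s" by blast
  have "Re (v * \<gamma> s) - Re (v * \<gamma> t) = Re (v * (\<gamma> s - \<gamma> t))" by (simp add: algebra_simps)
  also have "\<dots> \<le> norm v * norm (\<gamma> t - \<gamma> s)"
    using complex_Re_le_cmod[of "v * (\<gamma> s - \<gamma> t)"] by (simp add: norm_mult norm_minus_commute)
  also have "\<dots> \<le> norm v * C" by (intro mult_left_mono le t) auto
  finally show False using t by simp
qed

text \<open>The function element changes with the parameter, but near a given \<open>\<tau>\<close>
  it may be replaced by the fixed element at \<open>\<tau>\<close>, to which continuity and the
  chain rule apply.\<close>

lemma branched_antiderivative_along: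
  assumes "branched_antiderivative \<Delta> A h f" "linking_path \<Delta> A \<gamma> a"
  shows "continuous_on {a..} (\<lambda>t. f \<gamma> t (\<gamma> t))"
    "t > a \<Longrightarrow> (\<gamma> has_vector_derivative g) (at t) \<Longrightarrow>
       ((\<lambda>t. f \<gamma> t (\<gamma> t)) has_vector_derivative g * h (\<gamma> t)) (at t)"
proof -
  have c: "\<forall>\<^sub>F \<sigma> in at \<tau> within {a..}. f \<gamma> \<sigma> (\<gamma> \<sigma>) = f \<gamma> \<tau> (\<gamma> \<sigma>)"
    and d: "(f \<gamma> \<tau> has_field_derivative h (\<gamma> \<tau>)) (at (\<gamma> \<tau>))" if "\<tau> \<ge> a" for \<tau>
  proof -
    have "\<forall>\<^sub>F \<sigma> in at \<tau> within {a..}. \<forall>\<^sub>F z in nhds (\<gamma> \<sigma>). f \<gamma> \<sigma> z = f \<gamma> \<tau> z"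
      and *: "\<forall>\<^sub>F z in nhds (\<gamma> \<tau>). (f \<gamma> \<tau> has_field_derivative h z) (at z)"
      using assms that unfolding branched_antiderivative_def continued_along_def by blast+
    then show "\<forall>\<^sub>F \<sigma> in at \<tau> within {a..}. f \<gamma> \<sigma> (\<gamma> \<sigma>) = f \<gamma> \<tau> (\<gamma> \<sigma>)"
      by (auto elim!: eventually_mono dest: eventually_nhds_x_imp_x)
    show "(f \<gamma> \<tau> has_field_derivative h (\<gamma> \<tau>)) (at (\<gamma> \<tau>))" by (rule eventually_nhds_x_imp_x[OF *])
  qed
  have cg: "continuous_on {a..} \<gamma>" by (rule linking_path_continuous[OF assms(2)])
  show "continuous_on {a..} (\<lambda>t. f \<gamma> t (\<gamma> t))"
    unfolding continuous_on_def
  proof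
    fix \<tau> assume t: "\<tau> \<in> {a..}"
    then have "(\<gamma> \<longlongrightarrow> \<gamma> \<tau>) (at \<tau> within {a..})" using cg unfolding continuous_on_def by blast
    moreover have "isCont (f \<gamma> \<tau>) (\<gamma> \<tau>)" using DERIV_isCont[OF d] t by simp
    ultimately have "((\<lambda>\<sigma>. f \<gamma> \<tau> (\<gamma> \<sigma>)) \<longlongrightarrow> f \<gamma> \<tau> (\<gamma> \<tau>)) (at \<tau> within {a..})"
      by (rule isCont_tendsto_compose[rotated])
    then show "((\<lambda>t. f \<gamma> t (\<gamma> t)) \<longlongrightarrow> f \<gamma> \<tau> (\<gamma> \<tau>)) (at \<tau> within {a..})"
      using tendsto_cong[OF c[of \<tau>]] t by simp
  qed
  assume t: "t > a" and g: "(\<gamma> has_vector_derivative g) (at t)"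
  have "at t within {a..} = at t" using t by (intro at_within_interior) (simp add: interior_real_atLeast)
  then have "\<forall>\<^sub>F \<sigma> in nhds t. \<sigma> \<in> UNIV \<longrightarrow> f \<gamma> \<sigma> (\<gamma> \<sigma>) = (f \<gamma> t \<circ> \<gamma>) \<sigma>"
    using c[of t] t by (auto simp: eventually_at_filter elim!: eventually_mono)
  from has_vector_derivative_cong_ev[OF this]
  show "((\<lambda>t. f \<gamma> t (\<gamma> t)) has_vector_derivative g * h (\<gamma> t)) (at t)"
    using field_vector_diff_chain_at[OF g d[of t]] t by (simp add: o_def)
qed

text \<open>With \<open>e\<close> the reciprocal of Phi, \<open>?y\<close> is h and
  \<open>?z\<close> is h'. Subtracting the limits \<open>l s\<close> inside \<open>S\<close> makes
  \<open>S\<close> tend to 0, so the assumed normalisation carries over from e^(v xi) to Phi for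
  every N.\<close>

lemma recessive_error_bound:
  assumes D: "open \<Delta>" "\<psi> holomorphic_on \<Delta>" and v: "v \<noteq> 0"
    and lp: "linking_path \<Delta> A \<gamma> a"
    and mono: "\<And>s t. a \<le> s \<Longrightarrow> s \<le> t \<Longrightarrow> Re (v * \<gamma> t) \<le> Re (v * \<gamma> s)"
    and inf: "filterlim (\<lambda>t. Re (v * \<gamma> t)) at_bot at_top"
    and E: "\<And>s. s \<ge> 1 \<Longrightarrow> branched_antiderivative \<Delta> A (F_coeff \<psi> s) (E s)"
    and l: "\<And>s. s \<ge> 1 \<Longrightarrow> ((\<lambda>\<tau>. E s \<gamma> \<tau> (\<gamma> \<tau>)) \<longlongrightarrow> l s) at_top"
    and N: "N \<ge> 1"
    and int: "arclength_integrable (chi_fun \<psi> N v) \<gamma> a" "arclength_integrable (T_fun \<psi> N v) \<gamma> a"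
    and Y: "section_along (\<lambda>z. v\<^sup>2 + \<psi> z) \<gamma> {a..} Y"
    and Ylim: "((\<lambda>t. exp (- v * \<gamma> t) * fst (Y t)) \<longlongrightarrow> 1) at_top"
      "((\<lambda>t. exp (- v * \<gamma> t) * (snd (Y t) - v * fst (Y t))) \<longlongrightarrow> 0) at_top"
  defines "C \<equiv> 1 / norm v ^ N * arclength_integral (chi_fun \<psi> N v) \<gamma> a"
  shows "norm (exp (- v * \<gamma> a - (\<Sum>s = 1..N - 1. (E s \<gamma> a (\<gamma> a) - l s) / v ^ s)) * fst (Y a) - 1)
    \<le> C * exp (4 / norm v * arclength_integral (T_fun \<psi> N v) \<gamma> a + C)"
proof -
  obtain F where F: "finite F"
    "\<And>t. t \<ge> a \<Longrightarrow> t \<notin> F \<Longrightarrow> (\<gamma> has_vector_derivative path_deriv \<gamma> t) (at t)"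
    "\<And>t. t \<ge> a \<Longrightarrow> t \<notin> F \<Longrightarrow> isCont (path_deriv \<gamma>) t"
    "\<And>R. \<exists>B. \<forall>t\<in>{a..R} - F. norm (path_deriv \<gamma> t) \<le> B"
    using linking_path_regular[OF lp] by blast
  have cg: "continuous_on {a..} \<gamma>" and im: "\<gamma> ` {a..} \<subseteq> \<Delta>"
    using linking_path_continuous[OF lp] lp unfolding linking_path_def by auto
  have chol: "continuous_on {a..} (\<lambda>t. h (\<gamma> t))" if "h holomorphic_on \<Delta>" for h
    by (rule continuous_on_compose2[OF holomorphic_on_imp_continuous_on[OF that] cg im])
  define S where "S t = (\<Sum>s = 1..N - 1. (E s \<gamma> t (\<gamma> t) - l s) / v ^ s)" for t
  define T where "T t = T_fun \<psi> N v (\<gamma> t)" for t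
  define p where "p t = T t / v" for t
  define X where "X t = chi_fun \<psi> N v (\<gamma> t) / v ^ (N - 1)" for t
  have cS: "continuous_on {a..} S"
    unfolding S_def by (intro continuous_intros branched_antiderivative_along(1)[OF E lp]) (use v in auto)
  have cT: "continuous_on {a..} T" unfolding T_def by (intro chol T_fun_holomorphic D v)
  have cX: "continuous_on {a..} X" unfolding X_def
    by (intro continuous_intros chol chi_fun_holomorphic D v) (use v in auto)
  have cY: "continuous_on {a..} (\<lambda>t. fst (Y t))" "continuous_on {a..} (\<lambda>t. snd (Y t))"
    by (rule section_along_continuous[OF Y cg])+
  define e where "e t = exp (- v * \<gamma> t - S t)" for t
  have ce: "continuous_on {a..} e" unfolding e_def by (intro continuous_intros cg cS)
  let ?y = "\<lambda>t. e t * fst (Y t) - 1" and ?z = "\<lambda>t. e t * (snd (Y t) - (v + p t) * fst (Y t))"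
  have cp: "continuous_on {a..} p" unfolding p_def by (intro continuous_intros cT) (use v in auto)
  define W where "W = ((\<lambda>t. exp (- v * \<gamma> t) * fst (Y t)))"
  define W' where "W' = (\<lambda>t. exp (- v * \<gamma> t) * (snd (Y t) - v * fst (Y t)))"
  have "(S \<longlongrightarrow> (\<Sum>s = 1..N - 1. (l s - l s) / v ^ s)) at_top"
    unfolding S_def by (intro tendsto_intros l) (use v in auto)
  then have "((\<lambda>t. exp (- S t)) \<longlongrightarrow> exp (- 0)) at_top" by (intro tendsto_intros) simp
  then have eS: "((\<lambda>t. exp (- S t)) \<longlongrightarrow> 1) at_top" by simp
  have lim1: "((\<lambda>t. exp (- S t) * W t) \<longlongrightarrow> 1 * 1) at_top" "((\<lambda>t. exp (- S t) * W' t) \<longlongrightarrow> 1 * 0) at_top"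
    unfolding W_def W'_def by (intro tendsto_mult eS Ylim)+
  have y_eq: "?y t = exp (- S t) * W t - 1" and z_eq: "?z t = exp (- S t) * W' t - p t * (exp (- S t) * W t)" for t
    unfolding e_def W_def W'_def by (simp_all add: exp_diff exp_minus field_simps)
  have small: "\<exists>R\<ge>a. norm (?y R) + norm (?z R) / norm v \<le> d" if d: "d > 0" for d
  proof -
    \<comment> \<open>The sum of what y, the leading part of z and the part with T contribute per
      unit of \<open>d'\<close>. The 2 bounds \<open>exp (- S R) * W R\<close>, which is within
      \<open>d'\<close> of 1; for this \<open>d'\<close> is capped at 1.\<close>
    define c where "c = 1 + 1 / norm v + 2 / (norm v * norm v)"
    have c: "c > 0" unfolding c_def by (smt (verit) divide_nonneg_nonneg mult_nonneg_nonneg norm_ge_zero)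
    define d' where "d' = min 1 (d / c)"
    have d': "d' > 0" "d' \<le> 1" "c * d' \<le> d" unfolding d'_def using d c by (auto simp: min_def field_simps)
    have "\<forall>\<^sub>F t in at_top. dist (exp (- S t) * W t) (1 * 1) < d' \<and> dist (exp (- S t) * W' t) (1 * 0) < d' \<and> t \<ge> a"
      by (intro eventually_conj tendstoD[OF lim1(1) d'(1)] tendstoD[OF lim1(2) d'(1)] eventually_ge_at_top)
    then obtain R0 where R0: "\<forall>t\<ge>R0. dist (exp (- S t) * W t) (1 * 1) < d' \<and> dist (exp (- S t) * W' t) (1 * 0) < d' \<and> t \<ge> a"
      unfolding eventually_at_top_linorder by blast
    obtain R where R: "R \<ge> R0" "norm (T R) \<le> d'"
      using arclength_integrable_frequently_small[OF lp int(2) inf d'(1)] unfolding T_def by blast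
    have 1: "norm (?y R) \<le> d'" unfolding y_eq using R0 R(1) by (simp add: dist_norm less_imp_le)
    have w: "norm (exp (- S R) * W' R) \<le> d'" using R0 R(1) by (simp add: dist_norm less_imp_le)
    have "norm (exp (- S R) * W R) \<le> 2"
      using norm_triangle_ineq[of "?y R" 1] 1 d'(2) unfolding y_eq by simp
    moreover have "norm (p R) \<le> d' / norm v" unfolding p_def norm_divide using R(2) by (intro divide_right_mono) auto
    ultimately have "norm (p R * (exp (- S R) * W R)) \<le> d' / norm v * 2"
      unfolding norm_mult[of "p R"] by (intro mult_mono) (use d' in auto)
    then have "norm (?z R) \<le> d' + d' / norm v * 2"
      unfolding z_eq using norm_triangle_ineq4[of "exp (- S R) * W' R" "p R * (exp (- S R) * W R)"] w by linarith
    then have "norm (?z R) / norm v \<le> (d' + d' / norm v * 2) / norm v" by (rule divide_right_mono) simp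
    moreover have "c * d' = d' + (d' + d' / norm v * 2) / norm v"
      using v by (simp add: c_def field_simps)
    ultimately have "norm (?y R) + norm (?z R) / norm v \<le> c * d'"
      using 1 by linarith
    then show ?thesis using R0 R(1) d'(3) by (intro exI[of _ R]) auto
  qed
  have C: "0 \<le> C" unfolding C_def by (simp add: arclength_integral_nonneg)
  define K where "K = exp (4 / norm v * arclength_integral (T_fun \<psi> N v) \<gamma> a + C)"
  have main: "norm (?y a) \<le> (d + C) * K" if d: "d > 0" for d
  proof -
    obtain R where R: "a \<le> R" "norm (?y R) + norm (?z R) / norm v \<le> d" using small[OF d] by blast
    obtain B where B: "\<forall>t\<in>{a..R} - F. norm (path_deriv \<gamma> t) \<le> B" using F(4) by blast
    let ?P = "integral {a..R} (\<lambda>t. norm (X t) * norm (path_deriv \<gamma> t)) / norm v"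
    let ?Q = "integral {a..R} (\<lambda>t. norm (T t) * norm (path_deriv \<gamma> t)) / norm v"
    have sub: "{a..R} \<subseteq> {a..}" by auto
    note cR = continuous_on_subset[OF _ sub]
    note db = duhamel_bound[where s = a and R = R and F = F and u = v and \<gamma> = \<gamma> and g = "path_deriv \<gamma>" and B = B
        and X = X and T = T and y = ?y and z = ?z and d = d]
    have "norm (?y a) \<le> (d + ?P) * exp (?P + 2 * ?Q) \<and> norm (?z a) / norm v \<le> (d + ?P) * exp (?P + 2 * ?Q)"
    proof (rule db)
      fix t assume "t \<in> {a<..<R} - F"
      then have t: "t > a" "t \<ge> a" "t \<notin> F" "t \<in> interior {a..}" "t \<in> {a..R} - F" by (auto simp: interior_real_atLeast)
      have dg: "(\<gamma> has_vector_derivative path_deriv \<gamma> t) (at t)" using F(2) t by blast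
      have gD: "\<gamma> t \<in> \<Delta>" using im t by auto
      note dY = section_along_derivative[OF Y t(4) dg]
      have "(S has_vector_derivative (\<Sum>s = 1..N - 1. (path_deriv \<gamma> t * F_coeff \<psi> s (\<gamma> t) - 0) / v ^ s)) (at t)"
        unfolding S_def
        by (intro has_vector_derivative_sum has_vector_derivative_divide has_vector_derivative_diff
            branched_antiderivative_along(2)[OF E lp t(1) dg] has_vector_derivative_const) auto
      moreover have "(\<Sum>s = 1..N - 1. (path_deriv \<gamma> t * F_coeff \<psi> s (\<gamma> t) - 0) / v ^ s) = path_deriv \<gamma> t * p t"
        unfolding p_def T_def T_fun_over_u[OF v] by (simp add: sum_distrib_left)
      ultimately have dS: "(S has_vector_derivative path_deriv \<gamma> t * p t) (at t)" by simp
      have de: "(e has_vector_derivative ((- v * path_deriv \<gamma> t - path_deriv \<gamma> t * p t) * e t)) (at t)"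
        using field_vector_diff_chain_at[OF has_vector_derivative_diff[OF has_vector_derivative_mult_right[OF dg, of "- v"] dS] DERIV_exp]
        unfolding e_def by (simp add: o_def)
      have "(T_fun \<psi> N v has_field_derivative deriv (T_fun \<psi> N v) (\<gamma> t)) (at (\<gamma> t))"
        by (rule holomorphic_derivI[OF T_fun_holomorphic[OF D v] D(1) gD])
      from field_vector_diff_chain_at[OF dg this]
      have "(T has_vector_derivative path_deriv \<gamma> t * deriv (T_fun \<psi> N v) (\<gamma> t)) (at t)"
        unfolding T_def[abs_def] by (simp add: o_def)
      from has_vector_derivative_divide[OF this, of v]
      have dp: "(p has_vector_derivative path_deriv \<gamma> t * (deriv (T_fun \<psi> N v) (\<gamma> t) / v)) (at t)"
        unfolding p_def[abs_def] by simp
      \<comment> \<open>Differentiating \<open>?z\<close> leaves the coefficient v^2 + psi - P' -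
        P^2 with P = v + p in front of 1 + h, and the Riccati identity says that this is
        \<open>X t\<close>.\<close>
      have Xeq: "X t = \<psi> (\<gamma> t) - 2 * v * p t - deriv (T_fun \<psi> N v) (\<gamma> t) / v - (p t)\<^sup>2"
        unfolding X_def chi_fun_identity[OF D gD v N, symmetric] p_def T_def using v by simp
      show "(\<gamma> has_vector_derivative path_deriv \<gamma> t) (at t)" by (rule dg)
      show "isCont (path_deriv \<gamma>) t" using F(3) t by blast
      show "norm (path_deriv \<gamma> t) \<le> B" using B t by blast
      show "(?y has_vector_derivative path_deriv \<gamma> t * ?z t) (at t)"
        by (rule has_vector_derivative_eq_rhs[OF has_vector_derivative_diff[OF
            has_vector_derivative_mult[OF de dY(1)] has_vector_derivative_const]])
          (simp add: algebra_simps)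
      define dT where "dT = deriv (T_fun \<psi> N v) (\<gamma> t) / v"
      show "(?z has_vector_derivative path_deriv \<gamma> t * (X t * (1 + ?y t) - 2 * (v + T t / v) * ?z t)) (at t)"
        unfolding p_def[symmetric] Xeq
        by (rule has_vector_derivative_eq_rhs[OF
            has_vector_derivative_mult[OF de has_vector_derivative_diff[OF dY(2)
              has_vector_derivative_mult[OF has_vector_derivative_add[OF has_vector_derivative_const dp] dY(1)]]]])
          (simp only: dT_def[symmetric], simp add: algebra_simps power2_eq_square)
    next
      show "norm (?y R) + norm (?z R) / norm v \<le> d" by (rule R(2))
    qed (use R(1) v F(1) mono in \<open>auto intro!: continuous_intros cR cg cX cT ce cY cp\<close>)
    \<comment> \<open>N - 1 powers of \<open>v\<close> come from the residual \<open>X\<close>, the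
      last one from the Duhamel estimate.\<close>
    moreover have "?P \<le> C"
    proof -
      have "(\<lambda>t. norm (X t) * norm (path_deriv \<gamma> t)) =
          (\<lambda>t. norm (chi_fun \<psi> N v (\<gamma> t)) * norm (path_deriv \<gamma> t) / norm v ^ (N - 1))"
        unfolding X_def by (simp add: norm_divide norm_power)
      then have "?P = integral {a..R} (\<lambda>t. norm (chi_fun \<psi> N v (\<gamma> t)) * norm (path_deriv \<gamma> t)) / norm v ^ N"
        using N v by (simp add: power_eq_if)
      also have "\<dots> \<le> arclength_integral (chi_fun \<psi> N v) \<gamma> a / norm v ^ N"
        by (intro divide_right_mono arclength_integral_Icc_le(1)[OF int(1)]) auto
      finally show ?thesis by (simp add: C_def)
    qed
    \<comment> \<open>The estimate along the path gives the constant 2; it is relaxed to the 4 of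
      the stated bound.\<close>
    moreover have "2 * ?Q \<le> 4 / norm v * arclength_integral (T_fun \<psi> N v) \<gamma> a"
    proof -
      have "?Q \<le> arclength_integral (T_fun \<psi> N v) \<gamma> a / norm v"
        unfolding T_def by (intro divide_right_mono arclength_integral_Icc_le(1)[OF int(2)]) auto
      moreover have "0 \<le> arclength_integral (T_fun \<psi> N v) \<gamma> a / norm v" by (simp add: arclength_integral_nonneg)
      ultimately have "2 * ?Q \<le> 4 * (arclength_integral (T_fun \<psi> N v) \<gamma> a / norm v)" by linarith
      then show ?thesis by simp
    qed
    moreover from calculation have "(d + ?P) * exp (?P + 2 * ?Q) \<le> (d + C) * K"
      unfolding K_def using C d by (intro mult_mono) auto
    ultimately show ?thesis by linarith
  qed
  \<comment> \<open>\<open>C\<close> and \<open>K\<close> do not depend on the starting point R, so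
    the initial size \<open>d\<close> can be sent to 0; \<open>x / K\<close> is the \<open>d\<close>
    that costs exactly \<open>x\<close>.\<close>
  have "norm (?y a) \<le> C * K"
  proof (rule field_le_epsilon)
    fix x :: real assume x: "x > 0"
    have K: "K > 0" by (simp add: K_def)
    have "norm (?y a) \<le> (x / K + C) * K" by (rule main) (use x K in auto)
    also have "(x / K + C) * K = C * K + x" using K by (simp add: field_simps)
    finally show "norm (?y a) \<le> C * K + x" .
  qed
  then show ?thesis unfolding K_def e_def S_def .
qed

text \<open>Both solutions at once: \<open>v\<close> is u for j = 1 and -u for j = 2. In either case
  Re (v t) is nonincreasing in the parameter of a progressive path and tends to minus infinity, so
  e^(v xi) is the recessive exponential at the infinite end.\<close>

lemma liouville_green_solution:
  assumes D: "open \<Delta>" "\<psi> holomorphic_on \<Delta>" and v: "v \<noteq> 0" and vu: "v = - ((- 1) ^ j * u)"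
    and A: "arc_to_infinity \<Delta> A j u"
    and E: "\<forall>s\<ge>1. branched_antiderivative \<Delta> A (F_coeff \<psi> s) (E s)"
    and lim: "\<forall>\<gamma> a s. progressive_path \<Delta> A j u \<gamma> a \<longrightarrow> s \<ge> 1 \<longrightarrow> limit_at_infinity_exists (E s) \<gamma>"
    and int: "\<forall>\<gamma> a n r. progressive_path \<Delta> A j u \<gamma> a \<longrightarrow> n \<ge> 1 \<longrightarrow> r \<ge> 1 \<longrightarrow>
       arclength_integrable (chi_fun \<psi> (n + r) v) \<gamma> a \<and> arclength_integrable (T_fun \<psi> (n + r) v) \<gamma> a"
  shows "\<exists>(W :: branched) (\<epsilon> :: nat \<Rightarrow> (real \<Rightarrow> complex) \<Rightarrow> real \<Rightarrow> complex).
    branched_solution \<Delta> A \<psi> v W \<and>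
    (\<forall>n \<gamma> a. value_at_end W \<gamma> a =
         exp (S_sum (\<lambda>s. value_at_end (E s) \<gamma> a) n v - S_sum (\<lambda>s. value_at_infinity (E s) \<gamma>) n v)
         * (exp (v * \<gamma> a) + \<epsilon> n \<gamma> a)) \<and>
    (\<forall>n\<ge>1. \<forall>r\<ge>1. \<forall>\<gamma> a. progressive_path \<Delta> A j u \<gamma> a \<longrightarrow>
       norm (exp (- v * \<gamma> a) * \<epsilon> n \<gamma> a) \<le>
         norm (exp (\<Sum>s = n..n + r - 1. (value_at_end (E s) \<gamma> a - value_at_infinity (E s) \<gamma>) / v ^ s) - 1)
         + 1 / norm v ^ (n + r) * arclength_integral (chi_fun \<psi> (n + r) v) \<gamma> a
           * exp (4 / norm v * arclength_integral (T_fun \<psi> (n + r) v) \<gamma> a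
                + 1 / norm v ^ (n + r) * arclength_integral (chi_fun \<psi> (n + r) v) \<gamma> a
                + Re (\<Sum>s = n..n + r - 1. (value_at_end (E s) \<gamma> a - value_at_infinity (E s) \<gamma>) / v ^ s)))"
proof -
  note E = E[rule_format] and lim = lim[rule_format] and int = int[rule_format]
  define q where "q z = v\<^sup>2 + \<psi> z" for z
  have re: "Re ((- 1) ^ j * u * x) = - Re (v * x)" for x unfolding vu by simp
  have prog_lp: "linking_path \<Delta> A \<gamma> a"
    and prog_mono: "\<And>s t. a \<le> s \<Longrightarrow> s \<le> t \<Longrightarrow> Re (v * \<gamma> t) \<le> Re (v * \<gamma> s)"
    if "progressive_path \<Delta> A j u \<gamma> a" for \<gamma> a
  proof -
    show "linking_path \<Delta> A \<gamma> a" using that by (simp add: progressive_path_def)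
    have "mono_on {a..} (\<lambda>\<tau>. - Re (v * \<gamma> \<tau>))" using that unfolding progressive_path_def re by blast
    then show "Re (v * \<gamma> t) \<le> Re (v * \<gamma> s)" if "a \<le> s" "s \<le> t" for s t
      using that mono_onD[of "{a..}" "\<lambda>\<tau>. - Re (v * \<gamma> \<tau>)" s t] by auto
  qed
  have evA: "\<forall>\<^sub>F \<tau> in at_top. \<gamma> \<tau> = A \<tau>" if "linking_path \<Delta> A \<gamma> a" for \<gamma> a
    using that by (simp add: linking_path_def)
  have "\<exists>b Y0. 0 \<le> b \<and> section_along q A {b..} Y0 \<and>
    ((\<exists>\<gamma> a. progressive_path \<Delta> A j u \<gamma> a) \<longrightarrow>
      ((\<lambda>t. exp (- v * A t) * fst (Y0 t)) \<longlongrightarrow> 1) at_top \<and>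
      ((\<lambda>t. exp (- v * A t) * (snd (Y0 t) - v * fst (Y0 t))) \<longlongrightarrow> 0) at_top)"
  proof (cases "\<exists>\<gamma> a. progressive_path \<Delta> A j u \<gamma> a")
    case True
    then obtain \<gamma> a where pr: "progressive_path \<Delta> A j u \<gamma> a" by blast
    \<comment> \<open>The tail of any progressive path is a tail of the arc, so the arc is itself
      progressive from \<open>b\<close> on, and the integrability hypotheses apply to it.\<close>
    obtain m where m: "\<And>t. t \<ge> m \<Longrightarrow> \<gamma> t = A t"
      using evA[OF prog_lp[OF pr]] unfolding eventually_at_top_linorder by blast
    define b where "b = max m (max a 0)"
    have b: "b \<ge> m" "b \<ge> a" "b \<ge> 0" by (auto simp: b_def)
    have lpA: "linking_path \<Delta> A A b" by (rule arc_to_infinity_linking[OF A b(3)])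
    have moA: "Re (v * A t) \<le> Re (v * A s)" if "b \<le> s" "s \<le> t" for s t
      using prog_mono[OF pr, of s t] m[of s] m[of t] that b by simp
    have "mono_on {b..} (\<lambda>\<tau>. - Re (v * A \<tau>))"
      by (rule mono_onI, rule le_imp_neg_le, rule moA) auto
    then have "progressive_path \<Delta> A j u A b"
      unfolding progressive_path_def re using lpA by blast
    \<comment> \<open>T_2 = F_1 = psi/2, so n = r = 1 gives the integrability of psi that the
      construction of the solution requires.\<close>
    then have "arclength_integrable (T_fun \<psi> (1 + 1) v) A b" using int by blast
    then have "(\<lambda>\<tau>. norm (\<psi> (A \<tau>)) * norm (path_deriv A \<tau>) / 2) integrable_on {b..}"
      unfolding arclength_integrable_def T_fun_def by (simp add: norm_divide)
    from integrable_on_mult_right[OF this, of 2] have "arclength_integrable \<psi> A b"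
      unfolding arclength_integrable_def by simp
    from recessive_section_exists[OF D v lpA moA this] b(3) show ?thesis unfolding q_def by blast
  next
    case False
    \<comment> \<open>Without progressive paths there is no error bound to prove and no convergent
      integral to build a recessive solution from; the zero section is taken for
      \<open>Y0\<close>.\<close>
    then show ?thesis using section_along_zero[of q A "{0..}"]
      by (intro exI[of _ 0] exI[of _ "\<lambda>_. (0, 0)"]) blast
  qed
  then obtain b Y0 where b: "0 \<le> b" and Y0: "section_along q A {b..} Y0"
    and Y0lim: "\<And>\<gamma> a. progressive_path \<Delta> A j u \<gamma> a \<Longrightarrow> ((\<lambda>t. exp (- v * A t) * fst (Y0 t)) \<longlongrightarrow> 1) at_top"
    "\<And>\<gamma> a. progressive_path \<Delta> A j u \<gamma> a \<Longrightarrow> ((\<lambda>t. exp (- v * A t) * (snd (Y0 t) - v * fst (Y0 t))) \<longlongrightarrow> 0) at_top"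
    by blast
  obtain W where W: "branched_solution \<Delta> A \<psi> v W"
    and WY: "\<And>\<gamma> a. linking_path \<Delta> A \<gamma> a \<Longrightarrow> \<exists>Y. section_along q \<gamma> {a..} Y \<and>
       (\<forall>\<^sub>F \<sigma> in at_top. Y \<sigma> = Y0 \<sigma>) \<and> (\<forall>\<tau>\<ge>a. W \<gamma> \<tau> (\<gamma> \<tau>) = fst (Y \<tau>))"
    using branched_solution_exists[OF D A b Y0[unfolded q_def]] unfolding q_def by blast
  define Sd where "Sd n \<gamma> a = S_sum (\<lambda>s. value_at_end (E s) \<gamma> a) n v - S_sum (\<lambda>s. value_at_infinity (E s) \<gamma>) n v" for n \<gamma> a
  \<comment> \<open>The error is defined by solving the representation of the solution for it, so
    the representation holds for every n and every path; the content is in the bound.\<close>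
  define \<epsilon> where "\<epsilon> n \<gamma> a = value_at_end W \<gamma> a / exp (Sd n \<gamma> a) - exp (v * \<gamma> a)" for n \<gamma> a
  have Sd: "Sd n \<gamma> a = (\<Sum>s = 1..n - 1. (value_at_end (E s) \<gamma> a - value_at_infinity (E s) \<gamma>) / v ^ s)" for n \<gamma> a
    unfolding Sd_def S_sum_def by (simp add: sum_subtractf[symmetric] diff_divide_distrib)
  have bound: "norm (exp (- v * \<gamma> a) * \<epsilon> n \<gamma> a) \<le>
         norm (exp (\<Sum>s = n..n + r - 1. (value_at_end (E s) \<gamma> a - value_at_infinity (E s) \<gamma>) / v ^ s) - 1)
         + 1 / norm v ^ (n + r) * arclength_integral (chi_fun \<psi> (n + r) v) \<gamma> a
           * exp (4 / norm v * arclength_integral (T_fun \<psi> (n + r) v) \<gamma> a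
                + 1 / norm v ^ (n + r) * arclength_integral (chi_fun \<psi> (n + r) v) \<gamma> a
                + Re (\<Sum>s = n..n + r - 1. (value_at_end (E s) \<gamma> a - value_at_infinity (E s) \<gamma>) / v ^ s))"
    if n: "n \<ge> 1" and r: "r \<ge> 1" and pr: "progressive_path \<Delta> A j u \<gamma> a" for n r \<gamma> a
  proof -
    note lp = prog_lp[OF pr]
    obtain Y where Y: "section_along q \<gamma> {a..} Y" "\<forall>\<^sub>F \<sigma> in at_top. Y \<sigma> = Y0 \<sigma>" "\<forall>\<tau>\<ge>a. W \<gamma> \<tau> (\<gamma> \<tau>) = fst (Y \<tau>)"
      using WY[OF lp] by blast
    have ev: "\<forall>\<^sub>F t in at_top. \<gamma> t = A t \<and> Y t = Y0 t" by (intro eventually_conj evA[OF lp] Y(2))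
    have YL1: "((\<lambda>t. exp (- v * \<gamma> t) * fst (Y t)) \<longlongrightarrow> 1) at_top"
      by (rule Lim_transform_eventually[OF Y0lim(1)[OF pr]]) (rule eventually_mono[OF ev], simp)
    have YL2: "((\<lambda>t. exp (- v * \<gamma> t) * (snd (Y t) - v * fst (Y t))) \<longlongrightarrow> 0) at_top"
      by (rule Lim_transform_eventually[OF Y0lim(2)[OF pr]]) (rule eventually_mono[OF ev], simp)
    have "filterlim (\<lambda>t. Re ((- 1) ^ j * u * A t)) at_top at_top"
      using A unfolding arc_to_infinity_def by (cases "even j") (auto simp: mult.assoc)
    then have "filterlim (\<lambda>t. Re (v * A t)) at_bot at_top"
      unfolding re by (simp add: filterlim_uminus_at_top)
    then have inf: "filterlim (\<lambda>t. Re (v * \<gamma> t)) at_bot at_top"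
      by (rule filterlim_cong[THEN iffD1, rotated -1]) (auto intro: eventually_mono[OF ev])
    have l: "((\<lambda>\<tau>. E s \<gamma> \<tau> (\<gamma> \<tau>)) \<longlongrightarrow> value_at_infinity (E s) \<gamma>) at_top" if "s \<ge> 1" for s
      using lim[OF pr that] tendsto_Lim[OF trivial_limit_at_top_linorder]
      unfolding limit_at_infinity_exists_def value_at_infinity_def by fastforce
    define N where "N = n + r"
    have N: "N \<ge> 1" unfolding N_def using n by simp
    define Dn where "Dn = (\<Sum>s = n..N - 1. (value_at_end (E s) \<gamma> a - value_at_infinity (E s) \<gamma>) / v ^ s)"
    define C where "C = 1 / norm v ^ N * arclength_integral (chi_fun \<psi> N v) \<gamma> a"
    define B where "B = 4 / norm v * arclength_integral (T_fun \<psi> N v) \<gamma> a"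
    define h where "h = exp (- v * \<gamma> a - Sd N \<gamma> a) * value_at_end W \<gamma> a - 1"
    have "fst (Y a) = value_at_end W \<gamma> a" using Y(3) by (simp add: value_at_end_def)
    then have h: "norm h \<le> C * exp (B + C)"
      using recessive_error_bound[OF D v lp prog_mono[OF pr] inf E l N _ _ Y(1)[unfolded q_def] YL1 YL2] int[OF pr n r]
      unfolding h_def C_def B_def Sd N_def value_at_end_def by simp
    have SN: "Sd N \<gamma> a = Sd n \<gamma> a + Dn"
    proof -
      have "{1..N - 1} = {1..n - 1} \<union> {n..N - 1}" "{1..n - 1} \<inter> {n..N - 1} = {}"
        using n r unfolding N_def by auto
      then show ?thesis unfolding Sd Dn_def by (simp add: sum.union_disjoint)
    qed
    \<comment> \<open>Passing from N back to n multiplies 1 + h by exp(Dn). Splitting off exp(Dn) -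
      1 gives the first summand of the bound, and |exp(Dn)| = exp(Re Dn) moves the real part into
      the exponent of the second.\<close>
    have "exp (- v * \<gamma> a) * \<epsilon> n \<gamma> a = exp Dn * (1 + h) - 1"
      unfolding \<epsilon>_def h_def SN by (simp add: exp_diff exp_add exp_minus field_simps)
    also have "\<dots> = (exp Dn - 1) + exp Dn * h" by (simp add: algebra_simps)
    finally have "norm (exp (- v * \<gamma> a) * \<epsilon> n \<gamma> a) \<le> norm (exp Dn - 1) + norm (exp Dn * h)"
      by (simp only: norm_triangle_ineq)
    also have "norm (exp Dn * h) \<le> exp (Re Dn) * (C * exp (B + C))"
      unfolding norm_mult norm_exp_eq_Re by (intro mult_left_mono h) simp
    also have "\<dots> = C * exp (B + C + Re Dn)" by (simp add: exp_add)
    finally show ?thesis unfolding C_def B_def Dn_def N_def by simp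
  qed
  have "value_at_end W \<gamma> a = exp (Sd n \<gamma> a) * (exp (v * \<gamma> a) + \<epsilon> n \<gamma> a)" for n \<gamma> a
    unfolding \<epsilon>_def by simp
  with W bound show ?thesis unfolding Sd_def by blast
qed

text \<open>The error terms are functions of n and of the path with its end parameter, but not of r,
  so the bounds for all r concern the same error. Each bound refers to the branch reached along the
  path over which its integrals are taken.\<close>

theorem theorem1p2:
  fixes \<Delta> :: "complex set" and \<psi> :: "complex \<Rightarrow> complex" and u :: complex
    and A1 A2 :: "real \<Rightarrow> complex" and E :: "nat \<Rightarrow> branched"
  assumes "open \<Delta>" "connected \<Delta>" "\<not> bounded \<Delta>"
    and "\<psi> holomorphic_on \<Delta>"
    and "u \<noteq> 0"
    and "arc_to_infinity \<Delta> A1 1 u" "arc_to_infinity \<Delta> A2 2 u"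
    and "\<And>s. s \<ge> 1 \<Longrightarrow> branched_antiderivative \<Delta> A1 (F_coeff \<psi> s) (E s)"
    and "\<And>s. s \<ge> 1 \<Longrightarrow> branched_antiderivative \<Delta> A2 (F_coeff \<psi> s) (E s)"
    and "\<And>\<gamma> a s. progressive_path \<Delta> A1 1 u \<gamma> a \<Longrightarrow> s \<ge> 1 \<Longrightarrow> limit_at_infinity_exists (E s) \<gamma>"
    and "\<And>\<gamma> a s. progressive_path \<Delta> A2 2 u \<gamma> a \<Longrightarrow> s \<ge> 1 \<Longrightarrow> limit_at_infinity_exists (E s) \<gamma>"
    and "\<And>\<gamma> a n r. progressive_path \<Delta> A1 1 u \<gamma> a \<Longrightarrow> n \<ge> 1 \<Longrightarrow> r \<ge> 1 \<Longrightarrow>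
           arclength_integrable (chi_fun \<psi> (n + r) u) \<gamma> a \<and>
           arclength_integrable (T_fun \<psi> (n + r) u) \<gamma> a"
    and "\<And>\<gamma> a n r. progressive_path \<Delta> A2 2 u \<gamma> a \<Longrightarrow> n \<ge> 1 \<Longrightarrow> r \<ge> 1 \<Longrightarrow>
           arclength_integrable (chi_fun \<psi> (n + r) (- u)) \<gamma> a \<and>
           arclength_integrable (T_fun \<psi> (n + r) (- u)) \<gamma> a"
  shows "\<exists>(W1 :: branched) (W2 :: branched)
            (\<epsilon>1 :: nat \<Rightarrow> (real \<Rightarrow> complex) \<Rightarrow> real \<Rightarrow> complex)
            (\<epsilon>2 :: nat \<Rightarrow> (real \<Rightarrow> complex) \<Rightarrow> real \<Rightarrow> complex).
    branched_solution \<Delta> A1 \<psi> u W1 \<and> branched_solution \<Delta> A2 \<psi> u W2 \<and>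
    (\<forall>n\<ge>1. \<forall>\<gamma> a. linking_path \<Delta> A1 \<gamma> a \<longrightarrow>
       value_at_end W1 \<gamma> a =
         exp (S_sum (\<lambda>s. value_at_end (E s) \<gamma> a) n u - S_sum (\<lambda>s. value_at_infinity (E s) \<gamma>) n u)
         * (exp (u * \<gamma> a) + \<epsilon>1 n \<gamma> a)) \<and>
    (\<forall>n\<ge>1. \<forall>\<gamma> a. linking_path \<Delta> A2 \<gamma> a \<longrightarrow>
       value_at_end W2 \<gamma> a =
         exp (S_sum (\<lambda>s. value_at_end (E s) \<gamma> a) n (- u) - S_sum (\<lambda>s. value_at_infinity (E s) \<gamma>) n (- u))
         * (exp (- u * \<gamma> a) + \<epsilon>2 n \<gamma> a)) \<and>
    (\<forall>n\<ge>1. \<forall>r\<ge>1. \<forall>\<xi>\<in>Xi \<Delta> A1 1 u. \<forall>\<gamma> a. progressive_path \<Delta> A1 1 u \<gamma> a \<and> \<gamma> a = \<xi> \<longrightarrow>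
       norm (exp (- u * \<xi>) * \<epsilon>1 n \<gamma> a) \<le>
         norm (exp (\<Sum>s = n..n + r - 1. (value_at_end (E s) \<gamma> a - value_at_infinity (E s) \<gamma>) / u ^ s) - 1)
         + 1 / norm u ^ (n + r) * arclength_integral (chi_fun \<psi> (n + r) u) \<gamma> a
           * exp (4 / norm u * arclength_integral (T_fun \<psi> (n + r) u) \<gamma> a
                + 1 / norm u ^ (n + r) * arclength_integral (chi_fun \<psi> (n + r) u) \<gamma> a
                + Re (\<Sum>s = n..n + r - 1. (value_at_end (E s) \<gamma> a - value_at_infinity (E s) \<gamma>) / u ^ s))) \<and>
    (\<forall>n\<ge>1. \<forall>r\<ge>1. \<forall>\<xi>\<in>Xi \<Delta> A2 2 u. \<forall>\<gamma> a. progressive_path \<Delta> A2 2 u \<gamma> a \<and> \<gamma> a = \<xi> \<longrightarrow>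
       norm (exp (u * \<xi>) * \<epsilon>2 n \<gamma> a) \<le>
         norm (exp (\<Sum>s = n..n + r - 1. (-1) ^ s * (value_at_end (E s) \<gamma> a - value_at_infinity (E s) \<gamma>) / u ^ s) - 1)
         + 1 / norm u ^ (n + r) * arclength_integral (chi_fun \<psi> (n + r) (- u)) \<gamma> a
           * exp (4 / norm u * arclength_integral (T_fun \<psi> (n + r) (- u)) \<gamma> a
                + 1 / norm u ^ (n + r) * arclength_integral (chi_fun \<psi> (n + r) (- u)) \<gamma> a
                + Re (\<Sum>s = n..n + r - 1. (-1) ^ s * (value_at_end (E s) \<gamma> a - value_at_infinity (E s) \<gamma>) / u ^ s)))"
proof -
  have vu: "u = - ((- 1) ^ 1 * u)" "- u = - ((- 1) ^ 2 * u)" by simp_all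
  have "- u \<noteq> 0" using assms(5) by simp
  have p1: "\<forall>s\<ge>1. branched_antiderivative \<Delta> A1 (F_coeff \<psi> s) (E s)"
    "\<forall>\<gamma> a s. progressive_path \<Delta> A1 1 u \<gamma> a \<longrightarrow> s \<ge> 1 \<longrightarrow> limit_at_infinity_exists (E s) \<gamma>"
    "\<forall>\<gamma> a n r. progressive_path \<Delta> A1 1 u \<gamma> a \<longrightarrow> n \<ge> 1 \<longrightarrow> r \<ge> 1 \<longrightarrow>
       arclength_integrable (chi_fun \<psi> (n + r) u) \<gamma> a \<and> arclength_integrable (T_fun \<psi> (n + r) u) \<gamma> a"
    and p2: "\<forall>s\<ge>1. branched_antiderivative \<Delta> A2 (F_coeff \<psi> s) (E s)"
    "\<forall>\<gamma> a s. progressive_path \<Delta> A2 2 u \<gamma> a \<longrightarrow> s \<ge> 1 \<longrightarrow> limit_at_infinity_exists (E s) \<gamma>"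
    "\<forall>\<gamma> a n r. progressive_path \<Delta> A2 2 u \<gamma> a \<longrightarrow> n \<ge> 1 \<longrightarrow> r \<ge> 1 \<longrightarrow>
       arclength_integrable (chi_fun \<psi> (n + r) (- u)) \<gamma> a \<and> arclength_integrable (T_fun \<psi> (n + r) (- u)) \<gamma> a"
    using assms(8-13) by blast+
  from liouville_green_solution[OF assms(1,4,5) vu(1) assms(6) p1]
  obtain W1 \<epsilon>1 where W1: "branched_solution \<Delta> A1 \<psi> u W1"
    "\<And>n \<gamma> a. value_at_end W1 \<gamma> a =
         exp (S_sum (\<lambda>s. value_at_end (E s) \<gamma> a) n u - S_sum (\<lambda>s. value_at_infinity (E s) \<gamma>) n u)
         * (exp (u * \<gamma> a) + \<epsilon>1 n \<gamma> a)"
    "\<And>n r \<gamma> a. n \<ge> 1 \<Longrightarrow> r \<ge> 1 \<Longrightarrow> progressive_path \<Delta> A1 1 u \<gamma> a \<Longrightarrow>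
       norm (exp (- u * \<gamma> a) * \<epsilon>1 n \<gamma> a) \<le>
         norm (exp (\<Sum>s = n..n + r - 1. (value_at_end (E s) \<gamma> a - value_at_infinity (E s) \<gamma>) / u ^ s) - 1)
         + 1 / norm u ^ (n + r) * arclength_integral (chi_fun \<psi> (n + r) u) \<gamma> a
           * exp (4 / norm u * arclength_integral (T_fun \<psi> (n + r) u) \<gamma> a
                + 1 / norm u ^ (n + r) * arclength_integral (chi_fun \<psi> (n + r) u) \<gamma> a
                + Re (\<Sum>s = n..n + r - 1. (value_at_end (E s) \<gamma> a - value_at_infinity (E s) \<gamma>) / u ^ s))"
    by blast
  from liouville_green_solution[OF assms(1,4) \<open>- u \<noteq> 0\<close> vu(2) assms(7) p2]
  obtain W2 \<epsilon>2 where W2: "branched_solution \<Delta> A2 \<psi> (- u) W2"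
    "\<And>n \<gamma> a. value_at_end W2 \<gamma> a =
         exp (S_sum (\<lambda>s. value_at_end (E s) \<gamma> a) n (- u) - S_sum (\<lambda>s. value_at_infinity (E s) \<gamma>) n (- u))
         * (exp (- u * \<gamma> a) + \<epsilon>2 n \<gamma> a)"
    "\<And>n r \<gamma> a. n \<ge> 1 \<Longrightarrow> r \<ge> 1 \<Longrightarrow> progressive_path \<Delta> A2 2 u \<gamma> a \<Longrightarrow>
       norm (exp (- (- u) * \<gamma> a) * \<epsilon>2 n \<gamma> a) \<le>
         norm (exp (\<Sum>s = n..n + r - 1. (value_at_end (E s) \<gamma> a - value_at_infinity (E s) \<gamma>) / (- u) ^ s) - 1)
         + 1 / norm (- u) ^ (n + r) * arclength_integral (chi_fun \<psi> (n + r) (- u)) \<gamma> a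
           * exp (4 / norm (- u) * arclength_integral (T_fun \<psi> (n + r) (- u)) \<gamma> a
                + 1 / norm (- u) ^ (n + r) * arclength_integral (chi_fun \<psi> (n + r) (- u)) \<gamma> a
                + Re (\<Sum>s = n..n + r - 1. (value_at_end (E s) \<gamma> a - value_at_infinity (E s) \<gamma>) / (- u) ^ s))"
    by blast
  \<comment> \<open>The equation contains only the square of u, so the solution constructed for -u
    solves it for u; the powers of -u in its bound account for the signs (-1)^s.\<close>
  have sol2: "branched_solution \<Delta> A2 \<psi> u W2"
    using W2(1) unfolding branched_solution_def by simp
  have sgn: "x / (- u) ^ s = (- 1) ^ s * x / u ^ s" for x s
    by (cases "even s") auto
  show ?thesis
    by (rule exI[of _ W1], rule exI[of _ W2], rule exI[of _ \<epsilon>1], rule exI[of _ \<epsilon>2])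
      (use W1 sol2 W2(2) W2(3)[unfolded sgn minus_minus norm_minus_cancel] in blast)
qed

end
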